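(* Let $F$ be a field of characteristic different from two, let $a_1,a_2\in F\setminus\{-2,2\}$ be such that $\alpha_i=a_i^2-4$ is not a square in $F$ for $i=1,2$, and let $(V,b)=(F^2,b_{a_1})\otimes_F(F^2,b_{a_2})$. The invariant $$\widetilde{\nu}:H^1(-,\mathbf{GO}(b))\to H^2(-,\mathbb{Z}/2\mathbb{Z})/\langle(\alpha_1)\cup(\alpha_2)\rangle$$ detects decomposability. In other words, for any field extension $E/F$ and any non-degenerate $E$-bilinear space $(V',b')$ whose asymmetry is conjugate to the asymmetry of $(V,b)_E$, we have $\widetilde{\nu}_E(b')=0$ if and only if $(V',b')$ is decomposable (over $E$).
   Context: For $a\in F\setminus\{2\}$, $b_a$ is the bilinear form on $F^2$ with matrix $\begin{pmatrix}1&1\\0&\frac{1}{2-a}\end{pmatrix}$ in the canonical basis. A bilinear space is a finite-dimensional vector space with a bilinear form (no symmetry assumed). The asymmetry of a non-degenerate form $b$ on $V$ is the unique endomorphism $a_b$ with $b(x,y)=b(y,a_b(x))$ for all $x,y\in V$; asymmetries are conjugate if they correspond under some linear isomorphism of the underlying spaces. Similar means isomorphic up to a nonzero scalar factor. $(V,b)$ is decomposable if it is isomorphic to a tensor product of two bilinear spaces of dimension $\geq2$. $\mathbf{GO}(b)$ is the algebraic group of similitudes of $(V,b)$; for each field extension $E/F$, $H^1(E,\mathbf{GO}(b))$ is the pointed set of similarity classes of non-degenerate $E$-bilinear spaces whose asymmetry is conjugate to that of $(V,b)_E$. Let $L=F[\sqrt{\alpha_1}]\otimes_FF[\sqrt{\alpha_2}]$,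 where $F[\sqrt{\alpha}]=F[T]/(T^2-\alpha)$, let $K=F[\sqrt{\alpha_1}\otimes\sqrt{\alpha_2}]\subset L$, and $K_E=E\otimes_FK$, $L_E=E\otimes_FL$. The set $H^1(E,\mathbf{GO}(b))$ is identified with the group $K_E^\times/E^\times N_{L_E/K_E}(L_E^\times)$: the class $[r+s\sqrt{\alpha_1}\otimes\sqrt{\alpha_2}]$ corresponds to the similarity class of the form $(x,y)\mapsto b_E(x,u^{-1}(y))$ on $V_E$, where $u=r\,\mathrm{Id}+s(2a_{b_{a_1}}-a_1\mathrm{Id})\otimes(2a_{b_{a_2}}-a_2\mathrm{Id})$. For $x\in E^\times$, $(x)\in H^1(E,\mathbb{Z}/2\mathbb{Z})$ is the class of $x$ under $H^1(E,\mathbb{Z}/2\mathbb{Z})\simeq E^\times/E^{\times2}$. Define $\nu_E:H^1(E,\mathbf{GO}(b))\to H^2(E,\mathbb{Z}/2\mathbb{Z})$ by $\nu_E([u])=(\alpha_1)\cup(N_{K_E/E}(u))$ for $u\in K_E^\times$, and let $\widetilde{\nu}_E$ be the composition of $\nu_E$ with the projection $H^2(E,\mathbb{Z}/2\mathbb{Z})\to H^2(E,\mathbb{Z}/2\mathbb{Z})/\langle(\alpha_1)_E\cup(\alpha_2)_E\rangle$. *)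

theory Defs
  imports
    "HOL-Analysis.Analysis"
    "HOL-Algebra.Coset"
    "HOL-Algebra.Generated_Groups"
    "HOL-Computational_Algebra.Polynomial"
    "HOL-Library.Function_Algebras"
    "HOL-Library.Z2"
begin

section \<open>Bilinear spaces\<close>

text \<open>
  The underlying vector space of a bilinear space is a finite-dimensional subspace
  \<open>carr W\<close> of some ambient vector space with scalar multiplication \<open>scal W\<close>; addition is
  that of the ambient type. Only the values of \<open>bform W\<close> on \<open>carr W\<close> matter.
\<close>

record ('k, 'v) bilin =
  scal :: "'k \<Rightarrow> 'v \<Rightarrow> 'v"
  carr :: "'v set"
  bform :: "'v \<Rightarrow> 'v \<Rightarrow> 'k"

definition linear_on :: "('k \<Rightarrow> 'v \<Rightarrow> 'v) \<Rightarrow> 'v set \<Rightarrow> ('k \<Rightarrow> 'w \<Rightarrow> 'w) \<Rightarrow> 'w set \<Rightarrow>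
    ('v::ab_group_add \<Rightarrow> 'w::ab_group_add) \<Rightarrow> bool" where
  "linear_on s V s' V' f \<longleftrightarrow>
     (\<forall>x\<in>V. f x \<in> V') \<and>
     (\<forall>x\<in>V. \<forall>y\<in>V. f (x + y) = f x + f y) \<and>
     (\<forall>c. \<forall>x\<in>V. f (s c x) = s' c (f x))"

definition bilinear_on :: "('k \<Rightarrow> 'v \<Rightarrow> 'v) \<Rightarrow> 'v set \<Rightarrow> ('k \<Rightarrow> 'w \<Rightarrow> 'w) \<Rightarrow> 'w set \<Rightarrow>
    ('k \<Rightarrow> 'u \<Rightarrow> 'u) \<Rightarrow> 'u set \<Rightarrow>
    ('v::ab_group_add \<Rightarrow> 'w::ab_group_add \<Rightarrow> 'u::ab_group_add) \<Rightarrow> bool" where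
  "bilinear_on s V s' V' s'' V'' t \<longleftrightarrow>
     (\<forall>x\<in>V. linear_on s' V' s'' V'' (t x)) \<and>
     (\<forall>y\<in>V'. linear_on s V s'' V'' (\<lambda>x. t x y))"

definition bilinear_space :: "('k::field, 'v::ab_group_add) bilin \<Rightarrow> bool" where
  "bilinear_space W \<longleftrightarrow>
     vector_space (scal W) \<and>
     module.subspace (scal W) (carr W) \<and>
     (\<exists>B. finite B \<and> carr W = module.span (scal W) B) \<and>
     bilinear_on (scal W) (carr W) (scal W) (carr W) (*) UNIV (bform W)"

definition bdim :: "('k::field, 'v::ab_group_add) bilin \<Rightarrow> nat" where
  "bdim W = vector_space.dim (scal W) (carr W)"

definition nondegenerate :: "('k::field, 'v::ab_group_add) bilin \<Rightarrow> bool" where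
  "nondegenerate W \<longleftrightarrow>
     (\<forall>x\<in>carr W. (\<forall>y\<in>carr W. bform W x y = 0) \<longrightarrow> x = 0) \<and>
     (\<forall>y\<in>carr W. (\<forall>x\<in>carr W. bform W x y = 0) \<longrightarrow> y = 0)"

definition asymmetry :: "('k::field, 'v::ab_group_add) bilin \<Rightarrow> 'v \<Rightarrow> 'v" where
  "asymmetry W = (THE f. f \<in> extensional (carr W) \<and>
     linear_on (scal W) (carr W) (scal W) (carr W) f \<and>
     (\<forall>x\<in>carr W. \<forall>y\<in>carr W. bform W x y = bform W y (f x)))"

definition linear_iso :: "('k::field, 'v::ab_group_add) bilin \<Rightarrow>
    ('k, 'w::ab_group_add) bilin \<Rightarrow> ('v \<Rightarrow> 'w) \<Rightarrow> bool" where
  "linear_iso W W' \<phi> \<longleftrightarrow>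
     linear_on (scal W) (carr W) (scal W') (carr W') \<phi> \<and> bij_betw \<phi> (carr W) (carr W')"

definition asymmetries_conjugate :: "('k::field, 'v::ab_group_add) bilin \<Rightarrow>
    ('k, 'w::ab_group_add) bilin \<Rightarrow> bool" where
  "asymmetries_conjugate W W' \<longleftrightarrow>
     (\<exists>\<phi>. linear_iso W W' \<phi> \<and> (\<forall>x\<in>carr W. \<phi> (asymmetry W x) = asymmetry W' (\<phi> x)))"

definition similar :: "('k::field, 'v::ab_group_add) bilin \<Rightarrow>
    ('k, 'w::ab_group_add) bilin \<Rightarrow> bool" where
  "similar W W' \<longleftrightarrow>
     (\<exists>\<phi> c. c \<noteq> 0 \<and> linear_iso W W' \<phi> \<and>
        (\<forall>x\<in>carr W. \<forall>y\<in>carr W. bform W' (\<phi> x) (\<phi> y) = c * bform W x y))"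

text \<open>
  \<open>is_tensor_product W\<^sub>1 W\<^sub>2 W t\<close>: the map \<open>(x, y) \<mapsto> t x y\<close> induces an isomorphism of bilinear
  spaces from the tensor product of \<open>W\<^sub>1\<close> and \<open>W\<^sub>2\<close> onto \<open>W\<close>. The universal property is
  required for scalar-valued bilinear maps only; as all spaces are finite-dimensional, this
  says that the dual of the induced linear map is bijective.
\<close>

definition is_tensor_product :: "('k::field, 'v::ab_group_add) bilin \<Rightarrow>
    ('k, 'w::ab_group_add) bilin \<Rightarrow> ('k, 'u::ab_group_add) bilin \<Rightarrow> ('v \<Rightarrow> 'w \<Rightarrow> 'u) \<Rightarrow> bool"
  where
  "is_tensor_product W1 W2 W t \<longleftrightarrow>
     bilinear_on (scal W1) (carr W1) (scal W2) (carr W2) (scal W) (carr W) t \<and>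
     (\<forall>\<beta>. bilinear_on (scal W1) (carr W1) (scal W2) (carr W2) (*) UNIV \<beta> \<longrightarrow>
        (\<exists>!f. f \<in> extensional (carr W) \<and> linear_on (scal W) (carr W) (*) UNIV f \<and>
           (\<forall>x\<in>carr W1. \<forall>y\<in>carr W2. f (t x y) = \<beta> x y))) \<and>
     (\<forall>x\<in>carr W1. \<forall>x'\<in>carr W1. \<forall>y\<in>carr W2. \<forall>y'\<in>carr W2.
        bform W (t x y) (t x' y') = bform W1 x x' * bform W2 y y')"

text \<open>
  The two factors are sought among the finite-dimensional subspaces of \<open>nat \<Rightarrow> 'k\<close>; every
  finite-dimensional space is isomorphic to one of these.
\<close>

definition decomposable :: "('k::field, 'v::ab_group_add) bilin \<Rightarrow> bool" where
  "decomposable W \<longleftrightarrow>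
     (\<exists>(W1 :: ('k, nat \<Rightarrow> 'k) bilin) (W2 :: ('k, nat \<Rightarrow> 'k) bilin) t.
        bilinear_space W1 \<and> bilinear_space W2 \<and> bdim W1 \<ge> 2 \<and> bdim W2 \<ge> 2 \<and>
        is_tensor_product W1 W2 W t)"


section \<open>Bilinear spaces given by matrices, and their tensor products\<close>

definition matrix_space :: "'k::field ^ 'n ^ 'n \<Rightarrow> ('k, 'k ^ 'n) bilin" where
  "matrix_space M = \<lparr>scal = (*s), carr = UNIV,
     bform = (\<lambda>x y. \<Sum>i\<in>UNIV. \<Sum>j\<in>UNIV. x $ i * M $ i $ j * y $ j)\<rparr>"

definition kron :: "'k::times ^ 'm ^ 'm \<Rightarrow> 'k ^ 'n ^ 'n \<Rightarrow> 'k ^ ('m \<times> 'n) ^ ('m \<times> 'n)" where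
  "kron M N = (\<chi> p q. M $ fst p $ fst q * N $ snd p $ snd q)"

definition elem_tensor :: "'k::times ^ 'm \<Rightarrow> 'k ^ 'n \<Rightarrow> 'k ^ ('m \<times> 'n)" where
  "elem_tensor x y = (\<chi> p. x $ fst p * y $ snd p)"

lemma bilinear_space_matrix_space: "bilinear_space (matrix_space M)"
proof -
  have "(UNIV :: ('a ^ 'b) set) = module.span (*s) (cart_basis :: ('a ^ 'b) set)"
    using vec.span_Basis by simp
  then have "\<exists>B::('a ^ 'b) set. finite B \<and> UNIV = module.span (*s) B"
    using finite_cart_basis by blast
  then show ?thesis
    unfolding bilinear_space_def matrix_space_def bilinear_on_def linear_on_def
    by (auto simp: vec.vector_space_axioms vec.subspace_UNIV algebra_simps sum.distrib sum_distrib_left)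
qed

lemma sum_UNIV_prod:
  "(\<Sum>p\<in>UNIV. h p) = (\<Sum>i\<in>UNIV. \<Sum>k\<in>UNIV. h (i :: 'b::finite, k :: 'c::finite))"
  by (metis UNIV_Times_UNIV sum.cartesian_product')

lemma is_tensor_product_kron:
  "is_tensor_product (matrix_space M) (matrix_space N) (matrix_space (kron M N)) elem_tensor"
proof -
  let ?b = "\<lambda>M x y. \<Sum>i\<in>UNIV. \<Sum>j\<in>UNIV. x $ i * M $ i $ j * y $ j"
  have form: "?b (kron M N) (elem_tensor x y) (elem_tensor x' y') = ?b M x x' * ?b N y y'"
    for x x' y y'
  proof -
    have "?b (kron M N) (elem_tensor x y) (elem_tensor x' y') =
        (\<Sum>i\<in>UNIV. \<Sum>k\<in>UNIV. \<Sum>j\<in>UNIV. \<Sum>l\<in>UNIV.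
           (x $ i * M $ i $ j * x' $ j) * (y $ k * N $ k $ l * y' $ l))"
      unfolding sum_UNIV_prod by (simp add: kron_def elem_tensor_def mult_ac)
    also have "\<dots> = ?b M x x' * ?b N y y'"
      by (simp add: sum_product)
    finally show ?thesis .
  qed
  have expand: "w = (\<Sum>p\<in>UNIV. w $ p *s elem_tensor (axis (fst p) 1) (axis (snd p) 1))"
    for w :: "'a ^ ('b \<times> 'c)"
  proof -
    have "elem_tensor (axis (fst p) 1) (axis (snd p) 1) = (axis p 1 :: 'a ^ ('b \<times> 'c))" for p
      by (auto simp: vec_eq_iff elem_tensor_def axis_def prod_eq_iff)
    then show ?thesis by (simp add: basis_expansion)
  qed
  have univ: "\<exists>!f. linear_on (*s) UNIV (*) UNIV f \<and> (\<forall>x y. f (elem_tensor x y) = \<beta> x y)"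
    if \<beta>: "bilinear_on (*s) UNIV (*s) UNIV (*) UNIV \<beta>" for \<beta> :: "'a ^ 'b \<Rightarrow> 'a ^ 'c \<Rightarrow> 'a"
  proof -
    define F where "F w = (\<Sum>p\<in>UNIV. w $ p * \<beta> (axis (fst p) 1) (axis (snd p) 1))"
      for w :: "'a ^ ('b \<times> 'c)"
    have add1: "\<beta> (x + x') y = \<beta> x y + \<beta> x' y" and add2: "\<beta> x (y + y') = \<beta> x y + \<beta> x y'"
      and sc1: "\<beta> (c *s x) y = c * \<beta> x y" and sc2: "\<beta> x (c *s y) = c * \<beta> x y" for x x' y y' c
      using \<beta> by (auto simp: bilinear_on_def linear_on_def)
    have z1: "\<beta> 0 y = 0" and z2: "\<beta> x 0 = 0" for x y
      using sc1[of 0 0 y] sc2[of x 0 0] by auto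
    have s1: "\<beta> (\<Sum>i\<in>A. g i) y = (\<Sum>i\<in>A. \<beta> (g i) y)" for A :: "'b set" and g y
      by (induction A rule: infinite_finite_induct) (auto simp: add1 z1)
    have s2: "\<beta> x (\<Sum>i\<in>A. g i) = (\<Sum>i\<in>A. \<beta> x (g i))" for A :: "'c set" and g x
      by (induction A rule: infinite_finite_induct) (auto simp: add2 z2)
    have "F (elem_tensor x y) = \<beta> x y" for x y
    proof -
      have "\<beta> x y = \<beta> (\<Sum>i\<in>UNIV. x $ i *s axis i 1) (\<Sum>k\<in>UNIV. y $ k *s axis k 1)"
        by (simp add: basis_expansion)
      also have "\<dots> = (\<Sum>i\<in>UNIV. \<Sum>k\<in>UNIV. x $ i * y $ k * \<beta> (axis i 1) (axis k 1))"
        unfolding s1 sc1 unfolding s2 sc2 sum_distrib_left by (simp add: mult_ac)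
      also have "\<dots> = F (elem_tensor x y)"
        unfolding F_def sum_UNIV_prod by (simp add: elem_tensor_def)
      finally show ?thesis ..
    qed
    moreover have "linear_on (*s) UNIV (*) UNIV F"
      by (auto simp: linear_on_def F_def algebra_simps sum.distrib sum_distrib_left)
    moreover have "f = F"
      if f: "linear_on (*s) UNIV (*) UNIV f" "\<forall>x y. f (elem_tensor x y) = \<beta> x y" for f
    proof
      fix w
      have fadd: "f (x + y) = f x + f y" and fsc: "f (c *s x) = c * f x" for x y c
        using f(1) by (auto simp: linear_on_def)
      have f0: "f 0 = 0" using fsc[of 0 0] by simp
      have fs: "f (\<Sum>p\<in>A. g p) = (\<Sum>p\<in>A. f (g p))" for A :: "('b \<times> 'c) set" and g
        by (induction A rule: infinite_finite_induct) (auto simp: fadd f0)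
      have "f w = f (\<Sum>p\<in>UNIV. w $ p *s elem_tensor (axis (fst p) 1) (axis (snd p) 1))"
        using expand[of w] by simp
      also have "\<dots> = F w" unfolding fs fsc F_def by (simp add: f(2))
      finally show "f w = F w" .
    qed
    ultimately show ?thesis by blast
  qed
  have "bilinear_on (*s) UNIV (*s) UNIV (*s) UNIV
      (elem_tensor :: 'a ^ 'b \<Rightarrow> 'a ^ 'c \<Rightarrow> 'a ^ ('b \<times> 'c))"
    by (auto simp: bilinear_on_def linear_on_def elem_tensor_def vec_eq_iff algebra_simps)
  then show ?thesis
    using univ form by (simp add: is_tensor_product_def matrix_space_def)
qed

definition b_matrix :: "'k::field \<Rightarrow> 'k ^ 2 ^ 2" where
  "b_matrix a = vector [vector [1, 1], vector [0, 1 / (2 - a)]]"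

definition field_embedding :: "('f::field \<Rightarrow> 'e::field) \<Rightarrow> bool" where
  "field_embedding \<iota> \<longleftrightarrow>
     \<iota> 1 = 1 \<and> (\<forall>x y. \<iota> (x + y) = \<iota> x + \<iota> y) \<and> (\<forall>x y. \<iota> (x * y) = \<iota> x * \<iota> y)"

text \<open>The scalar extension \<open>(V, b)\<^sub>E\<close> of \<open>(F\<^sup>2, b\<^sub>1) \<otimes> (F\<^sup>2, b\<^sub>2)\<close> along \<open>\<iota> : F \<rightarrow> E\<close>.\<close>

definition VE :: "('f::field \<Rightarrow> 'e::field) \<Rightarrow> 'f \<Rightarrow> 'f \<Rightarrow> ('e, 'e ^ (2 \<times> 2)) bilin" where
  "VE \<iota> a1 a2 = matrix_space (map_matrix \<iota> (kron (b_matrix a1) (b_matrix a2)))"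


section \<open>The quadratic algebra \<open>K\<^sub>E\<close> and the forms attached to its units\<close>

text \<open>
  With \<open>d = \<alpha>\<^sub>1\<alpha>\<^sub>2\<close>, the pair \<open>(r, s)\<close> stands for \<open>r + s \<theta>\<close> in \<open>K\<^sub>E\<close>, where
  \<open>\<theta> = \<surd>\<alpha>\<^sub>1 \<otimes> \<surd>\<alpha>\<^sub>2\<close>, so \<open>\<theta>\<^sup>2 = d\<close>. The norm is the determinant of multiplication by
  \<open>r + s \<theta>\<close>, written in the basis \<open>1, \<theta>\<close>.
\<close>

fun qmult :: "'e::field \<Rightarrow> 'e \<times> 'e \<Rightarrow> 'e \<times> 'e \<Rightarrow> 'e \<times> 'e" where
  "qmult d (r, s) (r', s') = (r * r' + d * s * s', r * s' + s * r')"

definition qunit :: "'e::field \<Rightarrow> 'e \<times> 'e \<Rightarrow> bool" where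
  "qunit d u \<longleftrightarrow> (\<exists>v. qmult d u v = (1, 0))"

fun qnorm :: "'e::field \<Rightarrow> 'e \<times> 'e \<Rightarrow> 'e" where
  "qnorm d (r, s) = det (vector [vector [r, d * s], vector [s, r]] :: 'e ^ 2 ^ 2)"

lemma qnorm_eq: "qnorm d (r, s) = r\<^sup>2 - d * s\<^sup>2"
  by (simp add: det_2 power2_eq_square)

definition alpha :: "'f::field \<Rightarrow> 'f" where
  "alpha a = a\<^sup>2 - 4"

text \<open>The endomorphism \<open>2 a\<^sub>b - a Id\<close> of \<open>F\<^sup>2\<close> for \<open>b = b\<^sub>a\<close>; its square is \<open>\<alpha> Id\<close>.\<close>

definition delta :: "'f::field \<Rightarrow> 'f ^ 2 \<Rightarrow> 'f ^ 2" where
  "delta a x = 2 *s asymmetry (matrix_space (b_matrix a)) x - a *s x"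

fun u_endo :: "('f::field \<Rightarrow> 'e::field) \<Rightarrow> 'f \<Rightarrow> 'f \<Rightarrow> 'e \<times> 'e \<Rightarrow> 'e ^ (2 \<times> 2) \<Rightarrow> 'e ^ (2 \<times> 2)"
  where
  "u_endo \<iota> a1 a2 (r, s) x =
     r *s x + s *s (map_matrix \<iota> (kron (matrix (delta a1)) (matrix (delta a2))) *v x)"

definition twisted_space ::
    "('f::field \<Rightarrow> 'e::field) \<Rightarrow> 'f \<Rightarrow> 'f \<Rightarrow> 'e \<times> 'e \<Rightarrow> ('e, 'e ^ (2 \<times> 2)) bilin" where
  "twisted_space \<iota> a1 a2 u = (VE \<iota> a1 a2)
     \<lparr>bform := (\<lambda>x y. bform (VE \<iota> a1 a2) x (inv_into UNIV (u_endo \<iota> a1 a2 u) y))\<rparr>"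


section \<open>Galois cohomology with coefficients in \<open>\<int>/2\<int>\<close>\<close>

definition separable_poly :: "'a::field poly \<Rightarrow> bool" where
  "separable_poly p \<longleftrightarrow> coprime p (pderiv p)"

definition separable_closure :: "('e::field \<Rightarrow> 's::field) \<Rightarrow> bool" where
  "separable_closure j \<longleftrightarrow>
     field_embedding j \<and>
     (\<forall>x. \<exists>p. separable_poly p \<and> poly (map_poly j p) x = 0) \<and>
     (\<forall>q::'s poly. separable_poly q \<and> degree q > 0 \<longrightarrow> (\<exists>x. poly q x = 0))"

definition galois :: "('e::field \<Rightarrow> 's::field) \<Rightarrow> ('s \<Rightarrow> 's) set" where
  "galois j = {\<sigma>. bij \<sigma> \<and> field_embedding \<sigma> \<and> (\<forall>c. \<sigma> (j c) = j c)}"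

text \<open>The Krull topology is the topology of pointwise convergence for discrete \<open>'s\<close>.\<close>

definition krull :: "('e::field \<Rightarrow> 's::field) \<Rightarrow> ('s \<Rightarrow> 's) topology" where
  "krull j = subtopology (product_topology (\<lambda>_. discrete_topology UNIV) UNIV) (galois j)"

text \<open>
  Continuous inhomogeneous cochains; the Galois group acts trivially on the coefficients. By
  convention 2-cochains vanish outside the square of the Galois group.
\<close>

definition cochains1 :: "('e::field \<Rightarrow> 's::field) \<Rightarrow> (('s \<Rightarrow> 's) \<Rightarrow> bit) set" where
  "cochains1 j = {f. continuous_map (krull j) (discrete_topology UNIV) f}"

definition extend2 :: "('e::field \<Rightarrow> 's::field) \<Rightarrow> (('s \<Rightarrow> 's) \<Rightarrow> ('s \<Rightarrow> 's) \<Rightarrow> bit) \<Rightarrow>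
    ('s \<Rightarrow> 's) \<times> ('s \<Rightarrow> 's) \<Rightarrow> bit" where
  "extend2 j f = (\<lambda>(\<sigma>, \<tau>). if \<sigma> \<in> galois j \<and> \<tau> \<in> galois j then f \<sigma> \<tau> else 0)"

definition cochains2 ::
    "('e::field \<Rightarrow> 's::field) \<Rightarrow> (('s \<Rightarrow> 's) \<times> ('s \<Rightarrow> 's) \<Rightarrow> bit) set" where
  "cochains2 j = {f. continuous_map (prod_topology (krull j) (krull j)) (discrete_topology UNIV) f
     \<and> (\<forall>p. p \<notin> galois j \<times> galois j \<longrightarrow> f p = 0)}"

definition cocycles2 ::
    "('e::field \<Rightarrow> 's::field) \<Rightarrow> (('s \<Rightarrow> 's) \<times> ('s \<Rightarrow> 's) \<Rightarrow> bit) set" where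
  "cocycles2 j = {f \<in> cochains2 j. \<forall>\<sigma>\<in>galois j. \<forall>\<tau>\<in>galois j. \<forall>\<upsilon>\<in>galois j.
     f (\<tau>, \<upsilon>) - f (\<sigma> \<circ> \<tau>, \<upsilon>) + f (\<sigma>, \<tau> \<circ> \<upsilon>) - f (\<sigma>, \<tau>) = 0}"

definition coboundaries2 ::
    "('e::field \<Rightarrow> 's::field) \<Rightarrow> (('s \<Rightarrow> 's) \<times> ('s \<Rightarrow> 's) \<Rightarrow> bit) set" where
  "coboundaries2 j = (\<lambda>f. extend2 j (\<lambda>\<sigma> \<tau>. f \<tau> - f (\<sigma> \<circ> \<tau>) + f \<sigma>)) ` cochains1 j"

definition cocycle_group ::
    "('e::field \<Rightarrow> 's::field) \<Rightarrow> (('s \<Rightarrow> 's) \<times> ('s \<Rightarrow> 's) \<Rightarrow> bit) monoid" where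
  "cocycle_group j = \<lparr>carrier = cocycles2 j, mult = (\<lambda>f g p. f p + g p), one = (\<lambda>_. 0)\<rparr>"

definition H2 ::
    "('e::field \<Rightarrow> 's::field) \<Rightarrow> (('s \<Rightarrow> 's) \<times> ('s \<Rightarrow> 's) \<Rightarrow> bit) set monoid" where
  "H2 j = cocycle_group j Mod coboundaries2 j"

text \<open>
  The trivial action makes \<open>H\<^sup>1\<close> the group of continuous homomorphisms to \<open>\<int>/2\<int>\<close>. The class
  \<open>(x)\<close> sends \<open>\<sigma>\<close> to 0 iff \<open>\<sigma>\<close> fixes the square roots of \<open>x\<close> (characteristic not 2, \<open>x \<noteq> 0\<close>).
\<close>

definition kummer :: "('e::field \<Rightarrow> 's::field) \<Rightarrow> 'e \<Rightarrow> ('s \<Rightarrow> 's) \<Rightarrow> bit" where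
  "kummer j x \<sigma> = (if \<forall>y. y\<^sup>2 = j x \<longrightarrow> \<sigma> y = y then 0 else 1)"

definition cup :: "('e::field \<Rightarrow> 's::field) \<Rightarrow> (('s \<Rightarrow> 's) \<Rightarrow> bit) \<Rightarrow> (('s \<Rightarrow> 's) \<Rightarrow> bit) \<Rightarrow>
    (('s \<Rightarrow> 's) \<times> ('s \<Rightarrow> 's) \<Rightarrow> bit) set" where
  "cup j \<phi> \<psi> = coboundaries2 j #>\<^bsub>cocycle_group j\<^esub> extend2 j (\<lambda>\<sigma> \<tau>. \<phi> \<sigma> * \<psi> \<tau>)"


section \<open>The invariant\<close>

definition alpha_subgroup :: "('f::field \<Rightarrow> 'e::field) \<Rightarrow> ('e \<Rightarrow> 's::field) \<Rightarrow> 'f \<Rightarrow> 'f \<Rightarrow>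
    (('s \<Rightarrow> 's) \<times> ('s \<Rightarrow> 's) \<Rightarrow> bit) set set" where
  "alpha_subgroup \<iota> j a1 a2 =
     generate (H2 j) {cup j (kummer j (\<iota> (alpha a1))) (kummer j (\<iota> (alpha a2)))}"

definition nu_unit :: "('f::field \<Rightarrow> 'e::field) \<Rightarrow> ('e \<Rightarrow> 's::field) \<Rightarrow> 'f \<Rightarrow> 'f \<Rightarrow> 'e \<times> 'e \<Rightarrow>
    (('s \<Rightarrow> 's) \<times> ('s \<Rightarrow> 's) \<Rightarrow> bit) set" where
  "nu_unit \<iota> j a1 a2 u =
     cup j (kummer j (\<iota> (alpha a1))) (kummer j (qnorm (\<iota> (alpha a1 * alpha a2)) u))"

definition nu_tilde_unit :: "('f::field \<Rightarrow> 'e::field) \<Rightarrow> ('e \<Rightarrow> 's::field) \<Rightarrow> 'f \<Rightarrow> 'f \<Rightarrow>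
    'e \<times> 'e \<Rightarrow> (('s \<Rightarrow> 's) \<times> ('s \<Rightarrow> 's) \<Rightarrow> bit) set set" where
  "nu_tilde_unit \<iota> j a1 a2 u = alpha_subgroup \<iota> j a1 a2 #>\<^bsub>H2 j\<^esub> nu_unit \<iota> j a1 a2 u"

definition nu_tilde_target :: "('f::field \<Rightarrow> 'e::field) \<Rightarrow> ('e \<Rightarrow> 's::field) \<Rightarrow> 'f \<Rightarrow> 'f \<Rightarrow>
    (('s \<Rightarrow> 's) \<times> ('s \<Rightarrow> 's) \<Rightarrow> bit) set set monoid" where
  "nu_tilde_target \<iota> j a1 a2 = H2 j Mod alpha_subgroup \<iota> j a1 a2"

text \<open>
  \<open>nu_tilde_value \<iota> j a1 a2 W c\<close>: the similarity class of \<open>W\<close> corresponds to the class of a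
  unit \<open>u\<close> of \<open>K\<^sub>E\<close>, and \<open>c\<close> is the invariant of \<open>[u]\<close>. This is a relation and not a function
  of \<open>W\<close> because for \<open>a1 = a2\<close> or \<open>a1 = - a2\<close> the asymmetry of \<open>V\<close> has a repeated
  eigenvalue, and then \<open>u\<close> need not exist or need not determine \<open>c\<close> uniquely. Otherwise \<open>W\<close>
  has exactly one value.
\<close>

definition nu_tilde_value :: "('f::field \<Rightarrow> 'e::field) \<Rightarrow> ('e \<Rightarrow> 's::field) \<Rightarrow> 'f \<Rightarrow> 'f \<Rightarrow>
    ('e, 'v::ab_group_add) bilin \<Rightarrow> (('s \<Rightarrow> 's) \<times> ('s \<Rightarrow> 's) \<Rightarrow> bit) set set \<Rightarrow> bool" where
  "nu_tilde_value \<iota> j a1 a2 W c \<longleftrightarrow>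
     (\<exists>u. qunit (\<iota> (alpha a1 * alpha a2)) u \<and> similar W (twisted_space \<iota> a1 a2 u) \<and>
        c = nu_tilde_unit \<iota> j a1 a2 u)"

end

theory Submission
  imports Defs
begin

text \<open>
  Bilinear spaces of dimension 2 whose asymmetry has trace \<open>c \<noteq> \<plusminus>2\<close> are all similar to \<open>b\<^sub>c\<close>. If
  \<open>(V', b')\<close> is a tensor product of two planes, comparing the traces of the asymmetry and of its
  square shows that, up to order, the planes are similar to \<open>b\<^sub>a\<^sub>1, b\<^sub>a\<^sub>2\<close> or to \<open>b\<^sub>-\<^sub>a\<^sub>1, b\<^sub>-\<^sub>a\<^sub>2\<close>. The
  corresponding classes are those of \<open>1\<close> and \<open>\<theta>\<close>, and \<open>\<nu>\<close> maps them to \<open>0\<close> and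
  \<open>(\<alpha>\<^sub>1) \<union> (-\<alpha>\<^sub>1\<alpha>\<^sub>2) = (\<alpha>\<^sub>1) \<union> (\<alpha>\<^sub>2)\<close>.

  Conversely, if the invariant of \<open>u\<close> vanishes, then \<open>N(u)\<close> or \<open>N(u\<theta>)\<close> is of the form \<open>x\<^sup>2 - \<alpha>\<^sub>1y\<^sup>2\<close>, and
  \<open>u\<close> or \<open>u\<theta>\<close> is a scalar times a norm \<open>\<ell>\<ell>'\<close> from \<open>L\<^sub>E\<close>. The similitude \<open>\<ell>\<close> turns the
  form of \<open>u\<close> into \<open>b\<close> or \<open>b(x, \<theta>y)\<close>, which are tensor products.

  That \<open>(\<alpha>) \<union> (\<beta>) = 0\<close> makes \<open>\<beta>\<close> a norm from \<open>E(\<surd>\<alpha>)\<close> is seen as follows: a trivializing cochain restricts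
  to a character of the group of \<open>E(\<surd>\<alpha>)\<close>; an eigenvector \<open>y\<close> of this character exists by Dedekind
  independence, and for \<open>\<tau>\<close> moving \<open>\<surd>\<alpha>\<close> the element \<open>y\<tau>(y)/\<surd>\<beta>\<close> is fixed by the whole Galois group,
  so that \<open>y\<^sup>2\<close> has norm \<open>\<beta>\<close> up to a square.
\<close>

section \<open>Galois theory of the separable closure\<close>

text \<open>Although \<alpha>1 and \<alpha>2 are not squares in F, they may become squares in E, so
  neither K_E nor L_E need be a field. Norms are therefore kept as equations
  \<open>b = x\<^sup>2 - a * y\<^sup>2\<close>, elements of K_E and L_E become polynomials in the
  commuting matrices of \<theta> and \<surd>\<alpha>1 \<otimes> 1, and the split cases get their own
  witnesses. Two traces suffice to identify the planes because the asymmetry of a plane has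
  determinant 1: if its trace is c, its square has trace c^2 - 2. The asymmetry of a product of
  planes thus determines c1 c2 and c1^2 + c2^2, hence (c1 + c2)^2 and (c1 - c2)^2. The class of
  \<theta> appears because twisting b_a by \<surd>\<alpha> multiplies the asymmetry by -1.
  Conversely, the quotient by (\<alpha>1) \<union> (\<alpha>2) gives u and u\<theta> the same
  invariant, as N(\<theta>) = -\<alpha>1\<alpha>2 and (\<alpha>1) \<union> (-\<alpha>1) = 0. The
  separable closure is given only through roots of separable polynomials, so the existence of enough
  automorphisms and the determination of the fixed field are derived from these.\<close>

lemma field_embedding_simps:
  assumes "field_embedding h"
  shows "h 0 = 0" "h 1 = 1" "h (x + y) = h x + h y" "h (x * y) = h x * h y" "h (- x) = - h x"
    "h (x - y) = h x - h y" "h (inverse x) = inverse (h x)" "h (x / y) = h x / h y" "h (x ^ n) = h x ^ n"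
    "h x = h y \<longleftrightarrow> x = y" "h x = 0 \<longleftrightarrow> x = 0"
proof -
  have a: "h (x + y) = h x + h y" and m: "h (x * y) = h x * h y" and one: "h 1 = 1" for x y
    using assms by (auto simp: field_embedding_def)
  have z: "h 0 = 0" using a[of 0 0] by (metis add_cancel_right_right)
  have neg: "h (- x) = - h x" for x using a[of x "- x"] z by (simp add: eq_neg_iff_add_eq_0 add.commute)
  have sub: "h (x - y) = h x - h y" for x y using a[of x "- y"] neg by simp
  have inv: "h (inverse x) = inverse (h x)" for x
  proof (cases "x = 0")
    case False
    then have "h x * h (inverse x) = 1" using m[of x "inverse x"] one by simp
    then show ?thesis by (metis inverse_unique)
  qed (simp add: z)
  have nz: "h x = 0 \<longleftrightarrow> x = 0" for x
    using m[of x "inverse x"] one z by (metis mult_zero_left right_inverse zero_neq_one)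
  show "h 0 = 0" "h 1 = 1" "h (x + y) = h x + h y" "h (x * y) = h x * h y" "h (- x) = - h x"
    "h (x - y) = h x - h y" "h (inverse x) = inverse (h x)" "h x = 0 \<longleftrightarrow> x = 0"
    using a m one z neg sub inv nz by auto
  show "h (x / y) = h x / h y" using m inv by (simp add: divide_inverse)
  show "h (x ^ n) = h x ^ n" by (induction n) (auto simp: one m)
  show "h x = h y \<longleftrightarrow> x = y" using sub[of x y] nz[of "x - y"] by auto
qed

section \<open>Polynomials under field embeddings, and separability\<close>

lemma map_poly_add_embedding:
  assumes "field_embedding h"
  shows "map_poly h (p + q) = map_poly h p + map_poly h q"
  by (intro poly_eqI) (simp add: coeff_map_poly field_embedding_simps[OF assms])

lemma map_poly_mult_embedding:
  assumes "field_embedding h"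
  shows "map_poly h (p * q) = map_poly h p * map_poly h q"
proof -
  have "h (sum f A) = (\<Sum>i\<in>A. h (f i))" for f :: "nat \<Rightarrow> 'a" and A
    by (induction A rule: infinite_finite_induct) (auto simp: field_embedding_simps[OF assms])
  then show ?thesis
    by (intro poly_eqI) (simp add: coeff_map_poly coeff_mult field_embedding_simps[OF assms])
qed

lemma map_poly_pderiv_embedding:
  assumes "field_embedding h"
  shows "map_poly h (pderiv p) = pderiv (map_poly h p)"
proof -
  have "h (of_nat n) = of_nat n" for n
    by (induction n) (auto simp: field_embedding_simps[OF assms])
  then show ?thesis
    by (intro poly_eqI) (simp add: coeff_map_poly coeff_pderiv field_embedding_simps[OF assms] del: of_nat_Suc)
qed

lemma poly_map_poly_embedding:
  assumes "field_embedding h"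
  shows "poly (map_poly h p) (h x) = h (poly p x)"
  by (induction p) (auto simp: map_poly_pCons field_embedding_simps[OF assms])

text \<open>A nonzero combination of p and q of least degree divides every combination, since the
  remainder is again one; as a common divisor it is a unit. The point is to express coprimality by
  an identity, which any embedding of fields transports.\<close>

lemma coprime_poly_bezout:
  fixes p q :: "'a::field poly"
  assumes "coprime p q"
  shows "\<exists>u v. u * p + v * q = 1"
proof -
  have ex: "\<exists>n d u v. d \<noteq> 0 \<and> d = u * p + v * q \<and> degree d = n"
  proof (cases "p = 0")
    case True
    then have "q \<noteq> 0" using assms by auto
    then show ?thesis by (intro exI[of _ "degree q"] exI[of _ q] exI[of _ 0] exI[of _ 1]) simp
  next
    case False
    then show ?thesis by (intro exI[of _ "degree p"] exI[of _ p] exI[of _ 1] exI[of _ 0]) simp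
  qed
  define n where "n = (LEAST n. \<exists>d u v. d \<noteq> 0 \<and> d = u * p + v * q \<and> degree d = n)"
  obtain d u v where d: "d \<noteq> 0" "d = u * p + v * q" "degree d = n"
    using LeastI_ex[OF ex] unfolding n_def by blast
  have min: "d' = 0 \<or> n \<le> degree d'" if "d' = u' * p + v' * q" for d' u' v'
    using that unfolding n_def by (metis (mono_tags, lifting) Least_le)
  have dv: "d dvd u' * p + v' * q" for u' v'
  proof -
    let ?g = "u' * p + v' * q"
    have "?g mod d = (u' - ?g div d * u) * p + (v' - ?g div d * v) * q"
      by (simp add: minus_div_mult_eq_mod [symmetric] d(2) algebra_simps)
    then have "?g mod d = 0 \<or> n \<le> degree (?g mod d)" by (rule min)
    moreover have "?g mod d = 0 \<or> degree (?g mod d) < n" using degree_mod_less[OF d(1), of ?g] d(3) by simp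
    ultimately show ?thesis by (auto simp: dvd_eq_mod_eq_0)
  qed
  have "d dvd p" "d dvd q" using dv[of 1 0] dv[of 0 1] by auto
  then have "is_unit d" using assms by (meson coprime_common_divisor)
  then obtain e where "1 = d * e" by (elim dvdE)
  then have "(e * u) * p + (e * v) * q = 1" using d(2) by (simp add: algebra_simps)
  then show ?thesis by blast
qed

lemma separable_poly_map:
  assumes "field_embedding h" "separable_poly p"
  shows "separable_poly (map_poly h p)"
proof -
  obtain u v where "u * p + v * pderiv p = 1"
    using coprime_poly_bezout[of p "pderiv p"] assms(2) by (auto simp: separable_poly_def)
  then have "map_poly h (u * p + v * pderiv p) = 1"
    by (simp add: field_embedding_simps[OF assms(1)])
  then have "map_poly h u * map_poly h p + map_poly h v * pderiv (map_poly h p) = 1"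
    by (simp add: map_poly_add_embedding map_poly_mult_embedding map_poly_pderiv_embedding assms(1))
  then show ?thesis unfolding separable_poly_def
    by (metis coprimeI dvd_add dvd_mult)
qed

lemma separable_poly_dvd:
  fixes p q :: "'a::field poly"
  assumes "separable_poly p" "q dvd p"
  shows "separable_poly q"
proof -
  obtain k where k: "p = q * k" using assms(2) by (elim dvdE)
  show ?thesis
    unfolding separable_poly_def
  proof (rule coprimeI)
    fix c assume "c dvd q" "c dvd pderiv q"
    then have "c dvd p" "c dvd pderiv p" by (auto simp: k pderiv_mult)
    then show "is_unit c" using assms(1) coprime_common_divisor unfolding separable_poly_def by blast
  qed
qed

lemma separable_poly_nonzero: "separable_poly p \<Longrightarrow> p \<noteq> 0"
  by (auto simp: separable_poly_def)

text \<open>A double root would make the linear factor a common divisor of the polynomial and its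
  derivative.\<close>

lemma separable_poly_no_double_root:
  fixes g :: "'a::field poly"
  assumes "separable_poly ([:- w, 1:] * g)"
  shows "poly g w \<noteq> 0"
proof
  assume "poly g w = 0"
  then have "[:- w, 1:] dvd g" by (simp add: poly_eq_0_iff_dvd)
  then have "[:- w, 1:] dvd [:- w, 1:] * g" "[:- w, 1:] dvd pderiv ([:- w, 1:] * g)"
    unfolding pderiv_mult
    by (auto simp del: mult_pCons_left)
  then have "is_unit [:- w, 1:]"
    using assms coprime_common_divisor unfolding separable_poly_def by blast
  then show False by (simp add: is_unit_pCons_iff)
qed

text \<open>A partial embedding over \<open>j\<close> is represented by its graph, a single-valued subring of the
  product ring that contains the diagonal copy of the base field.\<close>

definition partial_embedding :: "('e::field \<Rightarrow> 's::field) \<Rightarrow> ('s \<times> 's) set \<Rightarrow> bool" where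
  "partial_embedding j \<Gamma> \<longleftrightarrow> single_valued \<Gamma> \<and> (\<forall>c. (j c, j c) \<in> \<Gamma>) \<and>
     (\<forall>x x' y y'. (x, x') \<in> \<Gamma> \<and> (y, y') \<in> \<Gamma> \<longrightarrow> (x + y, x' + y') \<in> \<Gamma> \<and> (x * y, x' * y') \<in> \<Gamma>)"

text \<open>The pairs (g, g') in which g' arises from g by applying the partial embedding to the
  coefficients.\<close>

definition polys_over :: "('s::field \<times> 's) set \<Rightarrow> ('s poly \<times> 's poly) set" where
  "polys_over \<Gamma> = {(g, g'). \<forall>i. (coeff g i, coeff g' i) \<in> \<Gamma>}"

section \<open>Extension of a partial embedding by one element\<close>

context
  fixes j :: "'e::field \<Rightarrow> 's::field"
  assumes sc: "separable_closure j"
begin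

lemma j_emb: "field_embedding j"
  using sc by (simp add: separable_closure_def)

lemmas j_simps = field_embedding_simps[OF j_emb]

context
  fixes \<Gamma>
  assumes pe: "partial_embedding j \<Gamma>"
begin

lemma pe_base: "(j c, j c) \<in> \<Gamma>"
  using pe by (auto simp: partial_embedding_def)

lemma pe_0: "(0, 0) \<in> \<Gamma>" and pe_1: "(1, 1) \<in> \<Gamma>"
  using pe_base[of 0] pe_base[of 1] by (simp_all add: j_simps)

lemma pe_unique: "(x, y) \<in> \<Gamma> \<Longrightarrow> (x, y') \<in> \<Gamma> \<Longrightarrow> y = y'"
  using pe by (auto simp: partial_embedding_def single_valued_def)

lemma pe_add: "(x, x') \<in> \<Gamma> \<Longrightarrow> (y, y') \<in> \<Gamma> \<Longrightarrow> (x + y, x' + y') \<in> \<Gamma>"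
  and pe_mult: "(x, x') \<in> \<Gamma> \<Longrightarrow> (y, y') \<in> \<Gamma> \<Longrightarrow> (x * y, x' * y') \<in> \<Gamma>"
  using pe unfolding partial_embedding_def by blast+

lemma pe_minus: "(x, x') \<in> \<Gamma> \<Longrightarrow> (- x, - x') \<in> \<Gamma>"
  using pe_mult[OF pe_base[of "- 1"]] by (simp add: j_simps)

lemma pe_diff: "(x, x') \<in> \<Gamma> \<Longrightarrow> (y, y') \<in> \<Gamma> \<Longrightarrow> (x - y, x' - y') \<in> \<Gamma>"
  using pe_add[OF _ pe_minus, of x x' y y'] by simp

lemma pe_sum: "(\<And>i. i \<in> A \<Longrightarrow> (f i, f' i) \<in> \<Gamma>) \<Longrightarrow> (sum f A, sum f' A) \<in> \<Gamma>"
  by (induction A rule: infinite_finite_induct) (auto simp: pe_0 pe_add)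

lemma pe_poly_base:
  "(a, b) \<in> \<Gamma> \<Longrightarrow> (poly (map_poly j h) a, poly (map_poly j h) b) \<in> \<Gamma>"
proof (induction h)
  case 0 then show ?case by (simp add: pe_0)
next
  case (pCons c h) then show ?case
    by (simp add: map_poly_pCons j_simps pe_add pe_mult pe_base)
qed

text \<open>An annihilating polynomial over the base with zero constant term can be divided by the
  variable, because a is nonzero. The resulting relation exhibits the inverse of a as a polynomial
  in a over the base.\<close>

lemma algebraic_nonzero_const:
  assumes "a \<noteq> (0::'s)"
  obtains c h where "c \<noteq> 0" "j c + a * poly (map_poly j h) a = 0"
proof -
  obtain p0 where p0: "separable_poly p0" "poly (map_poly j p0) a = 0"
    using sc unfolding separable_closure_def by blast
  have "p \<noteq> 0 \<Longrightarrow> poly (map_poly j p) a = 0 \<Longrightarrow>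
      \<exists>c h. c \<noteq> 0 \<and> j c + a * poly (map_poly j h) a = 0" for p
  proof (induction "degree p" arbitrary: p rule: less_induct)
    case less
    obtain c h where ch: "p = pCons c h" by (cases p)
    have eq: "j c + a * poly (map_poly j h) a = 0"
      using less.prems(2) by (simp add: ch map_poly_pCons j_simps)
    show ?case
    proof (cases "c = 0")
      case True
      then have h: "h \<noteq> 0" "poly (map_poly j h) a = 0" using less.prems eq assms ch by (auto simp: j_simps)
      moreover have "degree h < degree p" using h ch by simp
      ultimately show ?thesis using less.hyps by blast
    qed (use eq in blast)
  qed
  then show ?thesis using p0 separable_poly_nonzero that by blast
qed

text \<open>Closure under sums and products already yields inverses: a nonzero a is algebraic over
  the base, so its inverse is a polynomial in a with base coefficients, and b satisfies the same
  relation.\<close>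

lemma pe_inverse:
  assumes ab: "(a, b) \<in> \<Gamma>"
  shows "(inverse a, inverse b) \<in> \<Gamma>"
proof (cases "a = 0")
  case True then show ?thesis using pe_unique[OF pe_0] ab pe_0 by fastforce
next
  case False
  then obtain c h where ch: "c \<noteq> 0" "j c + a * poly (map_poly j h) a = 0"
    by (rule algebraic_nonzero_const)
  let ?h = "\<lambda>x. poly (map_poly j h) x"
  have hab: "(?h a, ?h b) \<in> \<Gamma>" using pe_poly_base[OF ab] .
  have "(j c + a * ?h a, j c + b * ?h b) \<in> \<Gamma>" by (intro pe_add pe_mult pe_base ab hab)
  then have b: "j c + b * ?h b = 0" using pe_unique[OF pe_0] ch by fastforce
  have "inverse x = j (- inverse c) * ?h x" if "j c + x * ?h x = 0" for x
  proof (rule inverse_unique)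
    have "x * ?h x = - j c" using that by (simp add: eq_neg_iff_add_eq_0 add.commute)
    then have "x * (j (- inverse c) * ?h x) = j (- inverse c) * (- j c)" by (metis mult.left_commute)
    then show "x * (j (- inverse c) * ?h x) = 1" using ch(1) by (simp add: j_simps)
  qed
  then have "inverse a = j (- inverse c) * ?h a" "inverse b = j (- inverse c) * ?h b"
    using b ch by auto
  then show ?thesis using pe_mult[OF pe_base hab] by simp
qed

lemma polys_over_add: "(g, g') \<in> polys_over \<Gamma> \<Longrightarrow> (h, h') \<in> polys_over \<Gamma> \<Longrightarrow> (g + h, g' + h') \<in> polys_over \<Gamma>"
  and polys_over_diff: "(g, g') \<in> polys_over \<Gamma> \<Longrightarrow> (h, h') \<in> polys_over \<Gamma> \<Longrightarrow> (g - h, g' - h') \<in> polys_over \<Gamma>"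
  and polys_over_mult: "(g, g') \<in> polys_over \<Gamma> \<Longrightarrow> (h, h') \<in> polys_over \<Gamma> \<Longrightarrow> (g * h, g' * h') \<in> polys_over \<Gamma>"
  by (auto simp: polys_over_def coeff_mult intro: pe_add pe_diff pe_mult pe_sum)

lemma polys_over_monom: "(a, b) \<in> \<Gamma> \<Longrightarrow> (monom a n, monom b n) \<in> polys_over \<Gamma>"
  by (auto simp: polys_over_def pe_0)

lemma polys_over_base: "(map_poly j p, map_poly j p) \<in> polys_over \<Gamma>"
  by (auto simp: polys_over_def coeff_map_poly j_simps pe_base)

lemma polys_over_0: "(0, g) \<in> polys_over \<Gamma> \<Longrightarrow> g = 0"
  using pe_unique[OF pe_0] by (force simp: polys_over_def intro: poly_eqI)

lemma polys_over_monic: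
  assumes "(p, p') \<in> polys_over \<Gamma>" "lead_coeff p = 1"
  shows "degree p' = degree p" "lead_coeff p' = 1"
proof -
  have c: "(coeff p i, coeff p' i) \<in> \<Gamma>" for i using assms by (auto simp: polys_over_def)
  have 1: "coeff p' (degree p) = 1" using c[of "degree p"] assms(2) pe_unique[OF pe_1] by force
  have "coeff p' i = 0" if "i > degree p" for i
    using c[of i] that pe_unique[OF pe_0] by (fastforce simp: coeff_eq_0)
  then show "degree p' = degree p" using 1
    by (intro antisym degree_le le_degree) auto
  then show "lead_coeff p' = 1" using 1 by simp
qed

text \<open>p is the monic polynomial of least degree over the domain with root x. Leading terms are
  cancelled in both components of a pair at once, so the quotient of g by p has an image that serves
  as quotient of g' by p'; thus p' divides g' although x is in general no root of g'.\<close>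

lemma minimal_polynomial:
  obtains p p' where "(p, p') \<in> polys_over \<Gamma>" "lead_coeff p = 1" "poly p x = 0"
    "\<And>g g'. (g, g') \<in> polys_over \<Gamma> \<Longrightarrow> poly g x = 0 \<Longrightarrow> p dvd g \<and> p' dvd g'"
proof -
  let ?P = "\<lambda>n. \<exists>p p'. (p, p') \<in> polys_over \<Gamma> \<and> p \<noteq> 0 \<and> poly p x = 0 \<and> degree p = n"
  obtain q where "separable_poly q" "poly (map_poly j q) x = 0"
    using sc unfolding separable_closure_def by blast
  then have ex: "\<exists>n. ?P n"
    using polys_over_base separable_poly_nonzero separable_poly_map[OF j_emb] by blast
  define n where "n = (LEAST n. ?P n)"
  obtain q q' where q: "(q, q') \<in> polys_over \<Gamma>" "q \<noteq> 0" "poly q x = 0" "degree q = n"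
    using LeastI_ex[OF ex] unfolding n_def by blast
  have min: "n \<le> degree g" if "(g, g') \<in> polys_over \<Gamma>" "g \<noteq> 0" "poly g x = 0" for g g'
    unfolding n_def using that by (intro Least_le) blast
  let ?l = "inverse (lead_coeff q)" and ?l' = "inverse (coeff q' (degree q))"
  have "(?l, ?l') \<in> \<Gamma>" using q(1) by (intro pe_inverse) (auto simp: polys_over_def)
  then have pp: "(monom ?l 0 * q, monom ?l' 0 * q') \<in> polys_over \<Gamma>"
    by (intro polys_over_mult polys_over_monom q(1))
  define p p' where "p = monom ?l 0 * q" and "p' = monom ?l' 0 * q'"
  have p: "(p, p') \<in> polys_over \<Gamma>" "lead_coeff p = 1" "poly p x = 0" "degree p = n"
    using pp q by (auto simp: p_def p'_def monom_0)
  have "(g, g') \<in> polys_over \<Gamma> \<Longrightarrow> poly g x = 0 \<Longrightarrow> p dvd g \<and> p' dvd g'" for g g'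
  \<comment> \<open>The measure puts the zero polynomial strictly below the nonzero constants, which
    have the same degree.\<close>
  proof (induction "if g = 0 then 0 else Suc (degree g)" arbitrary: g g' rule: less_induct)
    case less
    show ?case
    proof (cases "g = 0")
      case True then show ?thesis using polys_over_0 less.prems by auto
    next
      case False
      then have le: "n \<le> degree g" using min less.prems by blast
      define k where "k = degree g - n"
      let ?m = "monom (lead_coeff g) k" and ?m' = "monom (coeff g' (degree g)) k"
      let ?h = "g - ?m * p" and ?h' = "g' - ?m' * p'"
      have h: "(?h, ?h') \<in> polys_over \<Gamma>"
        using less.prems(1) p(1) by (intro polys_over_diff polys_over_mult polys_over_monom)
           (auto simp: polys_over_def)
      have hx: "poly ?h x = 0" using less.prems p by simp
      have "?h = 0 \<or> degree ?h < degree g"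
      proof (cases "?h = 0")
        case False
        have "degree (?m * p) \<le> degree g"
          using degree_mult_le[of ?m p] degree_monom_le[of "lead_coeff g" k] p(4) le k_def by linarith
        then have "degree ?h \<le> degree g" by (intro degree_diff_le) auto
        moreover have "coeff ?h (degree g) = 0"
          using le p(2,4) by (simp add: coeff_monom_mult k_def)
        ultimately show ?thesis using False
          by (metis leading_coeff_0_iff le_neq_implies_less)
      qed simp
      then have "p dvd ?h \<and> p' dvd ?h'" using less.hyps[OF _ h hx] False by auto
      then have "p dvd ?h + ?m * p" "p' dvd ?h' + ?m' * p'" by (blast intro: dvd_add dvd_triv_right)+
      then show ?thesis by simp
    qed
  qed
  then show ?thesis using that p by blast
qed

text \<open>The only possible extension sends g(x) to g'(x'). It is well defined because p' divides
  the image of any polynomial that vanishes at x, and p' vanishes at x'.\<close>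

lemma partial_embedding_adjoin:
  assumes dv: "\<And>g g'. (g, g') \<in> polys_over \<Gamma> \<Longrightarrow> poly g x = 0 \<Longrightarrow> p' dvd g'"
    and root: "poly p' x' = 0"
  shows "\<exists>\<Gamma>'. partial_embedding j \<Gamma>' \<and> \<Gamma> \<subseteq> \<Gamma>' \<and> (x, x') \<in> \<Gamma>'"
proof -
  define \<Gamma>' where "\<Gamma>' = (\<lambda>(g, g'). (poly g x, poly g' x')) ` polys_over \<Gamma>"
  have I: "(poly g x, poly g' x') \<in> \<Gamma>'" if "(g, g') \<in> polys_over \<Gamma>" for g g'
    using that by (auto simp: \<Gamma>'_def)
  have E: "\<exists>g g'. (g, g') \<in> polys_over \<Gamma> \<and> y = poly g x \<and> y' = poly g' x'" if "(y, y') \<in> \<Gamma>'" for y y'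
    using that by (auto simp: \<Gamma>'_def)
  have sub: "\<Gamma> \<subseteq> \<Gamma>'"
  proof
    fix z assume "z \<in> \<Gamma>"
    then show "z \<in> \<Gamma>'" using I[OF polys_over_monom[of "fst z" "snd z" 0]] by (simp add: poly_monom)
  qed
  have "(x, x') \<in> \<Gamma>'" using I[OF polys_over_monom[OF pe_1, of 1]] by (simp add: poly_monom)
  moreover have "single_valued \<Gamma>'"
  proof (rule single_valuedI)
    fix y z z' assume "(y, z) \<in> \<Gamma>'" "(y, z') \<in> \<Gamma>'"
    then obtain g g' h h' where gh: "(g, g') \<in> polys_over \<Gamma>" "(h, h') \<in> polys_over \<Gamma>"
      "poly g x = poly h x" "z = poly g' x'" "z' = poly h' x'" using E by metis
    then have "p' dvd g' - h'" using dv[OF polys_over_diff] by auto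
    then have "poly (g' - h') x' = 0" using root by (metis dvdE mult_zero_left poly_mult)
    then show "z = z'" using gh by simp
  qed
  moreover have "(y + z, y' + z') \<in> \<Gamma>' \<and> (y * z, y' * z') \<in> \<Gamma>'"
    if yz: "(y, y') \<in> \<Gamma>'" "(z, z') \<in> \<Gamma>'" for y y' z z'
  proof -
    obtain g g' h h' where "(g, g') \<in> polys_over \<Gamma>" "(h, h') \<in> polys_over \<Gamma>"
      "y = poly g x" "z = poly h x" "y' = poly g' x'" "z' = poly h' x'" using E yz by metis
    then show ?thesis using I[OF polys_over_add] I[OF polys_over_mult] by auto
  qed
  ultimately have "partial_embedding j \<Gamma>'"
    using sub pe_base unfolding partial_embedding_def by blast
  then show ?thesis using sub \<open>(x, x') \<in> \<Gamma>'\<close> by blast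
qed

text \<open>x is a root of a separable polynomial q over the base. As the embedding fixes the base,
  p' divides the image of q in the closure, so p' is separable and has a root there, to which x can
  be sent.\<close>

lemma partial_embedding_extend: "\<exists>\<Gamma>' x'. partial_embedding j \<Gamma>' \<and> \<Gamma> \<subseteq> \<Gamma>' \<and> (x, x') \<in> \<Gamma>'"
proof -
  obtain p p' where p: "(p, p') \<in> polys_over \<Gamma>" "lead_coeff p = 1" "poly p x = 0"
    and dv: "\<And>g g'. (g, g') \<in> polys_over \<Gamma> \<Longrightarrow> poly g x = 0 \<Longrightarrow> p dvd g \<and> p' dvd g'"
    using minimal_polynomial[of x] by blast
  obtain q where q: "separable_poly q" "poly (map_poly j q) x = 0"
    using sc unfolding separable_closure_def by blast
  have "p' dvd map_poly j q" using dv[OF polys_over_base q(2)] by simp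
  then have "separable_poly p'"
    using separable_poly_map[OF j_emb q(1)] separable_poly_dvd by blast
  moreover have "degree p > 0"
  proof (rule ccontr)
    assume "\<not> degree p > 0"
    then have "p = [:1:]" using p(2) by (metis degree_eq_zeroE gr0I lead_coeff_pCons(2) pCons_0_0)
    then show False using p(3) by simp
  qed
  then have "degree p' > 0" using polys_over_monic[OF p(1,2)] by simp
  ultimately obtain x' where "poly p' x' = 0"
    using sc unfolding separable_closure_def by blast
  then show ?thesis using partial_embedding_adjoin[of x p' x'] dv by blast
qed

end

text \<open>A maximal extension, given by Zorn's lemma, is defined everywhere, since any further
  element could be adjoined to its domain.\<close>

lemma galois_extend:
  assumes pe: "partial_embedding j \<Gamma>"
  shows "\<exists>\<sigma>\<in>galois j. \<forall>(x, y)\<in>\<Gamma>. \<sigma> x = y"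
proof -
  define A where "A = {\<Delta>. partial_embedding j \<Delta> \<and> \<Gamma> \<subseteq> \<Delta>}"
  have "\<exists>M\<in>A. \<forall>X\<in>A. M \<subseteq> X \<longrightarrow> X = M"
  proof (rule subset_Zorn_nonempty)
    show "A \<noteq> {}" using pe by (auto simp: A_def)
    fix C assume C: "C \<noteq> {}" "subset.chain A C"
    have pC: "partial_embedding j X" "\<Gamma> \<subseteq> X" if "X \<in> C" for X
      using C that by (auto simp: A_def subset.chain_def)
    have two: "\<exists>X\<in>C. z \<in> X \<and> z' \<in> X" if zz: "z \<in> \<Union>C" "z' \<in> \<Union>C" for z z'
    proof -
      obtain X Y where "X \<in> C" "Y \<in> C" "z \<in> X" "z' \<in> Y" using zz by blast
      moreover have "X \<subseteq> Y \<or> Y \<subseteq> X" using C(2) calculation by (auto simp: subset.chain_def)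
      ultimately show ?thesis by blast
    qed
    have "single_valued (\<Union>C)"
      by (rule single_valuedI) (meson two pC pe_unique)
    moreover have "(j c, j c) \<in> \<Union>C" for c using C(1) pC pe_base by blast
    moreover have "(x + y, x' + y') \<in> \<Union>C \<and> (x * y, x' * y') \<in> \<Union>C"
      if "(x, x') \<in> \<Union>C" "(y, y') \<in> \<Union>C" for x y x' y'
      using two[OF that] pC pe_add pe_mult by (meson UnionI)
    moreover have "\<Gamma> \<subseteq> \<Union>C" using C(1) pC by blast
    ultimately show "\<Union>C \<in> A" by (simp add: A_def partial_embedding_def)
  qed
  then obtain M where M: "partial_embedding j M" "\<Gamma> \<subseteq> M"
    and max: "\<And>X. partial_embedding j X \<Longrightarrow> M \<subseteq> X \<Longrightarrow> X = M"
    by (auto simp: A_def)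
  have total: "\<exists>y. (x, y) \<in> M" for x
    using partial_embedding_extend[OF M(1), of x] max by blast
  define \<sigma> where "\<sigma> x = (THE y. (x, y) \<in> M)" for x
  have s: "(x, y) \<in> M \<longleftrightarrow> \<sigma> x = y" for x y
    using total[of x] pe_unique[OF M(1)] unfolding \<sigma>_def by (metis the_equality)
  have emb: "field_embedding \<sigma>"
    using pe_1[OF M(1)] pe_add[OF M(1)] pe_mult[OF M(1)] by (simp add: s field_embedding_def)
  have fixb: "\<sigma> (j c) = j c" for c using pe_base[OF M(1)] by (simp add: s)
  have inj: "inj \<sigma>" by (auto simp: inj_def field_embedding_simps[OF emb])
  \<comment> \<open>\<sigma> maps the finite set of roots of a base polynomial annihilating y
    injectively into itself, hence onto itself.\<close>
  have "y \<in> range \<sigma>" for y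
  proof -
    obtain p where p: "separable_poly p" "poly (map_poly j p) y = 0"
      using sc unfolding separable_closure_def by blast
    let ?R = "{x. poly (map_poly j p) x = 0}"
    have "finite ?R"
      using separable_poly_nonzero[OF separable_poly_map[OF j_emb p(1)]] by (rule poly_roots_finite)
    moreover have "\<sigma> ` ?R \<subseteq> ?R"
    proof clarify
      fix x assume "poly (map_poly j p) x = 0"
      then have "(0, poly (map_poly j p) (\<sigma> x)) \<in> M"
        using pe_poly_base[OF M(1), of x "\<sigma> x" p] by (simp add: s)
      then show "poly (map_poly j p) (\<sigma> x) = 0" using pe_unique[OF M(1)] pe_0[OF M(1)] by blast
    qed
    ultimately have "\<sigma> ` ?R = ?R" using inj by (meson endo_inj_surj inj_on_subset subset_UNIV)
    then show ?thesis using p(2) by blast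
  qed
  then have "bij \<sigma>" using inj by (auto simp: bij_def)
  then have "\<sigma> \<in> galois j" using emb fixb by (simp add: galois_def)
  then show ?thesis using M(2) s by blast
qed

text \<open>An element w outside the base has a minimal polynomial of degree at least two. By
  separability it has a second root w', and the assignment of w' to w extends to an automorphism
  that moves w.\<close>

theorem galois_fixed_field:
  assumes "\<And>\<sigma>. \<sigma> \<in> galois j \<Longrightarrow> \<sigma> w = w"
  shows "w \<in> range j"
proof (rule ccontr)
  assume w: "w \<notin> range j"
  \<comment> \<open>The identity of the base as a partial embedding: a polynomial over the base is
    its own image, whence p' = p below.\<close>
  define \<Gamma> where "\<Gamma> = Id_on (range j)"
  have pe: "partial_embedding j \<Gamma>"
    by (auto simp: partial_embedding_def \<Gamma>_def single_valued_def) (metis j_simps(3,4) rangeI)+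
  obtain p p' where p: "(p, p') \<in> polys_over \<Gamma>" "lead_coeff p = 1" "poly p w = 0"
    and dv: "\<And>g g'. (g, g') \<in> polys_over \<Gamma> \<Longrightarrow> poly g w = 0 \<Longrightarrow> p dvd g \<and> p' dvd g'"
    using minimal_polynomial[OF pe, of w] by blast
  have "(coeff p i, coeff p' i) \<in> Id_on (range j)" for i
    using p(1) by (simp add: polys_over_def \<Gamma>_def)
  then have "coeff p' i = coeff p i" for i by (metis Id_onE prod.inject)
  then have pp: "p' = p" by (rule poly_eqI)
  obtain q where q: "separable_poly q" "poly (map_poly j q) w = 0"
    using sc unfolding separable_closure_def by blast
  have "p dvd map_poly j q" using dv[OF polys_over_base[OF pe] q(2)] by simp
  then have sp: "separable_poly p"
    using separable_poly_map[OF j_emb q(1)] separable_poly_dvd by blast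
  obtain g where g: "p = [:- w, 1:] * g" using p(3) by (auto simp: poly_eq_0_iff_dvd elim: dvdE)
  have "degree g > 0"
  proof (rule ccontr)
    assume "\<not> degree g > 0"
    then obtain c where c: "g = [:c:]" by (auto elim: degree_eq_zeroE)
    then have "c = 1" using p(2) g by (simp add: lead_coeff_mult del: mult_pCons_left mult_pCons_right)
    then have "coeff p 0 = - w" using g c by simp
    moreover have "coeff p 0 \<in> range j" using p(1) by (auto simp: polys_over_def \<Gamma>_def)
    ultimately show False using w by (metis (no_types, lifting) image_iff j_simps(5) minus_minus rangeI)
  qed
  moreover have "separable_poly g" using sp separable_poly_dvd g by (metis dvd_triv_right)
  ultimately obtain w' where w': "poly g w' = 0" using sc unfolding separable_closure_def by blast
  then have "w' \<noteq> w" using separable_poly_no_double_root sp g by metis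
  obtain \<Delta> where \<Delta>: "partial_embedding j \<Delta>" "(w, w') \<in> \<Delta>"
    using partial_embedding_adjoin[OF pe, of w p' w'] dv w' pp g by auto
  obtain \<sigma> where "\<sigma> \<in> galois j" "\<sigma> w = w'" using galois_extend[OF \<Delta>(1)] \<Delta>(2) by auto
  then show False using assms \<open>w' \<noteq> w\<close> by metis
qed

end

section \<open>Continuous cochains\<close>

lemma openin_krull_agree:
  assumes "finite \<Phi>"
  shows "openin (krull j) {\<tau> \<in> galois j. \<forall>x\<in>\<Phi>. \<tau> x = \<sigma> x}"
proof -
  let ?U = "\<lambda>x. if x \<in> \<Phi> then {\<sigma> x} else UNIV"
  have "openin (product_topology (\<lambda>_. discrete_topology UNIV) UNIV) (Pi\<^sub>E UNIV ?U)"
  proof (rule product_topology_basis)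
    have "{x. ?U x \<noteq> topspace (discrete_topology UNIV)} \<subseteq> \<Phi>" by auto
    then show "finite {x. ?U x \<noteq> topspace (discrete_topology UNIV)}" using assms by (rule finite_subset)
  qed auto
  moreover have "{\<tau> \<in> galois j. \<forall>x\<in>\<Phi>. \<tau> x = \<sigma> x} = Pi\<^sub>E UNIV ?U \<inter> galois j"
    by (auto simp: PiE_iff split: if_splits)
  ultimately show ?thesis unfolding krull_def openin_subtopology by blast
qed

lemma openin_krullD:
  assumes "openin (krull j) U" "\<sigma> \<in> U"
  shows "\<exists>\<Phi>. finite \<Phi> \<and> {\<tau> \<in> galois j. \<forall>x\<in>\<Phi>. \<tau> x = \<sigma> x} \<subseteq> U"
proof -
  obtain T where T: "openin (product_topology (\<lambda>_. discrete_topology UNIV) UNIV) T" "U = T \<inter> galois j"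
    using assms(1) unfolding krull_def openin_subtopology by blast
  obtain V where V: "\<sigma> \<in> Pi\<^sub>E UNIV V" "finite {i. V i \<noteq> UNIV}" "Pi\<^sub>E UNIV V \<subseteq> T"
    using product_topology_open_contains_basis[OF T(1), of \<sigma>] assms(2) T(2) by auto
  have "{\<tau> \<in> galois j. \<forall>x\<in>{i. V i \<noteq> UNIV}. \<tau> x = \<sigma> x} \<subseteq> U"
  proof clarify
    fix \<tau> assume \<tau>: "\<tau> \<in> galois j" "\<forall>x\<in>{i. V i \<noteq> UNIV}. \<tau> x = \<sigma> x"
    have "\<tau> x \<in> V x" for x using \<tau>(2) V(1) by (cases "V x = UNIV") (auto simp: PiE_iff)
    then have "\<tau> \<in> Pi\<^sub>E UNIV V" by auto
    then show "\<tau> \<in> U" using V(3) T(2) \<tau>(1) by blast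
  qed
  then show ?thesis using V(2) by blast
qed

lemma topspace_krull [simp]: "topspace (krull j) = galois j"
  by (auto simp: krull_def)

lemma continuous_map_discrete_iff:
  "continuous_map X (discrete_topology UNIV) f \<longleftrightarrow>
     (\<forall>x\<in>topspace X. \<exists>U. openin X U \<and> x \<in> U \<and> (\<forall>y\<in>U. f y = f x))" (is "?L \<longleftrightarrow> ?R")
proof
  assume L: ?L
  show ?R
  proof
    fix x assume "x \<in> topspace X"
    moreover have "openin X {y \<in> topspace X. f y \<in> {f x}}"
      using L by (rule openin_continuous_map_preimage) simp
    ultimately show "\<exists>U. openin X U \<and> x \<in> U \<and> (\<forall>y\<in>U. f y = f x)" by force
  qed
next
  assume R: ?R
  show ?L
    unfolding continuous_map_def
  proof (intro conjI allI impI)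
    fix V
    show "openin X {x \<in> topspace X. f x \<in> V}"
    proof (subst openin_subopen, intro ballI)
      fix x assume x: "x \<in> {x \<in> topspace X. f x \<in> V}"
      then obtain U where U: "openin X U" "x \<in> U" "\<forall>y\<in>U. f y = f x" using R by blast
      then have "U \<subseteq> {x \<in> topspace X. f x \<in> V}" using x openin_subset by fastforce
      then show "\<exists>T. openin X T \<and> x \<in> T \<and> T \<subseteq> {x \<in> topspace X. f x \<in> V}" using U by blast
    qed
  qed auto
qed

text \<open>Continuity into a discrete space means local constancy, and neighbourhoods of \<sigma>
  are given by finitely many values. In this form cochains are built from square roots, and a
  neighbourhood of \<open>id\<close> is extracted from a given cochain.\<close>

lemma cochains1_iff:
  "f \<in> cochains1 j \<longleftrightarrow> (\<forall>\<sigma>\<in>galois j. \<exists>\<Phi>. finite \<Phi> \<and>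
     (\<forall>\<tau>\<in>galois j. (\<forall>x\<in>\<Phi>. \<tau> x = \<sigma> x) \<longrightarrow> f \<tau> = f \<sigma>))" (is "_ \<longleftrightarrow> ?R")
proof
  assume "f \<in> cochains1 j"
  then have c: "\<forall>\<sigma>\<in>galois j. \<exists>U. openin (krull j) U \<and> \<sigma> \<in> U \<and> (\<forall>y\<in>U. f y = f \<sigma>)"
    unfolding cochains1_def continuous_map_discrete_iff mem_Collect_eq topspace_krull .
  show ?R
  proof
    fix \<sigma> assume "\<sigma> \<in> galois j"
    then obtain U where U: "openin (krull j) U" "\<sigma> \<in> U" "\<forall>y\<in>U. f y = f \<sigma>" using c by blast
    obtain \<Phi> where \<Phi>: "finite \<Phi>" "{\<tau> \<in> galois j. \<forall>x\<in>\<Phi>. \<tau> x = \<sigma> x} \<subseteq> U"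
      using openin_krullD[OF U(1,2)] by (elim exE conjE)
    have "f \<tau> = f \<sigma>" if "\<tau> \<in> galois j" "\<forall>x\<in>\<Phi>. \<tau> x = \<sigma> x" for \<tau>
    proof -
      have "\<tau> \<in> U" by (rule subsetD[OF \<Phi>(2)]) (use that in simp)
      then show ?thesis using U(3) by (rule bspec[rotated])
    qed
    then show "\<exists>\<Phi>. finite \<Phi> \<and> (\<forall>\<tau>\<in>galois j. (\<forall>x\<in>\<Phi>. \<tau> x = \<sigma> x) \<longrightarrow> f \<tau> = f \<sigma>)"
      using \<Phi>(1) by (intro exI[of _ \<Phi>] conjI ballI impI)
  qed
next
  assume R: ?R
  show "f \<in> cochains1 j"
    unfolding cochains1_def continuous_map_discrete_iff mem_Collect_eq topspace_krull
  proof
    fix \<sigma> assume s: "\<sigma> \<in> galois j"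
    then obtain \<Phi> where \<Phi>: "finite \<Phi>" "\<forall>\<tau>\<in>galois j. (\<forall>x\<in>\<Phi>. \<tau> x = \<sigma> x) \<longrightarrow> f \<tau> = f \<sigma>"
      using R by blast
    show "\<exists>U. openin (krull j) U \<and> \<sigma> \<in> U \<and> (\<forall>y\<in>U. f y = f \<sigma>)"
      using openin_krull_agree[OF \<Phi>(1), of j \<sigma>] s \<Phi>(2)
      by (intro exI[of _ "{\<tau> \<in> galois j. \<forall>x\<in>\<Phi>. \<tau> x = \<sigma> x}"]) blast
  qed
qed

section \<open>Automorphisms and cochain identities\<close>

lemma galois_id: "id \<in> galois j" "(\<lambda>x. x) \<in> galois j"
  by (auto simp: galois_def field_embedding_def bij_def)

lemma galois_comp: "\<sigma> \<in> galois j \<Longrightarrow> \<tau> \<in> galois j \<Longrightarrow> \<sigma> \<circ> \<tau> \<in> galois j"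
  by (auto simp: galois_def field_embedding_def bij_comp)

lemma galois_inv:
  assumes "\<sigma> \<in> galois j"
  shows "inv_into UNIV \<sigma> \<in> galois j"
proof -
  have b: "bij \<sigma>" and e: "field_embedding \<sigma>" and f: "\<sigma> (j c) = j c" for c
    using assms by (auto simp: galois_def)
  have i: "inv_into UNIV \<sigma> (\<sigma> x) = x" "\<sigma> (inv_into UNIV \<sigma> x) = x" for x
    using b by (simp_all add: bij_is_inj bij_is_surj surj_f_inv_f)
  have "inv_into UNIV \<sigma> (x + y) = inv_into UNIV \<sigma> x + inv_into UNIV \<sigma> y" "inv_into UNIV \<sigma> (x * y) = inv_into UNIV \<sigma> x * inv_into UNIV \<sigma> y" for x y
    by (metis i field_embedding_simps(3)[OF e], metis i field_embedding_simps(4)[OF e])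
  moreover have "inv_into UNIV \<sigma> 1 = 1" by (metis i(1) field_embedding_simps(2)[OF e])
  moreover have "inv_into UNIV \<sigma> (j c) = j c" for c by (metis i(1) f)
  ultimately show ?thesis using b by (simp add: galois_def field_embedding_def bij_imp_bij_inv)
qed

lemma galois_emb: "\<sigma> \<in> galois j \<Longrightarrow> field_embedding \<sigma>"
  by (auto simp: galois_def)

lemmas galois_simps = field_embedding_simps[OF galois_emb]

lemma galois_fix: "\<sigma> \<in> galois j \<Longrightarrow> \<sigma> (j c) = j c"
  by (auto simp: galois_def)

lemma bit_add_self [simp]: "x + x = (0::bit)" "x + (x + y) = y"
  by (cases x; cases y; simp)+

text \<open>The identity d(df) = 0 with letters for the values of f; the letter d stands for the
  value at the triple product, common to both bracketings.\<close>

lemma coboundary_cancel: "a - b + c - (a - d + e) + (b - d + g) - (c - e + g) = (0::'a::ab_group_add)"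
  by (simp add: algebra_simps)

lemma add_cocycle_expr:
  "(a + a') - (b + b') + (c + c') - (d + d') = (a - b + c - d) + (a' - b' + c' - (d'::'a::ab_group_add))"
  by (simp add: algebra_simps)

lemma add_coboundary_expr:
  "(a + a') - (b + b') + (c + c') = (a - b + c) + (a' - b' + (c'::'a::ab_group_add))"
  by (simp add: algebra_simps)

lemma extend2_apply: "\<sigma> \<in> galois j \<Longrightarrow> \<tau> \<in> galois j \<Longrightarrow> extend2 j f (\<sigma>, \<tau>) = f \<sigma> \<tau>"
  by (simp add: extend2_def)

lemma extend2_add: "extend2 j f p + extend2 j g p = extend2 j (\<lambda>\<sigma> \<tau>. f \<sigma> \<tau> + g \<sigma> \<tau>) p"
  by (cases p) (simp add: extend2_def)

lemma continuous_map_discrete_combine: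
  assumes "continuous_map X (discrete_topology UNIV) f" "continuous_map X (discrete_topology UNIV) g"
  shows "continuous_map X (discrete_topology UNIV) (\<lambda>x. h (f x) (g x))"
  unfolding continuous_map_discrete_iff
proof
  fix x assume x: "x \<in> topspace X"
  obtain U where U: "openin X U" "x \<in> U" "\<forall>y\<in>U. f y = f x"
    using bspec[OF assms(1)[unfolded continuous_map_discrete_iff] x] by (elim exE conjE)
  obtain V where V: "openin X V" "x \<in> V" "\<forall>y\<in>V. g y = g x"
    using bspec[OF assms(2)[unfolded continuous_map_discrete_iff] x] by (elim exE conjE)
  have "h (f y) (g y) = h (f x) (g x)" if "y \<in> U \<inter> V" for y using that U(3) V(3) by (metis IntE)
  then show "\<exists>U. openin X U \<and> x \<in> U \<and> (\<forall>y\<in>U. h (f y) (g y) = h (f x) (g x))"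
    using U V by (intro exI[of _ "U \<inter> V"]) blast
qed

text \<open>The value of \<sigma>\<tau> at k depends only on \<tau> at k and on \<sigma> at the one
  point \<tau>(k), so a product of two basic neighbourhoods suffices.\<close>

lemma continuous_map_galois_comp:
  "continuous_map (prod_topology (krull j) (krull j)) (krull j) (\<lambda>p. fst p \<circ> snd p)"
proof -
  have "continuous_map (prod_topology (krull j) (krull j)) (discrete_topology UNIV) (\<lambda>p. (fst p \<circ> snd p) k)" for k
    unfolding continuous_map_discrete_iff topspace_prod_topology topspace_krull
  proof
    fix p assume p: "p \<in> galois j \<times> galois j"
    let ?A = "\<lambda>z \<sigma>. {\<sigma>' \<in> galois j. \<forall>x\<in>{z}. \<sigma>' x = \<sigma> x}"
    have "openin (prod_topology (krull j) (krull j)) (?A (snd p k) (fst p) \<times> ?A k (snd p))"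
      by (intro openin_prod_Times_iff[THEN iffD2] disjI2 conjI openin_krull_agree) simp_all
    then show "\<exists>U. openin (prod_topology (krull j) (krull j)) U \<and> p \<in> U \<and>
        (\<forall>q\<in>U. (fst q \<circ> snd q) k = (fst p \<circ> snd p) k)"
      using p by (intro exI[of _ "?A (snd p k) (fst p) \<times> ?A k (snd p)"]) auto
  qed
  moreover have "(\<lambda>p. fst p \<circ> snd p) \<in> topspace (prod_topology (krull j) (krull j)) \<rightarrow> galois j"
    by (auto intro: galois_comp)
  ultimately show ?thesis
    unfolding krull_def[of j] continuous_map_in_subtopology continuous_map_componentwise_UNIV
    by (simp add: krull_def[of j, symmetric])
qed

lemma extend2_in_cocycles2:
  assumes cont: "continuous_map (prod_topology (krull j) (krull j)) (discrete_topology UNIV) (\<lambda>p. f (fst p) (snd p))"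
    and coc: "\<And>\<sigma> \<tau> \<upsilon>. \<sigma> \<in> galois j \<Longrightarrow> \<tau> \<in> galois j \<Longrightarrow> \<upsilon> \<in> galois j \<Longrightarrow>
      f \<tau> \<upsilon> - f (\<sigma> \<circ> \<tau>) \<upsilon> + f \<sigma> (\<tau> \<circ> \<upsilon>) - f \<sigma> \<tau> = 0"
  shows "extend2 j f \<in> cocycles2 j"
  unfolding cocycles2_def cochains2_def mem_Collect_eq
proof (intro conjI ballI allI impI)
  show "continuous_map (prod_topology (krull j) (krull j)) (discrete_topology UNIV) (extend2 j f)"
    by (rule continuous_map_eq[OF cont]) (auto simp: extend2_def)
  fix p assume "p \<notin> galois j \<times> galois j"
  then show "extend2 j f p = 0" by (cases p) (auto simp: extend2_def)
next
  fix \<sigma> \<tau> \<upsilon> assume *: "\<sigma> \<in> galois j" "\<tau> \<in> galois j" "\<upsilon> \<in> galois j"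
  show "extend2 j f (\<tau>, \<upsilon>) - extend2 j f (\<sigma> \<circ> \<tau>, \<upsilon>) + extend2 j f (\<sigma>, \<tau> \<circ> \<upsilon>) - extend2 j f (\<sigma>, \<tau>) = 0"
    using coc[OF *] * by (simp only: extend2_apply galois_comp)
qed

lemma continuous_map_cochain1:
  assumes "f \<in> cochains1 j"
  shows "continuous_map (prod_topology (krull j) (krull j)) (discrete_topology UNIV) (\<lambda>p. f (fst p))"
    "continuous_map (prod_topology (krull j) (krull j)) (discrete_topology UNIV) (\<lambda>p. f (snd p))"
    "continuous_map (prod_topology (krull j) (krull j)) (discrete_topology UNIV) (\<lambda>p. f (fst p \<circ> snd p))"
  using continuous_map_compose[OF continuous_map_fst assms[unfolded cochains1_def mem_Collect_eq]]
    continuous_map_compose[OF continuous_map_snd assms[unfolded cochains1_def mem_Collect_eq]]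
    continuous_map_compose[OF continuous_map_galois_comp assms[unfolded cochains1_def mem_Collect_eq]]
  by (simp_all only: o_def)

lemma coboundaries2_subset: "coboundaries2 j \<subseteq> cocycles2 j"
proof
  fix g assume "g \<in> coboundaries2 j"
  then obtain f where g: "g = extend2 j (\<lambda>\<sigma> \<tau>. f \<tau> - f (\<sigma> \<circ> \<tau>) + f \<sigma>)" and f: "f \<in> cochains1 j"
    unfolding coboundaries2_def by (rule imageE)
  show "g \<in> cocycles2 j"
    unfolding g
  proof (rule extend2_in_cocycles2)
    show "continuous_map (prod_topology (krull j) (krull j)) (discrete_topology UNIV)
        (\<lambda>p. f (snd p) - f (fst p \<circ> snd p) + f (fst p))"
      by (intro continuous_map_discrete_combine[of _ _ _ "(+)"] continuous_map_discrete_combine[of _ _ _ "(-)"]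
          continuous_map_cochain1 f)
    fix \<sigma> \<tau> \<upsilon>
    show "f \<upsilon> - f (\<tau> \<circ> \<upsilon>) + f \<tau> - (f \<upsilon> - f (\<sigma> \<circ> \<tau> \<circ> \<upsilon>) + f (\<sigma> \<circ> \<tau>)) +
        (f (\<tau> \<circ> \<upsilon>) - f (\<sigma> \<circ> (\<tau> \<circ> \<upsilon>)) + f \<sigma>) - (f \<tau> - f (\<sigma> \<circ> \<tau>) + f \<sigma>) = 0"
      unfolding o_assoc by (rule coboundary_cancel)
  qed
qed

section \<open>The groups of cocycles, coboundaries and cohomology classes\<close>

lemma cocycle_group_self: "f \<otimes>\<^bsub>cocycle_group j\<^esub> f = \<one>\<^bsub>cocycle_group j\<^esub>"
  unfolding cocycle_group_def monoid.simps by (rule ext) (rule bit_add_self)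

lemma comm_group_cocycle_group: "comm_group (cocycle_group j)"
proof (rule comm_groupI)
  have add: "(\<lambda>p. f p + g p) \<in> cocycles2 j" if fg: "f \<in> cocycles2 j" "g \<in> cocycles2 j" for f g
  proof -
    have "(\<lambda>p. f p + g p) \<in> cochains2 j"
      unfolding cochains2_def mem_Collect_eq
    proof (intro conjI)
      show "continuous_map (prod_topology (krull j) (krull j)) (discrete_topology UNIV) (\<lambda>p. f p + g p)"
        by (rule continuous_map_discrete_combine[where h = "(+)"]; use fg in \<open>unfold cocycles2_def cochains2_def, blast\<close>)
    qed (use fg in \<open>auto simp: cocycles2_def cochains2_def\<close>)
    moreover have "(f (\<tau>, \<upsilon>) + g (\<tau>, \<upsilon>)) - (f (\<sigma> \<circ> \<tau>, \<upsilon>) + g (\<sigma> \<circ> \<tau>, \<upsilon>)) +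
        (f (\<sigma>, \<tau> \<circ> \<upsilon>) + g (\<sigma>, \<tau> \<circ> \<upsilon>)) - (f (\<sigma>, \<tau>) + g (\<sigma>, \<tau>)) = 0"
      if "\<sigma> \<in> galois j" "\<tau> \<in> galois j" "\<upsilon> \<in> galois j" for \<sigma> \<tau> \<upsilon>
    proof -
      have "f (\<tau>, \<upsilon>) - f (\<sigma> \<circ> \<tau>, \<upsilon>) + f (\<sigma>, \<tau> \<circ> \<upsilon>) - f (\<sigma>, \<tau>) = 0"
        "g (\<tau>, \<upsilon>) - g (\<sigma> \<circ> \<tau>, \<upsilon>) + g (\<sigma>, \<tau> \<circ> \<upsilon>) - g (\<sigma>, \<tau>) = 0"
        using fg that by (auto simp: cocycles2_def)
      then show ?thesis unfolding add_cocycle_expr by simp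
    qed
    ultimately show ?thesis by (auto simp: cocycles2_def)
  qed
  fix f g assume *: "f \<in> carrier (cocycle_group j)" "g \<in> carrier (cocycle_group j)"
  show "f \<otimes>\<^bsub>cocycle_group j\<^esub> g \<in> carrier (cocycle_group j)"
    using add * by (simp add: cocycle_group_def)
next
  show "\<one>\<^bsub>cocycle_group j\<^esub> \<in> carrier (cocycle_group j)"
    by (auto simp: cocycle_group_def cocycles2_def cochains2_def)
next
  fix f assume *: "f \<in> carrier (cocycle_group j)"
  have "f \<otimes>\<^bsub>cocycle_group j\<^esub> f = \<one>\<^bsub>cocycle_group j\<^esub>" by (rule cocycle_group_self)
  then show "\<exists>g\<in>carrier (cocycle_group j). g \<otimes>\<^bsub>cocycle_group j\<^esub> f = \<one>\<^bsub>cocycle_group j\<^esub>"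
    using * by (rule bexI)
qed (unfold cocycle_group_def monoid.simps, simp_all only: add_0 add.assoc, simp_all only: add.commute)

lemma cochains1_add: "f \<in> cochains1 j \<Longrightarrow> g \<in> cochains1 j \<Longrightarrow> (\<lambda>\<sigma>. f \<sigma> + g \<sigma>) \<in> cochains1 j"
  unfolding cochains1_def mem_Collect_eq by (rule continuous_map_discrete_combine[where h = "(+)"])

lemma subgroup_coboundaries2: "subgroup (coboundaries2 j) (cocycle_group j)"
proof -
  interpret comm_group "cocycle_group j" by (rule comm_group_cocycle_group)
  show ?thesis
  proof (rule subgroupI)
    show "coboundaries2 j \<subseteq> carrier (cocycle_group j)"
      using coboundaries2_subset by (simp add: cocycle_group_def)
    have "(\<lambda>_. 0) \<in> cochains1 j" by (auto simp: cochains1_iff)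
    then show "coboundaries2 j \<noteq> {}" by (auto simp: coboundaries2_def)
    fix f g assume f: "f \<in> coboundaries2 j" and g: "g \<in> coboundaries2 j"
    have fc: "f \<in> carrier (cocycle_group j)"
      using f coboundaries2_subset by (auto simp: cocycle_group_def)
    have "f \<otimes>\<^bsub>cocycle_group j\<^esub> f = \<one>\<^bsub>cocycle_group j\<^esub>" by (rule cocycle_group_self)
    then show "inv\<^bsub>cocycle_group j\<^esub> f \<in> coboundaries2 j" using f fc by (simp add: inv_equality)
    obtain f' where f': "f = extend2 j (\<lambda>\<sigma> \<tau>. f' \<tau> - f' (\<sigma> \<circ> \<tau>) + f' \<sigma>)" "f' \<in> cochains1 j"
      using f unfolding coboundaries2_def by (rule imageE)
    obtain g' where g': "g = extend2 j (\<lambda>\<sigma> \<tau>. g' \<tau> - g' (\<sigma> \<circ> \<tau>) + g' \<sigma>)" "g' \<in> cochains1 j"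
      using g unfolding coboundaries2_def by (rule imageE)
    let ?h = "\<lambda>\<sigma>. f' \<sigma> + g' \<sigma>"
    have "f \<otimes>\<^bsub>cocycle_group j\<^esub> g = extend2 j (\<lambda>\<sigma> \<tau>. ?h \<tau> - ?h (\<sigma> \<circ> \<tau>) + ?h \<sigma>)"
      unfolding f' g' cocycle_group_def monoid.simps add_coboundary_expr by (rule ext) (rule extend2_add)
    then show "f \<otimes>\<^bsub>cocycle_group j\<^esub> g \<in> coboundaries2 j"
      unfolding coboundaries2_def by (rule image_eqI[where x = ?h]) (rule cochains1_add[OF f'(2) g'(2)])
  qed
qed

lemma normal_coboundaries2: "coboundaries2 j \<lhd> cocycle_group j"
  using comm_group.subgroup_imp_normal[OF comm_group_cocycle_group subgroup_coboundaries2] .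

lemma comm_group_H2: "comm_group (H2 j)"
  unfolding H2_def using comm_group.abelian_FactGroup[OF comm_group_cocycle_group subgroup_coboundaries2] .

lemma extend2_cong_iff:
  "extend2 j f = extend2 j g \<longleftrightarrow> (\<forall>\<sigma>\<in>galois j. \<forall>\<tau>\<in>galois j. f \<sigma> \<tau> = g \<sigma> \<tau>)" (is "?L \<longleftrightarrow> ?R")
proof
  assume L: ?L
  show ?R
  proof (intro ballI)
    fix \<sigma> \<tau> assume "\<sigma> \<in> galois j" "\<tau> \<in> galois j"
    then show "f \<sigma> \<tau> = g \<sigma> \<tau>" using fun_cong[OF L, of "(\<sigma>, \<tau>)"] by (simp only: extend2_apply)
  qed
next
  assume R: ?R
  show ?L
  proof
    fix p :: "('a \<Rightarrow> 'a) \<times> ('a \<Rightarrow> 'a)"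
    obtain \<sigma> \<tau> where p: "p = (\<sigma>, \<tau>)" by (cases p)
    show "extend2 j f p = extend2 j g p"
    proof (cases "\<sigma> \<in> galois j \<and> \<tau> \<in> galois j")
      case True
      then have "f \<sigma> \<tau> = g \<sigma> \<tau>" using R by blast
      then show ?thesis unfolding p extend2_def by (simp only: prod.case)
    next
      case False
      then show ?thesis unfolding p extend2_def by (simp only: prod.case if_False)
    qed
  qed
qed

lemma extend2_coboundary_iff:
  "extend2 j f \<in> coboundaries2 j \<longleftrightarrow>
     (\<exists>g\<in>cochains1 j. \<forall>\<sigma>\<in>galois j. \<forall>\<tau>\<in>galois j. f \<sigma> \<tau> = g \<tau> - g (\<sigma> \<circ> \<tau>) + g \<sigma>)"
  unfolding coboundaries2_def image_iff extend2_cong_iff ..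

section \<open>Quadratic characters and symbols\<close>

text \<open>The orbit lies among the roots of a polynomial over the base. It bounds the number of
  restrictions of automorphisms to a finite set.\<close>

lemma galois_finite_orbit:
  assumes "separable_closure j"
  shows "finite ((\<lambda>\<sigma>. \<sigma> x) ` galois j)"
proof -
  have emb: "field_embedding j" using assms by (simp add: separable_closure_def)
  obtain p where p: "separable_poly p" "poly (map_poly j p) x = 0"
    using assms unfolding separable_closure_def by blast
  have "map_poly j p \<noteq> 0" using separable_poly_nonzero[OF separable_poly_map[OF emb p(1)]] .
  then have "finite {y. poly (map_poly j p) y = 0}" by (rule poly_roots_finite)
  moreover have "(\<lambda>\<sigma>. \<sigma> x) ` galois j \<subseteq> {y. poly (map_poly j p) y = 0}"
  proof clarify
    fix \<sigma> assume s: "\<sigma> \<in> galois j"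
    have "map_poly \<sigma> (map_poly j p) = map_poly j p"
      using s by (intro poly_eqI) (simp add: coeff_map_poly galois_simps[OF s]
          field_embedding_simps[OF emb] galois_fix)
    then show "poly (map_poly j p) (\<sigma> x) = 0"
      using poly_map_poly_embedding[OF galois_emb[OF s], of "map_poly j p" x] p(2)
      by (simp add: galois_simps[OF s])
  qed
  ultimately show ?thesis by (rule finite_subset[rotated])
qed

text \<open>Subtracting \<open>h r m\<close> times the relation at x from the relation at xm removes
  the term of r and multiplies the others by \<open>h \<rho> m - h r m\<close>, so induction
  applies. M restricts the points of evaluation: the application needs a nonzero value at a point of
  a fixed field.\<close>

lemma dedekind_independence:
  fixes h :: "'r \<Rightarrow> 's::field \<Rightarrow> 's"
  assumes "finite R" "1 \<in> M" "\<And>x y. x \<in> M \<Longrightarrow> y \<in> M \<Longrightarrow> x * y \<in> M"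
    and "\<And>\<rho>. \<rho> \<in> R \<Longrightarrow> h \<rho> 1 = 1"
    and "\<And>\<rho> x y. \<rho> \<in> R \<Longrightarrow> x \<in> M \<Longrightarrow> y \<in> M \<Longrightarrow> h \<rho> (x * y) = h \<rho> x * h \<rho> y"
    and "\<And>\<rho> \<rho>'. \<rho> \<in> R \<Longrightarrow> \<rho>' \<in> R \<Longrightarrow> \<rho> \<noteq> \<rho>' \<Longrightarrow> \<exists>x\<in>M. h \<rho> x \<noteq> h \<rho>' x"
    and "\<And>x. x \<in> M \<Longrightarrow> (\<Sum>\<rho>\<in>R. a \<rho> * h \<rho> x) = 0"
  shows "\<forall>\<rho>\<in>R. a \<rho> = 0"
  using assms(1,4-7)
proof (induction R arbitrary: a)
  case empty then show ?case by simp
next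
  case (insert r R)
  have zero: "a \<rho> = 0" if r: "\<rho> \<in> R" for \<rho>
  proof -
    obtain m where m: "m \<in> M" "h \<rho> m \<noteq> h r m"
      using insert.prems(3)[of \<rho> r] insert.hyps(2) r by blast
    have "\<forall>\<rho>\<in>R. a \<rho> * (h \<rho> m - h r m) = 0"
    proof (rule insert.IH)
      fix x assume x: "x \<in> M"
      have "(\<Sum>\<rho>\<in>R. a \<rho> * (h \<rho> m - h r m) * h \<rho> x) =
          (\<Sum>\<rho>\<in>insert r R. a \<rho> * (h \<rho> m - h r m) * h \<rho> x)"
        using insert.hyps by simp
      also have "\<dots> = (\<Sum>\<rho>\<in>insert r R. a \<rho> * h \<rho> (x * m)) - h r m * (\<Sum>\<rho>\<in>insert r R. a \<rho> * h \<rho> x)"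
        unfolding sum_distrib_left sum_subtractf[symmetric] using insert.prems(2) x m(1)
        by (intro sum.cong refl) (simp add: algebra_simps)
      also have "\<dots> = 0" unfolding insert.prems(4)[OF x] insert.prems(4)[OF assms(3)[OF x m(1)]] by simp
      finally show "(\<Sum>\<rho>\<in>R. a \<rho> * (h \<rho> m - h r m) * h \<rho> x) = 0" .
    qed (use insert.prems in blast)+
    then show ?thesis using m(2) r by auto
  qed
  moreover have "a r = 0"
    using insert.prems(4)[OF assms(2)] insert.hyps insert.prems(1) zero by simp
  ultimately show ?case by blast
qed

lemma galois_character_eigenvector:
  fixes \<epsilon> :: "('s::field \<Rightarrow> 's) \<Rightarrow> 's"
  assumes sc: "separable_closure j"
    and H: "H \<subseteq> galois j" "id \<in> H" "\<And>\<sigma> \<tau>. \<sigma> \<in> H \<Longrightarrow> \<tau> \<in> H \<Longrightarrow> \<sigma> \<circ> \<tau> \<in> H" "\<And>\<sigma>. \<sigma> \<in> H \<Longrightarrow> inv_into UNIV \<sigma> \<in> H"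
    and sign: "\<And>\<sigma>. \<epsilon> \<sigma> \<in> {1, - 1}"
    and hom: "\<And>\<sigma> \<tau>. \<sigma> \<in> H \<Longrightarrow> \<tau> \<in> H \<Longrightarrow> \<epsilon> (\<sigma> \<circ> \<tau>) = \<epsilon> \<sigma> * \<epsilon> \<tau>"
    and fin: "finite \<Phi>" and cont: "\<And>\<sigma>. \<sigma> \<in> H \<Longrightarrow> \<forall>x\<in>\<Phi>. \<sigma> x = x \<Longrightarrow> \<epsilon> \<sigma> = 1"
  shows "\<exists>y. y \<noteq> 0 \<and> (\<forall>\<sigma>\<in>H. \<sigma> y = \<epsilon> \<sigma> * y)"
proof -
  \<comment> \<open>Restrictions to \<Phi> encode the cosets H/S, and M is the fixed field of S: on
    M an element of H acts through its coset.\<close>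
  define R where "R = (\<lambda>\<sigma>. restrict \<sigma> \<Phi>) ` H"
  define M where "M = {c. \<forall>\<sigma>\<in>H. (\<forall>x\<in>\<Phi>. \<sigma> x = x) \<longrightarrow> \<sigma> c = c}"
  have emb: "field_embedding \<sigma>" if "\<sigma> \<in> H" for \<sigma> using that H(1) galois_emb by blast
  have inv: "inv_into UNIV \<sigma> (\<sigma> x) = x" "\<sigma> (inv_into UNIV \<sigma> x) = x" if "\<sigma> \<in> H" for \<sigma> x
    using that H(1) by (auto simp: galois_def bij_is_inj bij_is_surj surj_f_inv_f)
  have agree: "\<epsilon> \<sigma> = \<epsilon> \<tau>" "\<And>c. c \<in> M \<Longrightarrow> \<sigma> c = \<tau> c"
    if st: "\<sigma> \<in> H" "\<tau> \<in> H" "\<And>x. x \<in> \<Phi> \<Longrightarrow> \<sigma> x = \<tau> x" for \<sigma> \<tau>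
  proof -
    let ?\<rho> = "inv_into UNIV \<tau> \<circ> \<sigma>"
    have \<rho>: "?\<rho> \<in> H" using H(3,4) st by blast
    have fx: "\<forall>x\<in>\<Phi>. ?\<rho> x = x" using st inv by simp
    have eq: "\<tau> \<circ> ?\<rho> = \<sigma>" using inv[OF st(2)] by (simp add: fun_eq_iff)
    show "\<epsilon> \<sigma> = \<epsilon> \<tau>" using hom[OF st(2) \<rho>] cont[OF \<rho> fx] unfolding eq by simp
    fix c assume "c \<in> M"
    then have "?\<rho> c = c" using \<rho> fx unfolding M_def by blast
    then show "\<sigma> c = \<tau> c" using eq by (metis comp_apply)
  qed
  have "finite (\<Pi>\<^sub>E x\<in>\<Phi>. (\<lambda>\<sigma>. \<sigma> x) ` galois j)"
    by (rule finite_PiE[OF fin]) (rule galois_finite_orbit[OF sc])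
  moreover have "R \<subseteq> (\<Pi>\<^sub>E x\<in>\<Phi>. (\<lambda>\<sigma>. \<sigma> x) ` galois j)"
    using H(1) by (auto simp: R_def)
  ultimately have finR: "finite R" by (rule finite_subset[rotated])
  define l where "l \<rho> = (SOME \<sigma>. \<sigma> \<in> H \<and> restrict \<sigma> \<Phi> = \<rho>)" for \<rho>
  have l: "l \<rho> \<in> H" "restrict (l \<rho>) \<Phi> = \<rho>" if "\<rho> \<in> R" for \<rho>
  proof -
    have "\<exists>\<sigma>. \<sigma> \<in> H \<and> restrict \<sigma> \<Phi> = \<rho>" using that by (auto simp: R_def)
    from someI_ex[OF this] show "l \<rho> \<in> H" "restrict (l \<rho>) \<Phi> = \<rho>" by (auto simp: l_def)
  qed
  have lx: "l \<rho> x = \<rho> x" if "\<rho> \<in> R" "x \<in> \<Phi>" for \<rho> x using l(2)[OF that(1)] that(2) by (metis restrict_apply')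
  have PhiM: "\<Phi> \<subseteq> M" by (auto simp: M_def)
  \<comment> \<open>If all resolvents vanished, Dedekind independence would make every sign
    zero.\<close>
  have "\<exists>c\<in>M. (\<Sum>\<rho>\<in>R. \<epsilon> (l \<rho>) * l \<rho> c) \<noteq> 0"
  proof (rule ccontr)
    assume "\<not> ?thesis"
    then have "\<forall>\<rho>\<in>R. \<epsilon> (l \<rho>) = 0"
    proof (intro dedekind_independence[OF finR, of M l])
      show "1 \<in> M" using emb field_embedding_simps(2) by (auto simp: M_def)
      show "x * y \<in> M" if "x \<in> M" "y \<in> M" for x y
        using that emb field_embedding_simps(4) unfolding M_def by fastforce
      fix \<rho> assume \<rho>: "\<rho> \<in> R"
      show "l \<rho> 1 = 1" "l \<rho> (x * y) = l \<rho> x * l \<rho> y" for x y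
        using field_embedding_simps[OF emb[OF l(1)[OF \<rho>]]] by auto
      fix \<rho>' assume \<rho>': "\<rho>' \<in> R" "\<rho> \<noteq> \<rho>'"
      have "\<exists>x\<in>\<Phi>. \<rho> x \<noteq> \<rho>' x"
      proof (rule ccontr)
        assume "\<not> ?thesis"
        then have "\<rho> = \<rho>'" using \<rho> \<rho>'(1) by (auto simp: R_def fun_eq_iff)
        then show False using \<rho>'(2) by simp
      qed
      then show "\<exists>x\<in>M. l \<rho> x \<noteq> l \<rho>' x" using lx \<rho> \<rho>'(1) PhiM by (metis subsetD)
    qed auto
    moreover have "restrict id \<Phi> \<in> R" using H(2) by (auto simp: R_def)
    ultimately have "\<epsilon> (l (restrict id \<Phi>)) = 0" by blast
    then show False using sign[of "l (restrict id \<Phi>)"] by auto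
  qed
  then obtain c where c: "c \<in> M" "(\<Sum>\<rho>\<in>R. \<epsilon> (l \<rho>) * l \<rho> c) \<noteq> 0" by blast
  define y where "y = (\<Sum>\<rho>\<in>R. \<epsilon> (l \<rho>) * l \<rho> c)"
  have "\<sigma> y = \<epsilon> \<sigma> * y" if s: "\<sigma> \<in> H" for \<sigma>
  proof -
    note S = field_embedding_simps[OF emb[OF s]]
    \<comment> \<open>\<sigma> permutes the cosets. Passing from
      \<open>\<sigma> \<circ> l \<rho>\<close> to the chosen representative of its coset changes
      neither the sign nor the value at c.\<close>
    define act where "act \<rho> = restrict (\<sigma> \<circ> \<rho>) \<Phi>" for \<rho>
    have act: "act \<rho> \<in> R" if "\<rho> \<in> R" for \<rho>
    proof -
      have "act \<rho> = restrict (\<sigma> \<circ> l \<rho>) \<Phi>" using lx[OF that] by (auto simp: act_def fun_eq_iff)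
      then show ?thesis using H(3)[OF s l(1)[OF that]] by (auto simp: R_def)
    qed
    have "inj_on act R"
    proof (rule inj_onI)
      fix \<rho> \<rho>' assume r: "\<rho> \<in> R" "\<rho>' \<in> R" "act \<rho> = act \<rho>'"
      have "\<rho> x = \<rho>' x" for x
      proof (cases "x \<in> \<Phi>")
        case True
        then have "\<sigma> (\<rho> x) = \<sigma> (\<rho>' x)" using fun_cong[OF r(3), of x] by (simp add: act_def)
        then show ?thesis using S(10) by blast
      qed (use r in \<open>auto simp: R_def\<close>)
      then show "\<rho> = \<rho>'" by blast
    qed
    then have bij: "bij_betw act R R"
      using finR act by (simp add: bij_betw_def endo_inj_surj image_subsetI)
    have step: "\<sigma> (\<epsilon> (l \<rho>) * l \<rho> c) = \<epsilon> \<sigma> * (\<epsilon> (l (act \<rho>)) * l (act \<rho>) c)" if r: "\<rho> \<in> R" for \<rho>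
    proof -
      have lr: "l \<rho> \<in> H" "l (act \<rho>) \<in> H" using l(1) r act by blast+
      have comp: "\<sigma> \<circ> l \<rho> \<in> H" using H(3) s lr by blast
      have ag: "(\<sigma> \<circ> l \<rho>) x = l (act \<rho>) x" if "x \<in> \<Phi>" for x
        using lx[OF act[OF r] that] lx[OF r that] that by (simp add: act_def)
      have "\<epsilon> (l (act \<rho>)) = \<epsilon> \<sigma> * \<epsilon> (l \<rho>)"
        using agree(1)[OF comp lr(2) ag] hom[OF s lr(1)] by metis
      moreover have "\<sigma> (l \<rho> c) = l (act \<rho>) c" using agree(2)[OF comp lr(2) ag c(1)] by simp
      moreover have "\<sigma> (\<epsilon> (l \<rho>)) = \<epsilon> (l \<rho>)" using sign[of "l \<rho>"] by (auto simp: S)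
      moreover have "\<epsilon> \<sigma> * \<epsilon> \<sigma> = 1" using sign[of \<sigma>] by auto
      ultimately show ?thesis unfolding S(4) by (simp add: mult.assoc[symmetric])
    qed
    have "\<sigma> (sum f A) = (\<Sum>i\<in>A. \<sigma> (f i))" for f :: "('s \<Rightarrow> 's) \<Rightarrow> 's" and A
      by (induction A rule: infinite_finite_induct) (auto simp: S)
    then have "\<sigma> y = (\<Sum>\<rho>\<in>R. \<epsilon> \<sigma> * (\<epsilon> (l (act \<rho>)) * l (act \<rho>) c))"
      unfolding y_def using step by simp
    also have "\<dots> = (\<Sum>\<rho>\<in>R. \<epsilon> \<sigma> * (\<epsilon> (l \<rho>) * l \<rho> c))"
      by (rule sum.reindex_bij_betw[OF bij])
    finally show ?thesis by (simp add: y_def sum_distrib_left)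
  qed
  then show ?thesis using c(2) y_def by blast
qed


text \<open>With a fourth root \<open>y\<close> of \<open>a\<close> and \<open>i\<^sup>2 = -1\<close>, the image of the Galois group acting on \<open>y\<close> and \<open>i\<close>
  embeds into the dihedral group of order 8, for which the witnessing cochain was found by solving
  the coboundary equation.\<close>

lemma dihedral_cochain:
  fixes y i :: "'s::field" and f :: "('s \<Rightarrow> 's) \<Rightarrow> bit"
  assumes ii: "i * i = - 1" "\<And>z. i * (i * z) = - z"
    and iy: "i * y \<noteq> y" "i * y \<noteq> - y" "- (i * y) \<noteq> y" "y \<noteq> i * y" "y \<noteq> - (i * y)" "- y \<noteq> i * y"
    and niy: "i * y \<noteq> - (i * y)" "- (i * y) \<noteq> i * y" "y \<noteq> - y" "- y \<noteq> y" "i \<noteq> - i" "- i \<noteq> i"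
    and S: "\<sigma> (i * y) = \<sigma> i * \<sigma> y" "\<sigma> (- y) = - \<sigma> y" "\<sigma> (- i) = - \<sigma> i" "\<sigma> (- (i * y)) = - (\<sigma> i * \<sigma> y)"
    and f: "\<And>\<sigma>. f \<sigma> = (if \<sigma> y = i * y \<or> \<sigma> y = - y \<and> \<sigma> i = i \<or> \<sigma> y = y \<and> \<sigma> i = - i then 1 else 0)"
    and s: "\<sigma> y = y \<or> \<sigma> y = i * y \<or> \<sigma> y = - y \<or> \<sigma> y = - (i * y)" "\<sigma> i = i \<or> \<sigma> i = - i"
    and t: "\<tau> y = y \<or> \<tau> y = i * y \<or> \<tau> y = - y \<or> \<tau> y = - (i * y)" "\<tau> i = i \<or> \<tau> i = - i"
  shows "(if \<sigma> y = y \<or> \<sigma> y = - y then 0 else 1) * (if (\<tau> y = y \<or> \<tau> y = - y) = (\<tau> i = i) then 0 else 1) =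
    f \<tau> - f (\<sigma> \<circ> \<tau>) + f \<sigma>"
proof -
  have diff: "a - b = a + b" for a b :: bit by simp
  have c: "(\<sigma> \<circ> \<tau>) y = \<sigma> (\<tau> y)" "(\<sigma> \<circ> \<tau>) i = \<sigma> (\<tau> i)" by simp_all
  note ss = ii iy niy minus_minus mult_minus_left mult_minus_right mult_zero_left mult_zero_right mult_1_left mult_1_right
    add_0 add_0_right bit_add_self simp_thms if_True if_False c S
  note fv = f[of \<sigma>] f[of \<tau>] f[of "\<sigma> \<circ> \<tau>"]
  show ?thesis unfolding fv c
    by (insert s t, elim disjE) (simp_all only: ss diff neg_equal_iff_equal)
qed

section \<open>Characters of square roots and the cocycle of a symbol\<close>

definition symbol :: "('e::field \<Rightarrow> 's::field) \<Rightarrow> 'e \<Rightarrow> 'e \<Rightarrow> ('s \<Rightarrow> 's) \<times> ('s \<Rightarrow> 's) \<Rightarrow> bit" where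
  "symbol j a b = extend2 j (\<lambda>\<sigma> \<tau>. kummer j a \<sigma> * kummer j b \<tau>)"

context
  fixes j :: "'e::field \<Rightarrow> 's::field"
  assumes sc: "separable_closure j" and two: "(2::'e) \<noteq> 0"
begin

lemma two_nonzero: "(2::'s) \<noteq> 0"
proof -
  have "j (1 + 1) = 1 + 1" by (simp only: j_simps[OF sc])
  moreover have "j (1 + 1) \<noteq> 0" using two j_simps(11)[OF sc, of "1 + 1"] by simp
  ultimately show ?thesis by simp
qed

lemma neq_minus: "(y::'s) \<noteq> 0 \<Longrightarrow> - y \<noteq> y" "(y::'s) \<noteq> 0 \<Longrightarrow> y \<noteq> - y"
  using two_nonzero by (metis add_eq_0_iff2 mult_2 mult_eq_0_iff neg_equal_iff_equal minus_minus)+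

lemma sqrt_exists:
  assumes "(c::'s) \<noteq> 0"
  obtains y where "y\<^sup>2 = c" "y \<noteq> 0"
proof -
  let ?p = "[:- c, 0, 1:]"
  have "separable_poly ?p"
    unfolding separable_poly_def
  proof (rule coprimeI)
    fix d assume d: "d dvd ?p" "d dvd pderiv ?p"
    \<comment> \<open>For p = X^2 - c, the combination X p' - 2p is the constant 2c, which is
      nonzero outside characteristic two.\<close>
    have "d dvd [:0, 1:] * pderiv ?p - smult 2 ?p"
      using d by (intro dvd_diff dvd_smult dvd_mult) auto
    also have "[:0, 1:] * pderiv ?p - smult 2 ?p = [:2 * c:]" by (simp add: pderiv_pCons)
    finally show "is_unit d" using assms two_nonzero
      by (meson dvd_trans is_unit_pCons_iff mult_eq_0_iff)
  qed
  moreover have "degree ?p > 0" by simp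
  ultimately obtain y where "poly ?p y = 0" using sc unfolding separable_closure_def by blast
  then have "y\<^sup>2 = c" by (simp add: power2_eq_square algebra_simps)
  then show ?thesis using that assms by auto
qed

lemma sqrt_base:
  assumes "x \<noteq> 0"
  obtains y where "y\<^sup>2 = j x" "y \<noteq> 0"
  using sqrt_exists[of "j x"] assms j_simps(11)[OF sc] by blast

lemma galois_sqrt:
  assumes "\<sigma> \<in> galois j" "y\<^sup>2 = j x"
  shows "\<sigma> y = y \<or> \<sigma> y = - y"
proof -
  have "(\<sigma> y)\<^sup>2 = y\<^sup>2"
    using assms galois_simps(9)[OF assms(1), of y 2] galois_fix[OF assms(1)] by simp
  then show ?thesis by (simp add: power2_eq_iff)
qed

lemma kummer_eq:
  assumes "\<sigma> \<in> galois j" "y\<^sup>2 = j x"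
  shows "kummer j x \<sigma> = (if \<sigma> y = y then 0 else 1)"
proof -
  have "(\<forall>z. z\<^sup>2 = j x \<longrightarrow> \<sigma> z = z) \<longleftrightarrow> \<sigma> y = y"
  proof
    assume y: "\<sigma> y = y"
    show "\<forall>z. z\<^sup>2 = j x \<longrightarrow> \<sigma> z = z"
    proof (intro allI impI)
      fix z assume "z\<^sup>2 = j x"
      then have "z = y \<or> z = - y" using assms(2) by (metis power2_eq_iff)
      then show "\<sigma> z = z" using y galois_simps(5)[OF assms(1), of y] by auto
    qed
  qed (use assms(2) in blast)
  then show ?thesis by (simp add: kummer_def)
qed

lemma kummer_sign:
  assumes "\<sigma> \<in> galois j" "y\<^sup>2 = j x"
  shows "\<sigma> y = (if kummer j x \<sigma> = 0 then y else - y)"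
  using kummer_eq[OF assms] galois_sqrt[OF assms] by auto

lemma kummer_cochain:
  assumes "x \<noteq> 0"
  shows "kummer j x \<in> cochains1 j"
  unfolding cochains1_iff
proof
  fix \<sigma> assume s: "\<sigma> \<in> galois j"
  obtain y where y: "y\<^sup>2 = j x" "y \<noteq> 0" using sqrt_base[OF assms] .
  have "kummer j x \<tau> = kummer j x \<sigma>" if "\<tau> \<in> galois j" "\<forall>z\<in>{y}. \<tau> z = \<sigma> z" for \<tau>
    using that kummer_eq[OF that(1) y(1)] kummer_eq[OF s y(1)] by simp
  then show "\<exists>\<Phi>. finite \<Phi> \<and> (\<forall>\<tau>\<in>galois j. (\<forall>x\<in>\<Phi>. \<tau> x = \<sigma> x) \<longrightarrow> kummer j x \<tau> = kummer j x \<sigma>)"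
    by (intro exI[of _ "{y}"] conjI ballI impI) blast+
qed

lemma kummer_comp:
  assumes "x \<noteq> 0" "\<sigma> \<in> galois j" "\<tau> \<in> galois j"
  shows "kummer j x (\<sigma> \<circ> \<tau>) = kummer j x \<sigma> + kummer j x \<tau>"
proof -
  obtain y where y: "y\<^sup>2 = j x" "y \<noteq> 0" using sqrt_base[OF assms(1)] .
  have "\<sigma> (- y) = - \<sigma> y" by (rule galois_simps(5)[OF assms(2)])
  then show ?thesis
    using galois_sqrt[OF assms(2) y(1)] galois_sqrt[OF assms(3) y(1)] neq_minus[OF y(2)]
    unfolding kummer_eq[OF assms(2) y(1)] kummer_eq[OF assms(3) y(1)] kummer_eq[OF galois_comp[OF assms(2,3)] y(1)]
    by auto
qed

lemma kummer_mult:
  assumes "x \<noteq> 0" "x' \<noteq> 0" "\<sigma> \<in> galois j"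
  shows "kummer j (x * x') \<sigma> = kummer j x \<sigma> + kummer j x' \<sigma>"
proof -
  obtain y where y: "y\<^sup>2 = j x" "y \<noteq> 0" using sqrt_base[OF assms(1)] .
  obtain y' where y': "y'\<^sup>2 = j x'" "y' \<noteq> 0" using sqrt_base[OF assms(2)] .
  have yy: "(y * y')\<^sup>2 = j (x * x')" using y y' by (simp add: power_mult_distrib j_simps[OF sc])
  have "\<sigma> (y * y') = \<sigma> y * \<sigma> y'" by (rule galois_simps(4)[OF assms(3)])
  then show ?thesis
    using galois_sqrt[OF assms(3) y(1)] galois_sqrt[OF assms(3) y'(1)] neq_minus[OF y(2)]
      neq_minus[OF y'(2)] neq_minus[of "y * y'"] y(2) y'(2)
    unfolding kummer_eq[OF assms(3) y(1)] kummer_eq[OF assms(3) y'(1)] kummer_eq[OF assms(3) yy]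
    by auto
qed

lemma kummer_square:
  assumes "\<sigma> \<in> galois j"
  shows "kummer j (x\<^sup>2) \<sigma> = 0"
  using kummer_eq[OF assms, of "j x" "x\<^sup>2"] galois_fix[OF assms] by (simp add: j_simps[OF sc])

lemma symbol_cocycle:
  assumes "a \<noteq> 0" "b \<noteq> 0"
  shows "symbol j a b \<in> cocycles2 j"
  unfolding symbol_def
proof (rule extend2_in_cocycles2)
  show "continuous_map (prod_topology (krull j) (krull j)) (discrete_topology UNIV)
      (\<lambda>p. kummer j a (fst p) * kummer j b (snd p))"
    by (rule continuous_map_discrete_combine[where h = "(*)"])
       (intro continuous_map_cochain1 kummer_cochain assms)+
next
  fix \<sigma> \<tau> \<upsilon> assume "\<sigma> \<in> galois j" "\<tau> \<in> galois j" "\<upsilon> \<in> galois j"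
  moreover have "p * q - (r + p) * q + r * (p' + q) - r * p' = 0" for p q r p' :: bit
    by (cases p; cases q; cases r; cases p') simp_all
  ultimately show "kummer j a \<tau> * kummer j b \<upsilon> - kummer j a (\<sigma> \<circ> \<tau>) * kummer j b \<upsilon> +
      kummer j a \<sigma> * kummer j b (\<tau> \<circ> \<upsilon>) - kummer j a \<sigma> * kummer j b \<tau> = 0"
    by (simp only: kummer_comp[OF assms(1)] kummer_comp[OF assms(2)])
qed

lemma symbol_trivial_1: "symbol j a 1 \<in> coboundaries2 j"
  unfolding symbol_def extend2_coboundary_iff
proof (intro bexI ballI)
  fix \<sigma> \<tau> assume "\<sigma> \<in> galois j" "\<tau> \<in> galois j"
  then show "kummer j a \<sigma> * kummer j 1 \<tau> = 0 - 0 + 0" using kummer_square[of \<tau> 1] by simp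
qed (use finite.emptyI in \<open>auto simp: cochains1_iff\<close>)

text \<open>Classically, -a is the norm of \<surd>a. Here the vanishing comes from an explicit
  cochain that depends on the action on a fourth root y of a and on i. All checks concern the values
  at y and i only, so they also cover the case that a or -1 is a square.\<close>

lemma symbol_trivial_neg:
  assumes "a \<noteq> 0"
  shows "symbol j a (- a) \<in> coboundaries2 j"
proof -
  obtain r where r: "r\<^sup>2 = j a" "r \<noteq> 0" using sqrt_base[OF assms] .
  obtain y where y: "y\<^sup>2 = r" "y \<noteq> 0" using sqrt_exists[OF r(2)] .
  obtain i :: 's where i: "i\<^sup>2 = - 1" "i \<noteq> 0" using sqrt_exists[of "- 1"] by auto
  have ii: "i * i = - 1" "i * (i * z) = - z" for z using i(1) by (simp_all add: power2_eq_square mult.assoc[symmetric])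
  have i1: "i \<noteq> 1" "i \<noteq> - 1" "- i \<noteq> 1" "1 \<noteq> i" "- 1 \<noteq> i"
  proof -
    have "i \<noteq> 1" "i \<noteq> - 1" using ii(1) neq_minus(2)[of 1] by auto
    then show "i \<noteq> 1" "i \<noteq> - 1" "- i \<noteq> 1" "1 \<noteq> i" "- 1 \<noteq> i" by (metis minus_minus)+
  qed
  have iy: "i * y \<noteq> y" "i * y \<noteq> - y" "- (i * y) \<noteq> y" "y \<noteq> i * y" "y \<noteq> - (i * y)" "- y \<noteq> i * y"
  proof -
    have "i * y \<noteq> y" "i * y \<noteq> - y" using i1 y(2) by (simp, metis mult_cancel_right mult_minus1)
    then show "i * y \<noteq> y" "i * y \<noteq> - y" "- (i * y) \<noteq> y" "y \<noteq> i * y" "y \<noteq> - (i * y)" "- y \<noteq> i * y"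
      by (metis minus_minus)+
  qed
  have niy: "i * y \<noteq> - (i * y)" "- (i * y) \<noteq> i * y" "y \<noteq> - y" "- y \<noteq> y" "i \<noteq> - i" "- i \<noteq> i"
    using neq_minus[of "i * y"] neq_minus[of y] neq_minus[of i] i(2) y(2) by auto
  have mr: "(i * r)\<^sup>2 = j (- a)" using r i by (simp add: power_mult_distrib j_simps[OF sc])
  have ya: "\<sigma> y = y \<or> \<sigma> y = i * y \<or> \<sigma> y = - y \<or> \<sigma> y = - (i * y)" if s: "\<sigma> \<in> galois j" for \<sigma>
  proof -
    have "(\<sigma> y)\<^sup>2 = \<sigma> r" using galois_simps(9)[OF s, of y 2] y(1) by simp
    then have "(\<sigma> y)\<^sup>2 = y\<^sup>2 \<or> (\<sigma> y)\<^sup>2 = (i * y)\<^sup>2"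
      using galois_sqrt[OF s r(1)] y(1) i(1) by (auto simp: power_mult_distrib)
    then show ?thesis by (auto simp: power2_eq_iff)
  qed
  have ia: "\<sigma> i = i \<or> \<sigma> i = - i" if s: "\<sigma> \<in> galois j" for \<sigma>
    using galois_sqrt[OF s, of i "- 1"] i(1) by (simp add: j_simps[OF sc])
  define f :: "('s \<Rightarrow> 's) \<Rightarrow> bit" where
    "f \<sigma> = (if \<sigma> y = i * y \<or> \<sigma> y = - y \<and> \<sigma> i = i \<or> \<sigma> y = y \<and> \<sigma> i = - i then 1 else 0)" for \<sigma>
  have "f \<in> cochains1 j"
    unfolding cochains1_iff
  proof
    fix \<sigma> assume "\<sigma> \<in> galois j"
    have "f \<tau> = f \<sigma>" if "\<forall>x\<in>{y, i}. \<tau> x = \<sigma> x" for \<tau> using that by (simp add: f_def)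
    then show "\<exists>\<Phi>. finite \<Phi> \<and> (\<forall>\<tau>\<in>galois j. (\<forall>x\<in>\<Phi>. \<tau> x = \<sigma> x) \<longrightarrow> f \<tau> = f \<sigma>)"
      by (intro exI[of _ "{y, i}"] conjI ballI impI) blast+
  qed
  moreover have "kummer j a \<sigma> * kummer j (- a) \<tau> = f \<tau> - f (\<sigma> \<circ> \<tau>) + f \<sigma>"
    if st: "\<sigma> \<in> galois j" "\<tau> \<in> galois j" for \<sigma> \<tau>
  proof -
    have Y: "y * y \<noteq> - (y * y)" "- (y * y) \<noteq> y * y"
      "i * (y * y) \<noteq> - (i * (y * y))" "- (i * (y * y)) \<noteq> i * (y * y)"
      using neq_minus[of "y * y"] neq_minus[of "i * (y * y)"] i(2) y(2) by auto
    have iyiy: "(i * y) * (i * y) = - (y * y)"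
    proof -
      have "(i * y) * (i * y) = (i * i) * (y * y)" by (simp only: mult_ac)
      then show ?thesis by (simp add: ii(1))
    qed
    have ryy: "r = y * y" using y(1) by (simp add: power2_eq_square)
    have sr: "\<sigma> r = \<sigma> y * \<sigma> y" "\<tau> (i * r) = \<tau> i * (\<tau> y * \<tau> y)"
      unfolding ryy by (simp_all only: galois_simps(4)[OF st(1)] galois_simps(4)[OF st(2)])
    \<comment> \<open>As r = y^2, it is fixed exactly when y is sent to y or -y.\<close>
    have ka: "kummer j a \<sigma> = (if \<sigma> y = y \<or> \<sigma> y = - y then 0 else 1)"
      unfolding kummer_eq[OF st(1) r(1)] sr using ya[OF st(1)]
      by (elim disjE) (simp_all add: iyiy iy niy Y ryy i1 y(2))
    \<comment> \<open>ir is a square root of -a. It is fixed when \<tau> changes the signs of both r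
      and i or of neither.\<close>
    have kb: "kummer j (- a) \<tau> = (if (\<tau> y = y \<or> \<tau> y = - y) = (\<tau> i = i) then 0 else 1)"
      unfolding kummer_eq[OF st(2) mr] sr using ya[OF st(2)] ia[OF st(2)]
      by (elim disjE) (simp_all add: iyiy iy niy Y ryy i1 y(2))
    have S: "\<sigma> (i * y) = \<sigma> i * \<sigma> y" "\<sigma> (- y) = - \<sigma> y" "\<sigma> (- i) = - \<sigma> i" "\<sigma> (- (i * y)) = - (\<sigma> i * \<sigma> y)"
      by (simp_all add: galois_simps[OF st(1)])
    show ?thesis
      unfolding ka kb
      by (rule dihedral_cochain[OF ii iy niy S f_def ya[OF st(1)] ia[OF st(1)] ya[OF st(2)] ia[OF st(2)]])
  qed
  ultimately show ?thesis unfolding symbol_def extend2_coboundary_iff by blast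
qed


theorem symbol_trivial_imp_norm:
  assumes "a \<noteq> 0" "b \<noteq> 0"
    and triv: "symbol j a b \<in> coboundaries2 j"
  shows "\<exists>x y. b = x\<^sup>2 - a * y\<^sup>2"
proof -
  obtain r where r: "r\<^sup>2 = j a" "r \<noteq> 0" using sqrt_base[OF assms(1)] .
  obtain rb where rb: "rb\<^sup>2 = j b" "rb \<noteq> 0" using sqrt_base[OF assms(2)] .
  show ?thesis
  proof (cases "r \<in> range j")
    case True
    then obtain c where c: "r = j c" by blast
    have "j (c\<^sup>2) = j a" using r c by (simp add: j_simps[OF sc])
    then have a: "a = c\<^sup>2" by (simp only: j_simps(10)[OF sc])
    then have "c \<noteq> 0" using assms(1) by auto
    \<comment> \<open>If a = c^2, the form x^2 - a y^2 is hyperbolic and represents every b.\<close>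
    have "b = ((b + 1) / 2)\<^sup>2 - ((b - 1) / 2)\<^sup>2"
    proof -
      have "(b + 1) / 2 - (b - 1) / 2 = 1" "(b + 1) / 2 + (b - 1) / 2 = b"
        using two by (simp_all add: diff_divide_distrib[symmetric] add_divide_distrib[symmetric])
      then have "((b + 1) / 2)\<^sup>2 - ((b - 1) / 2)\<^sup>2 = b * 1"
        by (metis power2_eq_square square_diff_square_factored)
      then show ?thesis by simp
    qed
    also have "\<dots> = ((b + 1) / 2)\<^sup>2 - a * ((b - 1) / (2 * c))\<^sup>2"
      using two \<open>c \<noteq> 0\<close> by (simp add: a power_divide power_mult_distrib)
    finally show ?thesis by blast
  next
    case False
    then obtain \<tau> where \<tau>: "\<tau> \<in> galois j" "\<tau> r \<noteq> r" using galois_fixed_field[OF sc] by blast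
    then have tr: "\<tau> r = - r" using galois_sqrt[OF \<tau>(1) r(1)] by blast
    obtain g where g: "g \<in> cochains1 j"
      "\<forall>\<sigma>\<in>galois j. \<forall>\<tau>\<in>galois j. kummer j a \<sigma> * kummer j b \<tau> = g \<tau> - g (\<sigma> \<circ> \<tau>) + g \<sigma>"
      using triv unfolding symbol_def extend2_coboundary_iff by blast
    \<comment> \<open>H is the Galois group of E(\<surd>a); \<epsilon> and \<eta> are the cochain g
      and the character of b, with bits turned into signs.\<close>
    define H where "H = {\<sigma> \<in> galois j. \<sigma> r = r}"
    define \<epsilon> :: "('s \<Rightarrow> 's) \<Rightarrow> 's" where "\<epsilon> \<sigma> = (if g \<sigma> = 0 then 1 else - 1)" for \<sigma>
    define \<eta> :: "('s \<Rightarrow> 's) \<Rightarrow> 's" where "\<eta> \<sigma> = (if kummer j b \<sigma> = 0 then 1 else - 1)" for \<sigma>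
    have S: "\<sigma> (x * z) = \<sigma> x * \<sigma> z" "\<sigma> (- x) = - \<sigma> x" "\<sigma> (x + z) = \<sigma> x + \<sigma> z" "\<sigma> (x - z) = \<sigma> x - \<sigma> z"
      "\<sigma> (x / z) = \<sigma> x / \<sigma> z" "\<sigma> 1 = 1" if "\<sigma> \<in> galois j" for \<sigma> x z
      using galois_simps[OF that] by auto
    have S2: "\<sigma> 2 = 2" if "\<sigma> \<in> galois j" for \<sigma>
      using S(3)[OF that, of 1 1] S(6)[OF that] by simp
    have eta: "\<sigma> rb = \<eta> \<sigma> * rb" if "\<sigma> \<in> galois j" for \<sigma>
      using kummer_sign[OF that rb(1)] by (simp add: \<eta>_def)
    have eta_comp: "\<eta> (\<sigma> \<circ> \<sigma>') = \<eta> \<sigma> * \<eta> \<sigma>'" if "\<sigma> \<in> galois j" "\<sigma>' \<in> galois j" for \<sigma> \<sigma>'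
      unfolding \<eta>_def kummer_comp[OF assms(2) that] by auto
    have sq: "\<epsilon> \<sigma> * \<epsilon> \<sigma> = 1" "\<eta> \<sigma> * \<eta> \<sigma> = 1" "\<eta> \<sigma> \<noteq> 0" for \<sigma> by (auto simp: \<epsilon>_def \<eta>_def)
    have eps_fix: "\<sigma> (\<epsilon> \<sigma>') = \<epsilon> \<sigma>'" "\<sigma> (\<eta> \<sigma>') = \<eta> \<sigma>'" if "\<sigma> \<in> galois j" for \<sigma> \<sigma>'
      using S[OF that] by (auto simp: \<epsilon>_def \<eta>_def)
    \<comment> \<open>The coboundary equation in signs. The correction \<eta> occurs only when
      \<sigma> moves r, so \<epsilon> is a character on H.\<close>
    have eps_comp: "\<epsilon> (\<sigma> \<circ> \<sigma>') = \<epsilon> \<sigma> * \<epsilon> \<sigma>' * (if \<sigma> r = r then 1 else \<eta> \<sigma>')"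
      if st: "\<sigma> \<in> galois j" "\<sigma>' \<in> galois j" for \<sigma> \<sigma>'
    proof -
      have gg: "kummer j a \<sigma> * kummer j b \<sigma>' = g \<sigma>' - g (\<sigma> \<circ> \<sigma>') + g \<sigma>" using g(2) st by blast
      have "g (\<sigma> \<circ> \<sigma>') = g \<sigma> + g \<sigma>' + kummer j a \<sigma> * kummer j b \<sigma>'"
        unfolding gg by (cases "g \<sigma>"; cases "g \<sigma>'"; cases "g (\<sigma> \<circ> \<sigma>')") simp_all
      then show ?thesis unfolding \<epsilon>_def \<eta>_def kummer_eq[OF st(1) r(1)] by auto
    qed
    have inv: "inv_into UNIV \<sigma> (\<sigma> x) = x" "\<sigma> (inv_into UNIV \<sigma> x) = x" if "\<sigma> \<in> galois j" for \<sigma> x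
      using that by (auto simp: galois_def bij_is_inj bij_is_surj surj_f_inv_f)
    have HG: "\<sigma> \<in> galois j" "\<sigma> r = r" if "\<sigma> \<in> H" for \<sigma> using that by (auto simp: H_def)
    have HI: "\<sigma> \<in> H" if "\<sigma> \<in> galois j" "\<sigma> r = r" for \<sigma> using that by (auto simp: H_def)
    have hom: "\<epsilon> (\<sigma> \<circ> \<sigma>') = \<epsilon> \<sigma> * \<epsilon> \<sigma>'" if "\<sigma> \<in> H" "\<sigma>' \<in> galois j" for \<sigma> \<sigma>'
      using eps_comp[OF HG(1)[OF that(1)] that(2)] HG(2)[OF that(1)] by simp
    have "id \<in> H" using galois_id by (simp add: H_def)
    moreover have "\<epsilon> (id \<circ> id) = \<epsilon> id * \<epsilon> id" by (rule hom) (use \<open>id \<in> H\<close> galois_id in auto)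
    ultimately have eps_id: "\<epsilon> id = 1" using sq(1)[of id] by simp
    obtain \<Phi> where \<Phi>: "finite \<Phi>" "\<forall>\<sigma>\<in>galois j. (\<forall>x\<in>\<Phi>. \<sigma> x = id x) \<longrightarrow> g \<sigma> = g id"
      using g(1) galois_id(1) unfolding cochains1_iff by blast
    have "\<exists>y. y \<noteq> 0 \<and> (\<forall>\<sigma>\<in>H. \<sigma> y = \<epsilon> \<sigma> * y)"
    proof (rule galois_character_eigenvector[OF sc _ _ _ _ _ _ \<Phi>(1)])
      show "H \<subseteq> galois j" "id \<in> H" using HG \<open>id \<in> H\<close> by auto
      show "\<sigma> \<circ> \<sigma>' \<in> H" if "\<sigma> \<in> H" "\<sigma>' \<in> H" for \<sigma> \<sigma>'
        using HG(1)[OF that(1)] HG(1)[OF that(2)] HG(2)[OF that(1)] HG(2)[OF that(2)]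
        by (intro HI galois_comp) auto
      show "inv_into UNIV \<sigma> \<in> H" if "\<sigma> \<in> H" for \<sigma>
        using HG[OF that] inv(1)[OF HG(1)[OF that], of r] by (intro HI galois_inv) auto
      show "\<epsilon> \<sigma> \<in> {1, - 1}" for \<sigma> by (simp add: \<epsilon>_def)
      show "\<epsilon> (\<sigma> \<circ> \<sigma>') = \<epsilon> \<sigma> * \<epsilon> \<sigma>'" if "\<sigma> \<in> H" "\<sigma>' \<in> H" for \<sigma> \<sigma>'
        using hom HG that by blast
      fix \<sigma> assume s: "\<sigma> \<in> H" "\<forall>x\<in>\<Phi>. \<sigma> x = x"
      have "g \<sigma> = g id" using \<Phi>(2) HG(1)[OF s(1)] s(2) unfolding id_apply by blast
      then show "\<epsilon> \<sigma> = 1" using eps_id unfolding \<epsilon>_def by (simp only:)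
    qed
    then obtain y where y: "y \<noteq> 0" "\<And>\<sigma>. \<sigma> \<in> H \<Longrightarrow> \<sigma> y = \<epsilon> \<sigma> * y" by blast
    \<comment> \<open>H has index two and \<tau> represents the other coset, so invariance under H
      and \<tau> is invariance under the whole group.\<close>
    have fixed: "x \<in> range j" if x: "\<And>\<sigma>. \<sigma> \<in> H \<Longrightarrow> \<sigma> x = x" "\<tau> x = x" for x
    proof (rule galois_fixed_field[OF sc])
      fix \<sigma> assume s: "\<sigma> \<in> galois j"
      show "\<sigma> x = x"
      proof (cases "\<sigma> r = r")
        case False
        then have sr: "\<sigma> r = - r" using galois_sqrt[OF s r(1)] by blast
        let ?\<rho> = "\<sigma> \<circ> inv_into UNIV \<tau>"
        have "inv_into UNIV \<tau> r = - r"
          using inv(1)[OF \<tau>(1), of "- r"] S(2)[OF \<tau>(1), of r] tr by simp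
        then have "?\<rho> \<in> H" using s \<tau>(1) S(2)[OF s, of r] sr by (intro HI galois_comp galois_inv) auto
        then have "?\<rho> x = x" by (rule x)
        moreover have "inv_into UNIV \<tau> x = x" using inv(1)[OF \<tau>(1), of x] x(2) by simp
        ultimately show ?thesis by simp
      qed (use s HI x in blast)
    qed
    \<comment> \<open>Conjugation by \<tau> multiplies the character \<epsilon> of H by \<eta>,
      because the correction enters \<epsilon>(\<tau>\<rho>) but not
      \<epsilon>(\<sigma>\<tau>).\<close>
    have conj: "\<exists>\<rho>\<in>H. \<sigma> \<circ> \<tau> = \<tau> \<circ> \<rho> \<and> \<epsilon> \<rho> = \<epsilon> \<sigma> * \<eta> \<sigma>" if s: "\<sigma> \<in> H" for \<sigma>
    proof -
      define \<rho> where "\<rho> = inv_into UNIV \<tau> \<circ> (\<sigma> \<circ> \<tau>)"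
      have "\<rho> r = r" using tr HG(2)[OF s] S(2)[OF HG(1)[OF s], of r] inv(1)[OF \<tau>(1), of r] by (simp add: \<rho>_def)
      then have rH: "\<rho> \<in> H" using HG(1)[OF s] \<tau>(1) by (intro HI) (auto simp: \<rho>_def intro!: galois_comp galois_inv)
      have eq: "\<sigma> \<circ> \<tau> = \<tau> \<circ> \<rho>" using inv(2)[OF \<tau>(1)] by (simp add: fun_eq_iff \<rho>_def)
      have "\<eta> \<sigma> * \<eta> \<tau> = \<eta> \<tau> * \<eta> \<rho>"
        using eta_comp[OF HG(1)[OF s] \<tau>(1)] eta_comp[OF \<tau>(1) HG(1)[OF rH]] unfolding eq by (rule trans[OF sym])
      then have et: "\<eta> \<rho> = \<eta> \<sigma>" using sq(3)[of \<tau>] by (metis mult.commute mult_left_cancel)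
      have "\<epsilon> (\<tau> \<circ> \<rho>) = \<epsilon> \<tau> * \<epsilon> \<rho> * \<eta> \<sigma>"
        using eps_comp[OF \<tau>(1) HG(1)[OF rH]] \<tau>(2) unfolding et by simp
      then have e: "\<epsilon> \<sigma> * \<epsilon> \<tau> = \<epsilon> \<tau> * \<epsilon> \<rho> * \<eta> \<sigma>"
        unfolding hom[OF s \<tau>(1), symmetric] eq .
      have "(\<epsilon> \<tau> * \<epsilon> \<tau>) * (\<epsilon> \<sigma> * \<eta> \<sigma>) = (\<epsilon> \<sigma> * \<epsilon> \<tau>) * (\<epsilon> \<tau> * \<eta> \<sigma>)" by (simp only: mult_ac)
      also have "\<dots> = (\<epsilon> \<tau> * \<epsilon> \<tau>) * (\<eta> \<sigma> * \<eta> \<sigma>) * \<epsilon> \<rho>" unfolding e by (simp only: mult_ac)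
      finally have "\<epsilon> \<rho> = \<epsilon> \<sigma> * \<eta> \<sigma>" unfolding sq by simp
      then show ?thesis using rH eq by blast
    qed
    have sty: "\<sigma> (\<tau> y) = \<epsilon> \<sigma> * \<eta> \<sigma> * \<tau> y" if s: "\<sigma> \<in> H" for \<sigma>
    proof -
      obtain \<rho> where \<rho>: "\<rho> \<in> H" "\<sigma> \<circ> \<tau> = \<tau> \<circ> \<rho>" "\<epsilon> \<rho> = \<epsilon> \<sigma> * \<eta> \<sigma>" using conj[OF s] by blast
      have "\<sigma> (\<tau> y) = \<tau> (\<rho> y)" using fun_cong[OF \<rho>(2), of y] by simp
      also have "\<dots> = \<epsilon> \<sigma> * \<eta> \<sigma> * \<tau> y"
        unfolding y(2)[OF \<rho>(1)] S(1)[OF \<tau>(1)] eps_fix[OF \<tau>(1)] \<rho>(3) ..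
      finally show ?thesis .
    qed
    have tt: "\<tau> \<circ> \<tau> \<in> H" using \<tau>(1) tr S(2)[OF \<tau>(1), of r] by (intro HI galois_comp) auto
    have "\<epsilon> (\<tau> \<circ> \<tau>) = \<eta> \<tau>" using eps_comp[OF \<tau>(1) \<tau>(1)] \<tau>(2) sq(1)[of \<tau>] by simp
    then have tty: "\<tau> (\<tau> y) = \<eta> \<tau> * y" using y(2)[OF tt] by simp
    have ty0: "\<tau> y \<noteq> 0" using y(1) galois_simps(11)[OF \<tau>(1)] by blast
    \<comment> \<open>Under H, y has character \<epsilon> and \<tau>(y) has character
      \<epsilon>\<eta>, so their product transforms like \<surd>b; applying \<tau> gives the factor
      \<eta>(\<tau>) on both sides.\<close>
    have "y * \<tau> y / rb \<in> range j"
    proof (rule fixed)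
      fix \<sigma> assume s: "\<sigma> \<in> H"
      have "\<sigma> (y * \<tau> y / rb) = (\<epsilon> \<sigma> * \<epsilon> \<sigma>) * (\<eta> \<sigma> * (y * \<tau> y)) / (\<eta> \<sigma> * rb)"
        by (simp add: S[OF HG(1)[OF s]] eta[OF HG(1)[OF s]] y(2)[OF s] sty[OF s] mult_ac)
      then show "\<sigma> (y * \<tau> y / rb) = y * \<tau> y / rb" using sq(1)[of \<sigma>] sq(3)[of \<sigma>] by simp
    next
      show "\<tau> (y * \<tau> y / rb) = y * \<tau> y / rb"
        using sq(3)[of \<tau>] by (simp add: S[OF \<tau>(1)] eta[OF \<tau>(1)] tty mult_ac)
    qed
    then obtain c where c: "y * \<tau> y / rb = j c" by blast
    have ttz: "\<tau> (\<tau> y) * \<tau> (\<tau> y) = y * y"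
    proof -
      have "\<tau> (\<tau> y) * \<tau> (\<tau> y) = (\<eta> \<tau> * \<eta> \<tau>) * (y * y)" unfolding tty by (simp only: mult_ac)
      then show ?thesis unfolding sq by simp
    qed
    have zH: "\<sigma> (y * y) = y * y" "\<sigma> (\<tau> y * \<tau> y) = \<tau> y * \<tau> y" if s: "\<sigma> \<in> H" for \<sigma>
    proof -
      have "\<sigma> (y * y) = (\<epsilon> \<sigma> * \<epsilon> \<sigma>) * (y * y)"
        unfolding S(1)[OF HG(1)[OF s]] y(2)[OF s] by (simp add: mult_ac)
      then show "\<sigma> (y * y) = y * y" unfolding sq by simp
      have "\<sigma> (\<tau> y * \<tau> y) = (\<epsilon> \<sigma> * \<epsilon> \<sigma>) * (\<eta> \<sigma> * \<eta> \<sigma>) * (\<tau> y * \<tau> y)"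
        unfolding S(1)[OF HG(1)[OF s]] sty[OF s] by (simp add: mult_ac)
      then show "\<sigma> (\<tau> y * \<tau> y) = \<tau> y * \<tau> y" unfolding sq by simp
    qed
    \<comment> \<open>y^2 lies in E(\<surd>a) and has conjugate \<tau>(y)^2. Its coordinates x1 and
      x2, with y^2 = x1 + x2 r, are found as the half sum and half difference of the two
      conjugates.\<close>
    have "(y * y + \<tau> y * \<tau> y) / 2 \<in> range j"
    proof (rule fixed)
      fix \<sigma> assume s: "\<sigma> \<in> H"
      show "\<sigma> ((y * y + \<tau> y * \<tau> y) / 2) = (y * y + \<tau> y * \<tau> y) / 2"
        unfolding S(3,5)[OF HG(1)[OF s]] zH[OF s] S2[OF HG(1)[OF s]] ..
    next
      show "\<tau> ((y * y + \<tau> y * \<tau> y) / 2) = (y * y + \<tau> y * \<tau> y) / 2"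
        unfolding S(1,3,5)[OF \<tau>(1)] S2[OF \<tau>(1)] ttz by (simp only: add.commute)
    qed
    then obtain x1 where x1: "(y * y + \<tau> y * \<tau> y) / 2 = j x1" by blast
    have "(y * y - \<tau> y * \<tau> y) / (2 * r) \<in> range j"
    proof (rule fixed)
      fix \<sigma> assume s: "\<sigma> \<in> H"
      show "\<sigma> ((y * y - \<tau> y * \<tau> y) / (2 * r)) = (y * y - \<tau> y * \<tau> y) / (2 * r)"
        unfolding S(4,5)[OF HG(1)[OF s]] zH[OF s] S(1)[OF HG(1)[OF s], of 2 r] S2[OF HG(1)[OF s]] HG(2)[OF s] ..
    next
      have "\<tau> ((y * y - \<tau> y * \<tau> y) / (2 * r)) = (\<tau> y * \<tau> y - y * y) / - (2 * r)"
        by (simp add: S[OF \<tau>(1)] S2[OF \<tau>(1)] ttz tr)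
      then show "\<tau> ((y * y - \<tau> y * \<tau> y) / (2 * r)) = (y * y - \<tau> y * \<tau> y) / (2 * r)"
        by (metis minus_diff_eq minus_divide_divide)
    qed
    then obtain x2 where x2: "(y * y - \<tau> y * \<tau> y) / (2 * r) = j x2" by blast
    have e1: "y * y + \<tau> y * \<tau> y = 2 * j x1" using x1 two_nonzero by (simp add: field_simps)
    have e2: "y * y - \<tau> y * \<tau> y = 2 * r * j x2" using x2 two_nonzero r(2) by (simp add: field_simps)
    have e3: "y * \<tau> y = j c * rb" using c rb(2) by (simp add: field_simps)
    \<comment> \<open>The norm x1^2 - a x2^2 of y^2 is (y \<tau>(y))^2 = c^2 b; the factor 4 clears
      the halves in x1 and x2.\<close>
    have "2 * 2 * (j x1 * j x1 - (r * r) * (j x2 * j x2)) = 2 * j x1 * (2 * j x1) - (2 * r * j x2) * (2 * r * j x2)"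
      by (simp add: algebra_simps)
    also have "\<dots> = 2 * 2 * ((y * \<tau> y) * (y * \<tau> y))"
      unfolding e1[symmetric] e2[symmetric] by (simp add: algebra_simps)
    also have "\<dots> = 2 * 2 * ((j c * j c) * (rb * rb))" unfolding e3 by (simp only: mult_ac)
    finally have "j x1 * j x1 - (r * r) * (j x2 * j x2) = (j c * j c) * (rb * rb)"
      using two_nonzero by (metis mult.assoc mult_left_cancel)
    then have "j (x1 * x1 - a * (x2 * x2)) = j (c * c * b)"
      using r(1) rb(1) by (simp add: j_simps[OF sc] power2_eq_square)
    then have eq: "x1 * x1 - a * (x2 * x2) = c * c * b" by (simp only: j_simps(10)[OF sc])
    have "c \<noteq> 0" using c y(1) ty0 rb(2) j_simps(1)[OF sc] by auto
    then have "b = (x1 / c)\<^sup>2 - a * (x2 / c)\<^sup>2"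
      using eq by (simp add: power2_eq_square field_simps)
    then show ?thesis by blast
  qed
qed


section \<open>Cup products and the quotient by (\<alpha>1) \<union> (\<alpha>2)\<close>

lemma cup_kummer: "cup j (kummer j a) (kummer j b) = coboundaries2 j #>\<^bsub>cocycle_group j\<^esub> symbol j a b"
  by (simp add: cup_def symbol_def)

lemma symbol_carrier: "a \<noteq> 0 \<Longrightarrow> b \<noteq> 0 \<Longrightarrow> symbol j a b \<in> carrier (cocycle_group j)"
  using symbol_cocycle by (simp add: cocycle_group_def)

lemma symbol_mult:
  assumes "b \<noteq> 0" "c \<noteq> 0"
  shows "symbol j a b \<otimes>\<^bsub>cocycle_group j\<^esub> symbol j a c = symbol j a (b * c)"
proof -
  have "symbol j a b \<otimes>\<^bsub>cocycle_group j\<^esub> symbol j a c =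
      extend2 j (\<lambda>\<sigma> \<tau>. kummer j a \<sigma> * kummer j b \<tau> + kummer j a \<sigma> * kummer j c \<tau>)"
    unfolding symbol_def cocycle_group_def monoid.simps by (rule ext) (rule extend2_add)
  also have "\<dots> = symbol j a (b * c)"
    unfolding symbol_def extend2_cong_iff
  proof (intro ballI)
    fix \<sigma> \<tau> assume t: "\<tau> \<in> galois j"
    show "kummer j a \<sigma> * kummer j b \<tau> + kummer j a \<sigma> * kummer j c \<tau> = kummer j a \<sigma> * kummer j (b * c) \<tau>"
      unfolding kummer_mult[OF assms t] distrib_left ..
  qed
  finally show ?thesis .
qed

lemma cup_mult:
  assumes "a \<noteq> 0" "b \<noteq> 0" "c \<noteq> 0"
  shows "cup j (kummer j a) (kummer j b) \<otimes>\<^bsub>H2 j\<^esub> cup j (kummer j a) (kummer j c) =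
    cup j (kummer j a) (kummer j (b * c))"
  unfolding cup_kummer H2_def mult_FactGroup
    normal.rcos_sum[OF normal_coboundaries2 symbol_carrier[OF assms(1,2)] symbol_carrier[OF assms(1,3)]]
    symbol_mult[OF assms(2,3)] ..

lemma cup_carrier:
  assumes "a \<noteq> 0" "b \<noteq> 0"
  shows "cup j (kummer j a) (kummer j b) \<in> carrier (H2 j)"
  unfolding cup_kummer H2_def carrier_FactGroup using symbol_carrier[OF assms] by blast

lemma cup_trivial_iff:
  assumes "a \<noteq> 0" "b \<noteq> 0"
  shows "cup j (kummer j a) (kummer j b) = \<one>\<^bsub>H2 j\<^esub> \<longleftrightarrow> symbol j a b \<in> coboundaries2 j"
proof -
  have g: "group (cocycle_group j)" using comm_group_cocycle_group by (rule comm_group.axioms)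
  show ?thesis
    unfolding cup_kummer H2_def one_FactGroup
    using group.coset_join1[OF g _ symbol_carrier[OF assms] subgroup_coboundaries2]
      group.coset_join2[OF g symbol_carrier[OF assms] subgroup_coboundaries2] by blast
qed

text \<open>The class h = (\<alpha>1) \<union> (\<alpha>2) satisfies h^2 = 1 in multiplicative
  notation, so it generates {1, h}, and v = h amounts to vh = 1. By bilinearity vh is the class of
  the symbol with second entry \<open>n * A2\<close>.\<close>

lemma nu_tilde_unit_trivial_iff:
  fixes \<iota> :: "'f::field \<Rightarrow> 'e" and a1 a2 :: 'f and u :: "'e \<times> 'e"
  defines "A1 \<equiv> \<iota> (alpha a1)" and "A2 \<equiv> \<iota> (alpha a2)"
    and "n \<equiv> qnorm (\<iota> (alpha a1 * alpha a2)) u"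
  assumes nz: "A1 \<noteq> 0" "A2 \<noteq> 0" "n \<noteq> 0"
  shows "nu_tilde_unit \<iota> j a1 a2 u = \<one>\<^bsub>nu_tilde_target \<iota> j a1 a2\<^esub> \<longleftrightarrow>
    symbol j A1 n \<in> coboundaries2 j \<or> symbol j A1 (n * A2) \<in> coboundaries2 j"
proof -
  interpret comm_group "H2 j" by (rule comm_group_H2)
  define h where "h = cup j (kummer j A1) (kummer j A2)"
  define v where "v = cup j (kummer j A1) (kummer j n)"
  have hc: "h \<in> carrier (H2 j)" and vc: "v \<in> carrier (H2 j)"
    unfolding h_def v_def using nz by (auto intro: cup_carrier)
  have "symbol j A1 (A2 * A2) = symbol j A1 1"
    unfolding symbol_def extend2_cong_iff
  proof (intro ballI)
    fix \<sigma> \<tau> assume t: "\<tau> \<in> galois j"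
    show "kummer j A1 \<sigma> * kummer j (A2 * A2) \<tau> = kummer j A1 \<sigma> * kummer j 1 \<tau>"
      using kummer_square[OF t, of A2] kummer_square[OF t, of 1] by (simp only: power2_eq_square mult_1_left)
  qed
  then have "cup j (kummer j A1) (kummer j (A2 * A2)) = \<one>\<^bsub>H2 j\<^esub>"
    using cup_trivial_iff[OF nz(1), of "A2 * A2"] nz(2) symbol_trivial_1[of A1] by simp
  then have hh: "h \<otimes>\<^bsub>H2 j\<^esub> h = \<one>\<^bsub>H2 j\<^esub>"
    unfolding h_def cup_mult[OF nz(1,2,2)] .
  let ?S = "{\<one>\<^bsub>H2 j\<^esub>, h}"
  have sub: "subgroup ?S (H2 j)"
  proof (rule subgroupI)
    show "inv\<^bsub>H2 j\<^esub> x \<in> ?S" if "x \<in> ?S" for x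
      using that inv_equality[OF hh hc hc] inv_one by blast
    show "x \<otimes>\<^bsub>H2 j\<^esub> y \<in> ?S" if "x \<in> ?S" "y \<in> ?S" for x y
      using that hh l_one[OF hc] r_one[OF hc] l_one[OF one_closed] by fastforce
  qed (use hc in auto)
  then have "generate (H2 j) {h} \<subseteq> ?S" by (intro generate_subgroup_incl) auto
  then have gen: "generate (H2 j) {h} = ?S" by (auto intro: generate.intros)
  have "nu_tilde_unit \<iota> j a1 a2 u = \<one>\<^bsub>nu_tilde_target \<iota> j a1 a2\<^esub> \<longleftrightarrow>
      ?S #>\<^bsub>H2 j\<^esub> v = ?S"
    unfolding nu_tilde_unit_def nu_tilde_target_def nu_unit_def alpha_subgroup_def one_FactGroup
      A1_def[symmetric] A2_def[symmetric] n_def[symmetric] h_def[symmetric] v_def[symmetric] gen ..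
  also have "\<dots> \<longleftrightarrow> v \<in> ?S"
  proof
    assume "?S #>\<^bsub>H2 j\<^esub> v = ?S"
    then show "v \<in> ?S" using vc sub by (rule coset_join1)
  next
    assume "v \<in> ?S"
    with vc sub show "?S #>\<^bsub>H2 j\<^esub> v = ?S" by (rule coset_join2)
  qed
  also have "\<dots> \<longleftrightarrow> v = \<one>\<^bsub>H2 j\<^esub> \<or> v \<otimes>\<^bsub>H2 j\<^esub> h = h \<otimes>\<^bsub>H2 j\<^esub> h"
    unfolding right_cancel[OF hc vc hc] by (simp only: insert_iff empty_iff simp_thms)
  also note hh
  also have "v \<otimes>\<^bsub>H2 j\<^esub> h = cup j (kummer j A1) (kummer j (n * A2))"
    unfolding v_def h_def using nz by (intro cup_mult)
  finally show ?thesis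
    unfolding v_def using cup_trivial_iff[OF nz(1,3)] cup_trivial_iff[OF nz(1), of "n * A2"] nz by simp
qed

end

section \<open>Matrix algebra\<close>

definition smult_mat :: "'k::field \<Rightarrow> 'k ^ 'n ^ 'm \<Rightarrow> 'k ^ 'n ^ 'm" (infixr "\<cdot>\<^sub>m" 75) where
  "c \<cdot>\<^sub>m M = (\<chi> i j. c * M $ i $ j)"

lemma smult_mat_nth [simp]: "(c \<cdot>\<^sub>m M) $ i $ j = c * M $ i $ j"
  by (simp add: smult_mat_def)

lemma smult_mat_mult: "(c \<cdot>\<^sub>m A) ** B = c \<cdot>\<^sub>m (A ** B)" "A ** (c \<cdot>\<^sub>m B) = c \<cdot>\<^sub>m (A ** B)"
  by (simp_all add: vec_eq_iff matrix_matrix_mult_def sum_distrib_left mult_ac)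

lemma smult_mat_vector: "(c \<cdot>\<^sub>m A) *v x = c *s (A *v x)"
  by (simp add: vec_eq_iff matrix_vector_mult_def sum_distrib_left mult_ac)

lemma smult_mat_smult_mat: "c \<cdot>\<^sub>m d \<cdot>\<^sub>m A = (c * d) \<cdot>\<^sub>m A"
  by (simp add: vec_eq_iff mult_ac)

lemma smult_mat_1 [simp]: "1 \<cdot>\<^sub>m A = A"
  by (simp add: vec_eq_iff)

lemma transpose_smult_mat: "transpose (c \<cdot>\<^sub>m A) = c \<cdot>\<^sub>m transpose A"
  by (simp add: vec_eq_iff transpose_def)

lemma transpose_add: "transpose (A + B) = transpose A + transpose B"
  by (simp add: vec_eq_iff transpose_def)

lemma matrix_ring_distribs:
  fixes A B C :: "'k::field ^ 'n ^ 'n"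
  shows "(A + B) ** C = A ** C + B ** C" "A ** (B + C) = A ** B + A ** C"
    "(A - B) ** C = A ** C - B ** C" "A ** (B - C) = A ** B - A ** C"
    "(- A) ** C = - (A ** C)" "A ** (- C) = - (A ** C)"
  by (simp_all add: vec_eq_iff matrix_matrix_mult_def algebra_simps sum.distrib sum_subtractf sum_negf)

lemma smult_mat_distribs:
  "c \<cdot>\<^sub>m (A + B) = c \<cdot>\<^sub>m A + c \<cdot>\<^sub>m B" "c \<cdot>\<^sub>m (A - B) = c \<cdot>\<^sub>m A - c \<cdot>\<^sub>m B" "c \<cdot>\<^sub>m (- A) = - (c \<cdot>\<^sub>m A)"
  by (simp_all add: vec_eq_iff algebra_simps)

section \<open>Forms with a given matrix\<close>

lemma bform_matrix_space: "bform (matrix_space M) x y = (\<Sum>i\<in>UNIV. x $ i * (M *v y) $ i)"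
  by (simp add: matrix_space_def matrix_vector_mult_def sum_distrib_left mult_ac)

lemma matrix_space_simps [simp]:
  "scal (matrix_space M) = (*s)" "carr (matrix_space M) = UNIV"
  by (simp_all add: matrix_space_def)

lemma sum_matrix_vector_transpose:
  fixes P :: "'k::field ^ 'n ^ 'm"
  shows "(\<Sum>i\<in>UNIV. (P *v x) $ i * y $ i) = (\<Sum>i\<in>UNIV. x $ i * (transpose P *v y) $ i)"
proof -
  have "(\<Sum>i\<in>UNIV. (P *v x) $ i * y $ i) = (\<Sum>i\<in>UNIV. \<Sum>k\<in>UNIV. P $ i $ k * x $ k * y $ i)"
    unfolding matrix_vector_mult_def vec_lambda_beta sum_distrib_right ..
  also have "\<dots> = (\<Sum>k\<in>UNIV. \<Sum>i\<in>UNIV. P $ i $ k * x $ k * y $ i)" by (rule sum.swap)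
  also have "\<dots> = (\<Sum>i\<in>UNIV. x $ i * (transpose P *v y) $ i)"
    unfolding matrix_vector_mult_def transpose_def vec_lambda_beta sum_distrib_left by (simp only: mult_ac)
  finally show ?thesis .
qed

lemma bform_congruence:
  "bform (matrix_space M) (P *v x) (P *v y) = bform (matrix_space (transpose P ** M ** P)) x y"
  unfolding bform_matrix_space sum_matrix_vector_transpose by (simp only: matrix_vector_mul_assoc matrix_mul_assoc)

lemma bform_smult_mat: "bform (matrix_space (c \<cdot>\<^sub>m M)) x y = c * bform (matrix_space M) x y"
  unfolding bform_matrix_space smult_mat_vector by (simp add: sum_distrib_left mult_ac)

section \<open>Matrices up to congruence and scalars\<close>

definition congruent_similar :: "'k::field ^ 'n ^ 'n \<Rightarrow> 'k ^ 'n ^ 'n \<Rightarrow> bool" where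
  "congruent_similar M M' \<longleftrightarrow> (\<exists>P e. invertible P \<and> e \<noteq> 0 \<and> transpose P ** M ** P = e \<cdot>\<^sub>m M')"

lemma congruent_similarI:
  "invertible P \<Longrightarrow> e \<noteq> 0 \<Longrightarrow> transpose P ** M ** P = e \<cdot>\<^sub>m M' \<Longrightarrow> congruent_similar M M'"
  by (auto simp: congruent_similar_def)

lemma invertible_mat_1: "invertible (mat 1 :: 'k::field ^ 'n ^ 'n)"
  by (auto simp: invertible_def intro!: exI[of _ "mat 1"])

lemma congruent_similar_smult: "c \<noteq> 0 \<Longrightarrow> congruent_similar (c \<cdot>\<^sub>m M) M"
  by (rule congruent_similarI[OF invertible_mat_1, of c]) simp_all

lemma congruent_similar_sym:
  assumes "congruent_similar M M'"
  shows "congruent_similar M' M"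
proof -
  obtain P e where P: "invertible P" "e \<noteq> 0" "transpose P ** M ** P = e \<cdot>\<^sub>m M'"
    using assms by (auto simp: congruent_similar_def)
  obtain R where R: "P ** R = mat 1" "R ** P = mat 1" using P(1) by (auto simp: invertible_def)
  have tR: "transpose R ** transpose P = mat 1"
    unfolding matrix_transpose_mul[symmetric] R(1) by (rule transpose_mat)
  have "e \<cdot>\<^sub>m (transpose R ** M' ** R) = transpose R ** (transpose P ** M ** P) ** R"
    unfolding P(3) by (simp only: smult_mat_mult)
  also have "\<dots> = (transpose R ** transpose P) ** M ** (P ** R)" by (simp only: matrix_mul_assoc)
  also have "\<dots> = M" by (simp add: tR R)
  finally have "inverse e \<cdot>\<^sub>m e \<cdot>\<^sub>m (transpose R ** M' ** R) = inverse e \<cdot>\<^sub>m M" by simp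
  then have "transpose R ** M' ** R = inverse e \<cdot>\<^sub>m M" using P(2) by (simp add: smult_mat_smult_mat)
  moreover have "invertible R" using R by (auto simp: invertible_def)
  ultimately show ?thesis using P(2) by (intro congruent_similarI[of R "inverse e"]) auto
qed

lemma congruent_similar_trans:
  assumes "congruent_similar M M'" "congruent_similar M' M''"
  shows "congruent_similar M M''"
proof -
  obtain P e where P: "invertible P" "e \<noteq> 0" "transpose P ** M ** P = e \<cdot>\<^sub>m M'"
    using assms(1) by (auto simp: congruent_similar_def)
  obtain Q d where Q: "invertible Q" "d \<noteq> 0" "transpose Q ** M' ** Q = d \<cdot>\<^sub>m M''"
    using assms(2) by (auto simp: congruent_similar_def)
  have "transpose (P ** Q) ** M ** (P ** Q) = transpose Q ** (transpose P ** M ** P) ** Q"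
    by (simp only: matrix_transpose_mul matrix_mul_assoc)
  also have "\<dots> = (e * d) \<cdot>\<^sub>m M''" unfolding P(3) smult_mat_mult Q(3) smult_mat_smult_mat ..
  finally show ?thesis
    using P Q by (intro congruent_similarI[of "P ** Q" "e * d"] invertible_mult) auto
qed

lemma linear_iso_matrix:
  fixes P :: "'k::field ^ 'n ^ 'n"
  assumes "invertible P"
  shows "linear_iso (matrix_space M) (matrix_space M') ((*v) P)"
proof -
  obtain R where R: "P ** R = mat 1" "R ** P = mat 1" using assms by (auto simp: invertible_def)
  have "bij ((*v) P)"
    by (rule o_bij[of "(*v) R"]) (simp_all add: fun_eq_iff matrix_vector_mul_assoc R)
  then show ?thesis
    by (simp add: linear_iso_def linear_on_def matrix_vector_right_distrib vector_scalar_commute)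
qed

lemma congruent_similar_imp_similar:
  assumes "congruent_similar M M'"
  shows "similar (matrix_space M) (matrix_space M')"
proof -
  obtain P e where P: "invertible P" "e \<noteq> 0" "transpose P ** M' ** P = e \<cdot>\<^sub>m M"
    using congruent_similar_sym[OF assms] by (auto simp: congruent_similar_def)
  have "bform (matrix_space M') (P *v x) (P *v y) = e * bform (matrix_space M) x y" for x y
    unfolding bform_congruence P(3) bform_smult_mat ..
  then show ?thesis
    unfolding similar_def by (intro exI[of _ "(*v) P"] exI[of _ e]) (simp add: P(2) linear_iso_matrix[OF P(1)])
qed

lemma similar_trans:
  assumes "similar W W'" "similar W' W''"
  shows "similar W W''"
proof -
  obtain \<phi> c where \<phi>: "c \<noteq> 0" "linear_iso W W' \<phi>"
    "\<forall>x\<in>carr W. \<forall>y\<in>carr W. bform W' (\<phi> x) (\<phi> y) = c * bform W x y"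
    using assms(1) by (auto simp: similar_def)
  obtain \<psi> d where \<psi>: "d \<noteq> 0" "linear_iso W' W'' \<psi>"
    "\<forall>x\<in>carr W'. \<forall>y\<in>carr W'. bform W'' (\<psi> x) (\<psi> y) = d * bform W' x y"
    using assms(2) by (auto simp: similar_def)
  have mem: "\<phi> x \<in> carr W'" if "x \<in> carr W" for x using \<phi>(2) that by (auto simp: linear_iso_def linear_on_def)
  have "linear_iso W W'' (\<psi> \<circ> \<phi>)"
    unfolding linear_iso_def
  proof
    show "linear_on (scal W) (carr W) (scal W'') (carr W'') (\<psi> \<circ> \<phi>)"
      using \<phi>(2) \<psi>(2) mem by (auto simp: linear_iso_def linear_on_def)
    show "bij_betw (\<psi> \<circ> \<phi>) (carr W) (carr W'')"
      using \<phi>(2) \<psi>(2) by (auto simp: linear_iso_def intro: bij_betw_trans)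
  qed
  moreover have "bform W'' ((\<psi> \<circ> \<phi>) x) ((\<psi> \<circ> \<phi>) y) = (d * c) * bform W x y"
    if "x \<in> carr W" "y \<in> carr W" for x y
    using \<phi>(3) \<psi>(3) mem that by (simp add: mult.assoc)
  moreover have "d * c \<noteq> 0" using \<phi>(1) \<psi>(1) by simp
  ultimately show ?thesis unfolding similar_def by blast
qed

section \<open>Kronecker products\<close>

lemma kron_mult:
  fixes M M' :: "'k::field ^ 'm ^ 'm" and N N' :: "'k ^ 'n ^ 'n"
  shows "kron M N ** kron M' N' = kron (M ** M') (N ** N')"
  by (simp add: vec_eq_iff matrix_matrix_mult_def kron_def sum_UNIV_prod sum_product mult_ac)

lemma transpose_kron: "transpose (kron M N) = kron (transpose M) (transpose N)"
  by (simp add: vec_eq_iff transpose_def kron_def)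

lemma kron_smult:
  "kron (c \<cdot>\<^sub>m M) N = c \<cdot>\<^sub>m kron M N" "kron M (c \<cdot>\<^sub>m N) = c \<cdot>\<^sub>m kron M N"
  by (simp_all add: vec_eq_iff kron_def mult_ac)

lemma kron_minus:
  fixes M :: "'k::field ^ 'm ^ 'm" and N :: "'k ^ 'n ^ 'n"
  shows "kron (- M) N = - kron M N" "kron M (- N) = - kron M N"
  by (simp_all add: vec_eq_iff kron_def)

lemma kron_mat_1: "kron (mat 1 :: 'k::field ^ 'm ^ 'm) (mat 1 :: 'k ^ 'n ^ 'n) = mat 1"
  by (auto simp: vec_eq_iff kron_def mat_def prod_eq_iff)

lemma invertible_kron:
  fixes M :: "'k::field ^ 'm ^ 'm" and N :: "'k ^ 'n ^ 'n"
  assumes "invertible M" "invertible N"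
  shows "invertible (kron M N)"
proof -
  obtain M' N' where "M ** M' = mat 1" "M' ** M = mat 1" "N ** N' = mat 1" "N' ** N = mat 1"
    using assms by (auto simp: invertible_def)
  then have "kron M N ** kron M' N' = mat 1" "kron M' N' ** kron M N = mat 1"
    by (simp_all add: kron_mult kron_mat_1)
  then show ?thesis by (auto simp: invertible_def)
qed

lemma congruent_similar_kron:
  fixes M M' :: "'k::field ^ 'm ^ 'm" and N N' :: "'k ^ 'n ^ 'n"
  assumes "congruent_similar M M'" "congruent_similar N N'"
  shows "congruent_similar (kron M N) (kron M' N')"
proof -
  obtain P e where P: "invertible P" "e \<noteq> 0" "transpose P ** M ** P = e \<cdot>\<^sub>m M'"
    using assms(1) by (auto simp: congruent_similar_def)
  obtain Q d where Q: "invertible Q" "d \<noteq> 0" "transpose Q ** N ** Q = d \<cdot>\<^sub>m N'"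
    using assms(2) by (auto simp: congruent_similar_def)
  have "transpose (kron P Q) ** kron M N ** kron P Q = (e * d) \<cdot>\<^sub>m kron M' N'"
    unfolding transpose_kron kron_mult P(3) Q(3) kron_smult smult_mat_smult_mat by (simp only: mult.commute)
  then show ?thesis
    using P Q by (intro congruent_similarI[of "kron P Q" "e * d"] invertible_kron) auto
qed

lemma congruent_similar_kron_swap:
  fixes M N :: "'k::field ^ 'n ^ 'n"
  shows "congruent_similar (kron M N) (kron N M)"
proof -
  define P :: "'k ^ ('n \<times> 'n) ^ ('n \<times> 'n)" where "P = (\<chi> p q. if p = prod.swap q then 1 else 0)"
  have PP: "P ** P = mat 1"
    by (simp add: P_def vec_eq_iff matrix_matrix_mult_def mat_def if_distrib[of "\<lambda>x. _ * x"] cong: if_cong)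
  have "transpose P ** kron M N ** P = 1 \<cdot>\<^sub>m kron N M"
  proof -
    have "(A ** P) $ p $ q = A $ p $ prod.swap q" "(transpose P ** A) $ p $ q = A $ prod.swap p $ q"
      for A :: "'k ^ ('n \<times> 'n) ^ ('n \<times> 'n)" and p q
      by (simp_all add: P_def matrix_matrix_mult_def transpose_def if_distrib[of "\<lambda>x. _ * x"]
          if_distrib[of "\<lambda>x. x * _"] cong: if_cong)
    then show ?thesis by (simp add: vec_eq_iff kron_def mult.commute)
  qed
  then show ?thesis using PP by (intro congruent_similarI[of P 1]) (auto simp: invertible_def)
qed

lemma trace_kron:
  fixes M :: "'k::field ^ 'm ^ 'm" and N :: "'k ^ 'n ^ 'n"
  shows "trace (kron M N) = trace M * trace N"
  by (simp add: trace_def kron_def sum_UNIV_prod sum_product)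

lemma kron_elem_tensor:
  fixes M :: "'k::field ^ 'm ^ 'm" and N :: "'k ^ 'n ^ 'n"
  shows "kron M N *v elem_tensor x y = elem_tensor (M *v x) (N *v y)"
  by (simp add: vec_eq_iff kron_def elem_tensor_def matrix_vector_mult_def sum_UNIV_prod sum_product mult_ac)

section \<open>Two-dimensional forms\<close>

lemmas mat2_simps = vec_eq_iff forall_2 sum_2 matrix_matrix_mult_def transpose_def vector_2 mat_def

text \<open>The quadratic condition says that the asymmetry of M has trace c, cleared of the inverse
  of M (see \<open>asymmetry_2_trace\<close>). A vector e with b(e, e) = p nonzero is completed by v
  with b(v, e) = 0 and b(e, v) = p; the condition then forces b(v, v) = p/(2 - c). The bound c
  \<noteq> 2 excludes symmetric forms, c \<noteq> -2 alternating ones.\<close>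

lemma congruent_similar_b_matrix:
  fixes M :: "'k::field ^ 2 ^ 2"
  assumes "det M \<noteq> 0" "(M $ 1 $ 2 - M $ 2 $ 1)\<^sup>2 = (2 - c) * det M" "c \<noteq> 2" "c \<noteq> - 2"
  shows "congruent_similar M (b_matrix c)"
proof -
  have main: "congruent_similar M (b_matrix c)"
    if M: "det M \<noteq> 0" "(M $ 1 $ 2 - M $ 2 $ 1)\<^sup>2 = (2 - c) * det M" "M $ 1 $ 1 \<noteq> 0" for M :: "'k ^ 2 ^ 2"
  proof -
    define p q r s where "p = M $ 1 $ 1" and "q = M $ 1 $ 2" and "r = M $ 2 $ 1" and "s = M $ 2 $ 2"
    note pqrs = p_def[symmetric] q_def[symmetric] r_def[symmetric] s_def[symmetric]
    have d: "det M = p * s - q * r" by (simp add: det_2 pqrs)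
    have qr: "q \<noteq> r"
    proof
      assume "q = r"
      then have "(2 - c) * det M = 0" using M(2) by (simp add: pqrs)
      then show False using M(1) assms(3) by simp
    qed
    define t where "t = 1 / (q - r)"
    have t: "t * (q - r) = 1" "t \<noteq> 0" using qr by (simp_all add: t_def)
    \<comment> \<open>The second column is v = t(-r e1 + p e2). It satisfies b(v, e1) = 0, and t =
      1/(q - r) normalizes b(e1, v) to p.\<close>
    define P :: "'k ^ 2 ^ 2" where "P = vector [vector [1, - r * t], vector [0, p * t]]"
    have "det P \<noteq> 0" using M(3) t(2) by (simp add: P_def det_2 vector_2 pqrs)
    then have "invertible P" by (simp add: invertible_det_nz)
    moreover have "transpose P ** M ** P = p \<cdot>\<^sub>m b_matrix c"
    proof -
      have e12: "p * (- r * t) + q * (p * t) = p" using t(1) by (metis (no_types, opaque_lifting) ab_group_add_class.ab_diff_conv_add_uminus add.commute mult.commute mult.left_commute mult_minus_left mult_1_right right_diff_distrib)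
      have "(t * (q - r))\<^sup>2 * p = t\<^sup>2 * p * ((2 - c) * (p * s - q * r))"
        using M(2) unfolding pqrs d by (simp add: power_mult_distrib)
      then have "t\<^sup>2 * p * (p * s - q * r) = p / (2 - c)"
        using t(1) assms(3) by (simp add: field_simps)
      then have e22: "(- r * t * p + p * t * r) * (- r * t) + (- r * t * q + p * t * s) * (p * t) = p / (2 - c)"
        by (simp add: algebra_simps power2_eq_square)
      show ?thesis
        using e12 e22 by (simp add: mat2_simps P_def b_matrix_def pqrs)
    qed
    ultimately show ?thesis using M(3) by (intro congruent_similarI[of P p]) (auto simp: p_def)
  qed
  have step: "congruent_similar M (b_matrix c)"
    if P: "det P \<noteq> 0" and nz: "(transpose P ** M ** P) $ 1 $ 1 \<noteq> 0" for P :: "'k ^ 2 ^ 2"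
  proof -
    let ?M = "transpose P ** M ** P"
    have d: "det ?M = (det P)\<^sup>2 * det M" by (simp add: det_mul det_transpose power2_eq_square)
    have "?M $ 1 $ 2 - ?M $ 2 $ 1 = det P * (M $ 1 $ 2 - M $ 2 $ 1)"
      by (simp add: mat2_simps det_2 algebra_simps)
    then have "(?M $ 1 $ 2 - ?M $ 2 $ 1)\<^sup>2 = (2 - c) * det ?M"
      by (simp only: d power_mult_distrib assms(2) mult_ac)
    then have "congruent_similar ?M (b_matrix c)" using d P assms(1) nz by (intro main) auto
    moreover have "congruent_similar M ?M"
      using P by (intro congruent_similarI[of P 1]) (auto simp: invertible_det_nz)
    ultimately show ?thesis by (rule congruent_similar_trans[rotated])
  qed
  \<comment> \<open>A vector with nonzero value is found among e1, e2 and e1 + e2.\<close>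
  consider "M $ 1 $ 1 \<noteq> 0" | "M $ 2 $ 2 \<noteq> 0" | "M $ 1 $ 1 = 0" "M $ 2 $ 2 = 0" by blast
  then show ?thesis
  proof cases
    case 1 then show ?thesis using main assms by blast
  next
    case 2
    then show ?thesis by (intro step[of "vector [vector [0, 1], vector [1, 0]]"]) (simp_all add: det_2 mat2_simps)
  next
    case 3
    let ?q = "M $ 1 $ 2" and ?r = "M $ 2 $ 1"
    have d: "det M = - (?q * ?r)" by (simp add: det_2 3)
    \<comment> \<open>Otherwise M is alternating, and its asymmetry -1 would have trace c =
      -2.\<close>
    have "?q + ?r \<noteq> 0"
    proof
      assume "?q + ?r = 0"
      then have r: "?r = - ?q" by (simp add: eq_neg_iff_add_eq_0 add.commute)
      have "(2 + 2) * (?q * ?q) = (2 - c) * (?q * ?q)"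
        using assms(2) unfolding d r by (simp add: power2_eq_square algebra_simps)
      moreover have "?q * ?q \<noteq> 0" using assms(1) d r by auto
      ultimately have "2 + 2 = 2 - c" by (metis mult_right_cancel)
      then have "c = - 2" by (metis add_diff_cancel_left' diff_add_cancel diff_minus_eq_add uminus_add_conv_diff add.inverse_inverse add_left_cancel)
      then show False using assms(4) by blast
    qed
    then show ?thesis
      by (intro step[of "vector [vector [1, 0], vector [1, 1]]"]) (simp_all add: det_2 mat2_simps 3 add.commute)
  qed
qed

text \<open>Twice the asymmetry of b_a minus its trace a, as \<open>matrix_delta\<close>
  shows.\<close>

definition delta_matrix :: "'k::field \<Rightarrow> 'k ^ 2 ^ 2" where
  "delta_matrix a = vector [vector [a - 2, - 2], vector [4 - 2 * a, 2 - a]]"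

lemma delta_matrix_square: "delta_matrix a ** delta_matrix a = alpha a \<cdot>\<^sub>m mat 1"
  by (simp add: mat2_simps delta_matrix_def alpha_def power2_eq_square algebra_simps)

text \<open>The asymmetry A preserves b, so its adjoint is its inverse, which is a - A since A has
  trace a and determinant 1. Hence 2A - a is skew-adjoint.\<close>

lemma delta_matrix_skew:
  assumes "a \<noteq> 2"
  shows "transpose (delta_matrix a) ** b_matrix a = - (b_matrix a ** delta_matrix a)"
proof -
  have "(4 - 2 * a) / (2 - a) = 2" using assms by (simp add: field_simps)
  then show ?thesis using assms by (simp add: mat2_simps delta_matrix_def b_matrix_def)
qed

lemma b_matrix_delta_matrix:
  assumes "a \<noteq> 2"
  shows "b_matrix a ** delta_matrix a = vector [vector [2 - a, - a], vector [2, 1]]"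
  using assms by (simp add: mat2_simps delta_matrix_def b_matrix_def field_simps)

lemma invertible_b_matrix: "a \<noteq> 2 \<Longrightarrow> invertible (b_matrix a)"
  by (simp add: invertible_det_nz det_2 b_matrix_def)

text \<open>As \<delta> = 2A - a is skew-adjoint, the form b(x, \<delta>y) has asymmetry -A, of
  trace -a. This is the source of the planes b_(-a1) and b_(-a2).\<close>

lemma congruent_similar_b_matrix_neg:
  fixes a :: "'k::field"
  assumes "a \<noteq> 2" "a \<noteq> - 2"
  shows "congruent_similar (b_matrix a ** delta_matrix a) (b_matrix (- a))"
proof (rule congruent_similar_b_matrix)
  have d: "det (b_matrix a ** delta_matrix a) = a + 2"
    unfolding b_matrix_delta_matrix[OF assms(1)] by (simp add: det_2 algebra_simps)
  show "det (b_matrix a ** delta_matrix a) \<noteq> 0"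
    unfolding d using assms(2) by (simp add: add_eq_0_iff2)
  show "((b_matrix a ** delta_matrix a) $ 1 $ 2 - (b_matrix a ** delta_matrix a) $ 2 $ 1)\<^sup>2 =
      (2 - - a) * det (b_matrix a ** delta_matrix a)"
    unfolding d unfolding b_matrix_delta_matrix[OF assms(1)] by (simp add: power2_eq_square algebra_simps)
  show "- a \<noteq> 2" "- a \<noteq> - 2" using assms by (metis minus_minus)+
qed

section \<open>Norms and similitudes\<close>

text \<open>The witness comes from the isotropy of the transfer of \<open>\<langle>u\<rangle> \<otimes> \<langle>1, -\<alpha>\<^sub>1\<rangle>\<close>: for \<open>u = r + s\<theta>\<close> with
  \<open>N(u) = x\<^sup>2 - \<alpha>\<^sub>1y\<^sup>2\<close>, the element \<open>(x - r + s\<theta>)\<^sup>2 - \<alpha>\<^sub>1y\<^sup>2\<close> is \<open>-2(x - r)\<close> times the conjugate of \<open>u\<close>. If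
  \<open>x = r = 0\<close>, then \<open>\<alpha>\<^sub>2\<close> is a square, so that \<open>\<alpha>\<^sub>1\<close> is a square in \<open>K\<close> and all of \<open>K\<close> is represented.\<close>

lemma conjugate_is_relative_norm:
  fixes r s x y \<alpha>1 \<alpha>2 :: "'k::field"
  assumes two: "(2::'k) \<noteq> 0" and nz: "\<alpha>1 \<noteq> 0" "\<alpha>2 \<noteq> 0" "r\<^sup>2 - \<alpha>1 * \<alpha>2 * s\<^sup>2 \<noteq> 0"
    and norm: "r\<^sup>2 - \<alpha>1 * \<alpha>2 * s\<^sup>2 = x\<^sup>2 - \<alpha>1 * y\<^sup>2"
  shows "\<exists>x0 x1 y0 y1 e. e \<noteq> 0 \<and>
    x0\<^sup>2 + \<alpha>1 * \<alpha>2 * x1\<^sup>2 - \<alpha>1 * (y0\<^sup>2 + \<alpha>1 * \<alpha>2 * y1\<^sup>2) = e * r \<and> 2 * (x0 * x1 - \<alpha>1 * y0 * y1) = - e * s"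
proof -
  have generic: ?thesis
    if z: "z \<noteq> r" "r\<^sup>2 - \<alpha>1 * \<alpha>2 * s\<^sup>2 = z\<^sup>2 - \<alpha>1 * y\<^sup>2" for z
  proof (intro exI conjI)
    show "- 2 * (z - r) \<noteq> 0" using two z(1) by simp
    have "(z - r)\<^sup>2 + \<alpha>1 * \<alpha>2 * s\<^sup>2 - \<alpha>1 * y\<^sup>2 =
        - 2 * (z - r) * r + ((z\<^sup>2 - \<alpha>1 * y\<^sup>2) - (r\<^sup>2 - \<alpha>1 * \<alpha>2 * s\<^sup>2))"
      by (simp add: power2_eq_square algebra_simps)
    then show "(z - r)\<^sup>2 + \<alpha>1 * \<alpha>2 * s\<^sup>2 - \<alpha>1 * (y\<^sup>2 + \<alpha>1 * \<alpha>2 * 0\<^sup>2) = - 2 * (z - r) * r"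
      unfolding z(2) by simp
    show "2 * ((z - r) * s - \<alpha>1 * y * 0) = - (- 2 * (z - r)) * s" by (simp add: algebra_simps)
  qed
  consider "s = 0" | "x \<noteq> r" | "- x \<noteq> r" | "s \<noteq> 0" "x = r" "- x = r" by blast
  then show ?thesis
  proof cases
    case 1
    then have "r \<noteq> 0" using nz(3) by auto
    then show ?thesis using 1
      by (intro exI[of _ 1] exI[of _ 0] exI[of _ 0] exI[of _ 0] exI[of _ "1 / r"]) simp
  next
    case 2 then show ?thesis using generic norm by blast
  next
    case 3 then show ?thesis using generic[of "- x"] norm by simp
  next
    case 4
    then have "2 * r = 0" by (metis add.right_inverse mult_2)
    then have r: "r = 0" "x = 0" using two 4 by auto
    then have "\<alpha>1 * (\<alpha>2 * s\<^sup>2) = \<alpha>1 * y\<^sup>2" using norm by simp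
    then have ys: "y\<^sup>2 = \<alpha>2 * s\<^sup>2" using nz(1) by simp
    define \<beta> where "\<beta> = y / s"
    have b: "\<beta>\<^sup>2 = \<alpha>2" using ys 4(1) by (simp add: \<beta>_def power_divide)
    have b0: "\<beta> \<noteq> 0" using b nz(2) by auto
    have ab: "\<alpha>1 * \<alpha>2 = \<alpha>1 * \<beta>\<^sup>2" using b by simp
    define c where "c = 1 / (2 * \<beta> * \<alpha>1)"
    have c: "c * (2 * \<beta> * \<alpha>1) = 1" using two b0 nz(1) by (simp add: c_def)
    define h where "h = 1 / (2::'k)"
    have h: "2 * h = 1" using two by (simp add: h_def)
    have hc: "h = c * \<beta> * \<alpha>1"
    proof -
      have "2 * h = 2 * (c * \<beta> * \<alpha>1)" using h c by (simp add: mult_ac)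
      then show ?thesis using two by simp
    qed
    have d: "\<alpha>1 * \<alpha>2 * c = h * \<beta>" unfolding hc ab by (simp add: power2_eq_square mult_ac)
    \<comment> \<open>The value to represent is \<theta> itself, with e = -1/s. In K,
      \<theta>/\<beta> is a square root of \<alpha>1, so \<theta> = X^2 - \<alpha>1 Y^2 for X =
      (\<theta> + 1)/2 and Y = (\<theta> - 1)/(2\<surd>\<alpha>1) = \<beta>/2 - c\<theta>. These are
      the four coefficients, with \<beta>/2 written as \<alpha>1\<alpha>2c.\<close>
    show ?thesis
    proof (intro exI conjI)
      show "- 1 / s \<noteq> 0" using 4(1) by simp
      have "h\<^sup>2 + \<alpha>1 * \<alpha>2 * h\<^sup>2 - \<alpha>1 * ((\<alpha>1 * \<alpha>2 * c)\<^sup>2 + \<alpha>1 * \<alpha>2 * (- c)\<^sup>2) = 0"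
        unfolding d ab hc by (simp add: power2_eq_square algebra_simps)
      then show "h\<^sup>2 + \<alpha>1 * \<alpha>2 * h\<^sup>2 - \<alpha>1 * ((\<alpha>1 * \<alpha>2 * c)\<^sup>2 + \<alpha>1 * \<alpha>2 * (- c)\<^sup>2) = (- 1 / s) * r"
        unfolding r by simp
      have "\<alpha>1 * (h * \<beta>) * c = h * h" unfolding hc by (simp add: mult_ac)
      then have "2 * (h * h - \<alpha>1 * (\<alpha>1 * \<alpha>2 * c) * (- c)) = 2 * (h * h + h * h)"
        unfolding d by simp
      also have "\<dots> = 2 * h * (2 * h)" by (simp add: algebra_simps)
      finally have "2 * (h * h - \<alpha>1 * (\<alpha>1 * \<alpha>2 * c) * (- c)) = 2 * h * (2 * h)" .
      then show "2 * (h * h - \<alpha>1 * (\<alpha>1 * \<alpha>2 * c) * (- c)) = - (- 1 / s) * s"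
        unfolding h using 4(1) by simp
    qed
  qed
qed

text \<open>With X = x0 + x1 T and Y = y0 + y1 T this is (X - YD)(X + YD) = X^2 - \<alpha>Y^2, the
  norm from L to K when T is \<theta> and D is \<surd>\<alpha>1 \<otimes> 1.\<close>

lemma commuting_norm:
  fixes T D :: "'k::field ^ 'n ^ 'n"
  assumes comm: "T ** D = D ** T" and sq: "T ** T = d \<cdot>\<^sub>m mat 1" "D ** D = \<alpha> \<cdot>\<^sub>m mat 1"
  shows "((x0 \<cdot>\<^sub>m mat 1 + x1 \<cdot>\<^sub>m T) - (y0 \<cdot>\<^sub>m D + y1 \<cdot>\<^sub>m (T ** D))) **
      ((x0 \<cdot>\<^sub>m mat 1 + x1 \<cdot>\<^sub>m T) + (y0 \<cdot>\<^sub>m D + y1 \<cdot>\<^sub>m (T ** D))) =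
    (x0\<^sup>2 + d * x1\<^sup>2 - \<alpha> * (y0\<^sup>2 + d * y1\<^sup>2)) \<cdot>\<^sub>m mat 1 + (2 * (x0 * x1 - \<alpha> * y0 * y1)) \<cdot>\<^sub>m T"
proof -
  have TD: "D ** (T ** D) = \<alpha> \<cdot>\<^sub>m T" "(T ** D) ** D = \<alpha> \<cdot>\<^sub>m T"
    by (simp_all only: comm matrix_mul_assoc sq(2) smult_mat_mult matrix_mul_lid)
       (simp_all only: comm[symmetric] matrix_mul_assoc[symmetric] sq(2) smult_mat_mult matrix_mul_rid)
  have TT: "T ** (T ** D) = d \<cdot>\<^sub>m D" "(T ** D) ** T = d \<cdot>\<^sub>m D"
    by (simp_all only: matrix_mul_assoc sq(1) smult_mat_mult matrix_mul_lid)
       (simp_all only: comm matrix_mul_assoc[symmetric] sq(1) smult_mat_mult matrix_mul_rid)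
  have "(T ** D) ** (T ** D) = T ** (D ** (T ** D))" by (simp only: matrix_mul_assoc)
  then have TDTD: "(T ** D) ** (T ** D) = (\<alpha> * d) \<cdot>\<^sub>m mat 1"
    by (simp only: TD smult_mat_mult sq(1) smult_mat_smult_mat)
  show ?thesis
    unfolding matrix_ring_distribs smult_mat_mult TD TT TDTD sq comm[symmetric] smult_mat_smult_mat
      matrix_mul_lid matrix_mul_rid
    by (simp add: vec_eq_iff algebra_simps power2_eq_square)
qed

text \<open>T is self-adjoint and D skew-adjoint, and they commute, so TD is skew-adjoint. Taking
  adjoints is thus the conjugation of L over K that negates D.\<close>

lemma adjoint_product:
  fixes T D B :: "'k::field ^ 'n ^ 'n"
  assumes comm: "T ** D = D ** T"
    and TB: "transpose T ** B = B ** T" and DB: "transpose D ** B = - (B ** D)"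
  shows "transpose ((x0 \<cdot>\<^sub>m mat 1 + x1 \<cdot>\<^sub>m T) + (y0 \<cdot>\<^sub>m D + y1 \<cdot>\<^sub>m (T ** D))) ** B =
    B ** ((x0 \<cdot>\<^sub>m mat 1 + x1 \<cdot>\<^sub>m T) - (y0 \<cdot>\<^sub>m D + y1 \<cdot>\<^sub>m (T ** D)))"
proof -
  have "transpose (T ** D) ** B = transpose D ** (transpose T ** B)"
    by (simp only: matrix_transpose_mul matrix_mul_assoc)
  also have "\<dots> = - (B ** D) ** T" unfolding TB by (simp only: matrix_mul_assoc DB)
  finally have TDB: "transpose (T ** D) ** B = - (B ** (T ** D))"
    by (simp only: matrix_ring_distribs comm matrix_mul_assoc)
  show ?thesis
    unfolding transpose_add transpose_smult_mat matrix_ring_distribs smult_mat_mult TB DB TDB transpose_mat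
      matrix_mul_lid matrix_mul_rid smult_mat_distribs by simp
qed

abbreviation form_matrix :: "'k::field \<Rightarrow> 'k \<Rightarrow> 'k ^ (2 \<times> 2) ^ (2 \<times> 2)" where
  "form_matrix a1 a2 \<equiv> kron (b_matrix a1) (b_matrix a2)"

abbreviation theta_matrix :: "'k::field \<Rightarrow> 'k \<Rightarrow> 'k ^ (2 \<times> 2) ^ (2 \<times> 2)" where
  "theta_matrix a1 a2 \<equiv> kron (delta_matrix a1) (delta_matrix a2)"

context
  fixes a1 a2 :: "'k::field"
  assumes a: "a1 \<noteq> 2" "a1 \<noteq> - 2" "a2 \<noteq> 2" "a2 \<noteq> - 2" and two: "(2::'k) \<noteq> 0"
begin

lemma alpha_nonzero: "alpha a1 \<noteq> 0" "alpha a2 \<noteq> 0"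
proof -
  have "alpha x = (x - 2) * (x - - 2)" for x :: 'k by (simp add: alpha_def power2_eq_square algebra_simps)
  then show "alpha a1 \<noteq> 0" "alpha a2 \<noteq> 0" using a by (auto simp: add_eq_0_iff2)
qed

lemma theta_matrix_square: "theta_matrix a1 a2 ** theta_matrix a1 a2 = (alpha a1 * alpha a2) \<cdot>\<^sub>m mat 1"
  by (simp add: kron_mult delta_matrix_square kron_smult kron_mat_1 smult_mat_smult_mat mult.commute)

text \<open>For l in L with conjugate l' and l'l = e(r - s\<theta>), the adjoint of l is l', so
  transforming M by l yields M l'l = e M(r - s\<theta>). The two choices of M serve the units u and
  u\<theta>.\<close>

lemma relative_norm_congruent:
  assumes nz: "r\<^sup>2 - alpha a1 * alpha a2 * s\<^sup>2 \<noteq> 0" and norm: "r\<^sup>2 - alpha a1 * alpha a2 * s\<^sup>2 = x\<^sup>2 - alpha a1 * y\<^sup>2"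
    and M: "M = form_matrix a1 a2 \<or> M = form_matrix a1 a2 ** theta_matrix a1 a2" and inv: "invertible (M ** (r \<cdot>\<^sub>m mat 1 - s \<cdot>\<^sub>m theta_matrix a1 a2))"
  shows "congruent_similar M (M ** (r \<cdot>\<^sub>m mat 1 - s \<cdot>\<^sub>m theta_matrix a1 a2))"
proof -
  let ?B = "form_matrix a1 a2" and ?T = "theta_matrix a1 a2"
  let ?D = "kron (delta_matrix a1) (mat 1) :: 'k ^ (2 \<times> 2) ^ (2 \<times> 2)"
  let ?MU = "M ** (r \<cdot>\<^sub>m mat 1 - s \<cdot>\<^sub>m ?T)"
  have D: "?D ** ?D = alpha a1 \<cdot>\<^sub>m mat 1"
    by (simp add: kron_mult delta_matrix_square kron_smult kron_mat_1)
  have comm: "?T ** ?D = ?D ** ?T" by (simp add: kron_mult)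
  have TB: "transpose ?T ** ?B = ?B ** ?T"
    by (simp add: transpose_kron kron_mult delta_matrix_skew a kron_minus)
  have DB: "transpose ?D ** ?B = - (?B ** ?D)"
    by (simp add: transpose_kron kron_mult delta_matrix_skew a kron_minus)
  \<comment> \<open>The adjoints of \<theta> and D are the same for b(x, \<theta>y), since \<theta>
    is self-adjoint and commutes with D.\<close>
  have TBT: "transpose ?T ** (?B ** ?T) = (?B ** ?T) ** ?T"
    unfolding matrix_mul_assoc TB ..
  have DBT: "transpose ?D ** (?B ** ?T) = - ((?B ** ?T) ** ?D)"
    unfolding matrix_mul_assoc DB unfolding matrix_mul_assoc[symmetric] comm
    unfolding matrix_mul_assoc matrix_ring_distribs ..
  obtain x0 x1 y0 y1 e where e: "e \<noteq> 0"
    "x0\<^sup>2 + alpha a1 * alpha a2 * x1\<^sup>2 - alpha a1 * (y0\<^sup>2 + alpha a1 * alpha a2 * y1\<^sup>2) = e * r"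
    "2 * (x0 * x1 - alpha a1 * y0 * y1) = - e * s"
    using conjugate_is_relative_norm[OF two alpha_nonzero nz norm] by blast
  let ?L = "(x0 \<cdot>\<^sub>m mat 1 + x1 \<cdot>\<^sub>m ?T) + (y0 \<cdot>\<^sub>m ?D + y1 \<cdot>\<^sub>m (?T ** ?D))"
  let ?L' = "(x0 \<cdot>\<^sub>m mat 1 + x1 \<cdot>\<^sub>m ?T) - (y0 \<cdot>\<^sub>m ?D + y1 \<cdot>\<^sub>m (?T ** ?D))"
  have LL: "?L' ** ?L = e \<cdot>\<^sub>m (r \<cdot>\<^sub>m mat 1 - s \<cdot>\<^sub>m ?T)"
    unfolding commuting_norm[OF comm theta_matrix_square D] e by (simp add: vec_eq_iff algebra_simps)
  have "transpose ?L ** M = M ** ?L'"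
    using M adjoint_product[OF comm TB DB] adjoint_product[OF comm TBT DBT] by auto
  then have "transpose ?L ** M ** ?L = M ** (?L' ** ?L)" by (simp only: matrix_mul_assoc)
  also have "\<dots> = e \<cdot>\<^sub>m ?MU" unfolding LL smult_mat_mult ..
  finally have eq: "transpose ?L ** M ** ?L = e \<cdot>\<^sub>m ?MU" .
  have "invertible (e \<cdot>\<^sub>m ?MU)"
  proof -
    obtain R where "?MU ** R = mat 1" "R ** ?MU = mat 1"
      using inv by (auto simp: invertible_def)
    then show ?thesis using e(1) unfolding invertible_def
      by (intro exI[of _ "inverse e \<cdot>\<^sub>m R"]) (simp add: smult_mat_mult smult_mat_smult_mat)
  qed
  then have "det ?L \<noteq> 0" unfolding eq[symmetric] invertible_det_nz det_mul det_transpose by auto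
  then have "invertible ?L" by (simp add: invertible_det_nz)
  then show ?thesis using e(1) eq by (rule congruent_similarI)
qed

end

section \<open>Asymmetries\<close>

abbreviation linear_map :: "('k::field, 'v::ab_group_add) bilin \<Rightarrow> ('k, 'w::ab_group_add) bilin \<Rightarrow> ('v \<Rightarrow> 'w) \<Rightarrow> bool" where
  "linear_map W W' \<equiv> linear_on (scal W) (carr W) (scal W') (carr W')"

abbreviation linear_functional :: "('k::field, 'v::ab_group_add) bilin \<Rightarrow> ('v \<Rightarrow> 'k) \<Rightarrow> bool" where
  "linear_functional W \<equiv> linear_on (scal W) (carr W) (*) UNIV"

text \<open>Nondegeneracy makes the map described in \<open>asymmetry\<close> unique. Uniqueness is
  understood among extensional maps, so f is first restricted to the carrier.\<close>

lemma asymmetry_eqI: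
  assumes W: "bilinear_space W" "nondegenerate W"
    and f: "linear_map W W f"
    and adj: "\<And>x y. x \<in> carr W \<Longrightarrow> y \<in> carr W \<Longrightarrow> bform W x y = bform W y (f x)"
    and x: "x \<in> carr W"
  shows "asymmetry W x = f x"
proof -
  interpret vector_space "scal W" using W(1) by (simp add: bilinear_space_def)
  have sub: "subspace (carr W)" using W(1) by (simp add: bilinear_space_def)
  have badd: "bform W z (v + w) = bform W z v + bform W z w" if "z \<in> carr W" "v \<in> carr W" "w \<in> carr W" for z v w
    using W(1) that by (auto simp: bilinear_space_def bilinear_on_def linear_on_def)
  have bdiff: "bform W z (v - w) = bform W z v - bform W z w" if "z \<in> carr W" "v \<in> carr W" "w \<in> carr W" for z v w
    using badd[of z "v - w" w] that subspace_diff[OF sub that(2,3)] by simp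
  let ?f = "restrict f (carr W)"
  have "asymmetry W = ?f"
    unfolding asymmetry_def
  proof (rule the_equality)
    show "?f \<in> extensional (carr W) \<and> linear_map W W ?f \<and>
        (\<forall>x\<in>carr W. \<forall>y\<in>carr W. bform W x y = bform W y (?f x))"
      using f adj subspace_add[OF sub] subspace_scale[OF sub] by (auto simp: linear_on_def)
    fix g assume g: "g \<in> extensional (carr W) \<and> linear_map W W g \<and>
        (\<forall>x\<in>carr W. \<forall>y\<in>carr W. bform W x y = bform W y (g x))"
    show "g = ?f"
    proof (rule extensionalityI[of _ "carr W"])
      fix v assume v: "v \<in> carr W"
      have mem: "g v \<in> carr W" "f v \<in> carr W" using g f v by (auto simp: linear_on_def)
      have "bform W w (g v - f v) = 0" if w: "w \<in> carr W" for w
      proof -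
        have "bform W w (g v) = bform W v w" using g v w by simp
        also have "\<dots> = bform W w (f v)" by (rule adj[OF v w])
        finally show ?thesis using bdiff[OF w mem] by simp
      qed
      then have "g v - f v = 0"
        using W(2) subspace_diff[OF sub mem] unfolding nondegenerate_def by blast
      then show "g v = ?f v" using v by simp
    qed (use g in auto)
  qed
  then show ?thesis using x by simp
qed

lemma nondegenerate_matrix_space:
  fixes M :: "'k::field ^ 'n ^ 'n"
  assumes "invertible M"
  shows "nondegenerate (matrix_space M)"
proof -
  obtain R where R: "M ** R = mat 1" "R ** M = mat 1" using assms by (auto simp: invertible_def)
  have ax: "(\<Sum>i\<in>UNIV. x $ i * axis k 1 $ i) = x $ k" "(\<Sum>i\<in>UNIV. axis k 1 $ i * x $ i) = x $ k"
    for x :: "'k ^ 'n" and k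
    by (simp_all add: axis_def if_distrib[of "\<lambda>z. _ * z"] if_distrib[of "\<lambda>z. z * _"] cong: if_cong)
  show ?thesis
    unfolding nondegenerate_def matrix_space_simps
  proof (intro conjI ballI impI)
    fix x :: "'k ^ 'n" assume x: "\<forall>y\<in>UNIV. bform (matrix_space M) x y = 0"
    have "x $ k = 0" for k
      using bspec[OF x, of "R *v axis k 1"] by (simp add: bform_matrix_space matrix_vector_mul_assoc R ax)
    then show "x = 0" by (simp add: vec_eq_iff)
  next
    fix y :: "'k ^ 'n" assume y: "\<forall>x\<in>UNIV. bform (matrix_space M) x y = 0"
    have "(M *v y) $ k = 0" for k
      using bspec[OF y, of "axis k 1"] by (simp add: bform_matrix_space ax)
    then have "M *v y = 0" by (simp add: vec_eq_iff)
    then have "R *v (M *v y) = 0" by simp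
    then show "y = 0" by (simp add: matrix_vector_mul_assoc R)
  qed
qed

lemma bform_matrix_adjoint:
  assumes "M ** A = transpose M"
  shows "bform (matrix_space M) x y = bform (matrix_space M) y (A *v x)"
proof -
  have "bform (matrix_space M) x y = (\<Sum>i\<in>UNIV. (M *v y) $ i * x $ i)"
    unfolding bform_matrix_space by (simp only: mult.commute)
  also have "\<dots> = bform (matrix_space M) y (A *v x)"
    unfolding bform_matrix_space sum_matrix_vector_transpose matrix_vector_mul_assoc assms ..
  finally show ?thesis .
qed

lemma asymmetry_matrix_space:
  fixes M :: "'k::field ^ 'n ^ 'n"
  assumes "invertible M" "M ** A = transpose M"
  shows "asymmetry (matrix_space M) = (*v) A"
proof
  fix x
  show "asymmetry (matrix_space M) x = A *v x"
  proof (rule asymmetry_eqI[OF bilinear_space_matrix_space nondegenerate_matrix_space[OF assms(1)]])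
    show "linear_on (scal (matrix_space M)) (carr (matrix_space M)) (scal (matrix_space M)) (carr (matrix_space M)) ((*v) A)"
      by (simp add: linear_on_def matrix_vector_right_distrib vector_scalar_commute)
  qed (rule bform_matrix_adjoint[OF assms(2)], simp)
qed

definition asym_matrix :: "'k::field \<Rightarrow> 'k ^ 2 ^ 2" where
  "asym_matrix a = vector [vector [a - 1, - 1], vector [2 - a, 1]]"

lemma b_matrix_asym_matrix: "a \<noteq> 2 \<Longrightarrow> b_matrix a ** asym_matrix a = transpose (b_matrix a)"
  by (simp add: mat2_simps b_matrix_def asym_matrix_def)

lemma matrix_delta:
  assumes "a \<noteq> 2"
  shows "matrix (delta a) = delta_matrix a"
proof -
  have D: "delta_matrix a = 2 \<cdot>\<^sub>m asym_matrix a - a \<cdot>\<^sub>m mat 1"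
    by (simp add: mat2_simps delta_matrix_def asym_matrix_def)
  have "delta a = (*v) (delta_matrix a)"
  proof
    fix x
    show "delta a x = delta_matrix a *v x"
      unfolding delta_def asymmetry_matrix_space[OF invertible_b_matrix[OF assms] b_matrix_asym_matrix[OF assms]]
        D matrix_vector_mult_diff_rdistrib smult_mat_vector matrix_vector_mul_lid ..
  qed
  then show ?thesis by (simp only: matrix_of_matrix_vector_mul)
qed

section \<open>Scalar extension and twisted forms\<close>

context
  fixes \<iota> :: "'f::field \<Rightarrow> 'e::field"
  assumes emb: "field_embedding \<iota>"
begin

lemmas emb_simps = field_embedding_simps[OF emb]

lemma emb_2: "\<iota> 2 = 2"
proof -
  have "\<iota> (1 + 1) = 1 + 1" by (simp only: emb_simps)
  then show ?thesis by simp
qed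

lemma emb_4: "\<iota> 4 = 4"
proof -
  have "\<iota> (2 + 2) = 2 + 2" by (simp only: emb_simps(3) emb_2)
  then show ?thesis by simp
qed

lemma emb_alpha: "\<iota> (alpha a) = alpha (\<iota> a)"
  by (simp add: alpha_def emb_simps emb_4)

lemma map_matrix_kron:
  "map_matrix \<iota> (kron M N) = kron (map_matrix \<iota> M) (map_matrix \<iota> N)"
  by (simp add: vec_eq_iff kron_def map_matrix_def emb_simps)

lemma map_matrix_b_matrix: "map_matrix \<iota> (b_matrix a) = b_matrix (\<iota> a)"
  by (simp add: vec_eq_iff forall_2 vector_2 b_matrix_def map_matrix_def emb_simps emb_2)

lemma map_matrix_delta_matrix: "map_matrix \<iota> (delta_matrix a) = delta_matrix (\<iota> a)"
  by (simp add: vec_eq_iff forall_2 vector_2 delta_matrix_def map_matrix_def emb_simps emb_2 emb_4)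

lemma VE_eq: "VE \<iota> a1 a2 = matrix_space (form_matrix (\<iota> a1) (\<iota> a2))"
  by (simp add: VE_def map_matrix_kron map_matrix_b_matrix)

lemma u_endo_eq:
  assumes "a1 \<noteq> 2" "a2 \<noteq> 2"
  shows "u_endo \<iota> a1 a2 (r, s) = (*v) (r \<cdot>\<^sub>m mat 1 + s \<cdot>\<^sub>m theta_matrix (\<iota> a1) (\<iota> a2))"
  by (rule ext) (simp only: u_endo.simps matrix_delta[OF assms(1)] matrix_delta[OF assms(2)] map_matrix_kron
      map_matrix_delta_matrix matrix_vector_mult_add_rdistrib smult_mat_vector matrix_vector_mul_lid)

text \<open>The inverse of u is (r - s\<theta>)/N(u), so up to the scalar 1/N(u) the twisted form is
  b(x, (r - s\<theta>)y), which is polynomial in \<theta>.\<close>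

lemma twisted_space_eq:
  assumes a: "a1 \<noteq> 2" "a2 \<noteq> 2" and n: "qnorm (\<iota> (alpha a1 * alpha a2)) (r, s) \<noteq> 0"
  shows "twisted_space \<iota> a1 a2 (r, s) = matrix_space (inverse (qnorm (\<iota> (alpha a1 * alpha a2)) (r, s)) \<cdot>\<^sub>m
    (form_matrix (\<iota> a1) (\<iota> a2) **
     (r \<cdot>\<^sub>m mat 1 - s \<cdot>\<^sub>m theta_matrix (\<iota> a1) (\<iota> a2))))"
proof -
  let ?T = "theta_matrix (\<iota> a1) (\<iota> a2)"
  let ?B = "form_matrix (\<iota> a1) (\<iota> a2)"
  let ?n = "qnorm (\<iota> (alpha a1 * alpha a2)) (r, s)"
  let ?U = "r \<cdot>\<^sub>m mat 1 + s \<cdot>\<^sub>m ?T" and ?V = "inverse ?n \<cdot>\<^sub>m (r \<cdot>\<^sub>m mat 1 - s \<cdot>\<^sub>m ?T)"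
  have TT: "?T ** ?T = (\<iota> (alpha a1 * alpha a2)) \<cdot>\<^sub>m mat 1"
    unfolding kron_mult delta_matrix_square kron_smult kron_mat_1 smult_mat_smult_mat emb_simps(4) emb_alpha
    by (simp only: mult.commute)
  have p: "?U ** (r \<cdot>\<^sub>m mat 1 - s \<cdot>\<^sub>m ?T) = ?n \<cdot>\<^sub>m mat 1" "(r \<cdot>\<^sub>m mat 1 - s \<cdot>\<^sub>m ?T) ** ?U = ?n \<cdot>\<^sub>m mat 1"
    unfolding matrix_ring_distribs smult_mat_mult TT matrix_mul_lid matrix_mul_rid smult_mat_smult_mat qnorm_eq
    by (simp_all add: vec_eq_iff algebra_simps power2_eq_square)
  have UV: "?U ** ?V = mat 1" "?V ** ?U = mat 1"
    unfolding smult_mat_mult p smult_mat_smult_mat using n by simp_all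
  have "inv_into UNIV (u_endo \<iota> a1 a2 (r, s)) = (*v) ?V"
    unfolding u_endo_eq[OF a]
    by (rule inv_equality) (simp_all only: matrix_vector_mul_assoc UV matrix_vector_mul_lid)
  then have "twisted_space \<iota> a1 a2 (r, s) = (matrix_space ?B) \<lparr>bform := \<lambda>x y. bform (matrix_space ?B) x (?V *v y)\<rparr>"
    unfolding twisted_space_def VE_eq by (simp only:)
  also have "\<dots> = matrix_space (inverse ?n \<cdot>\<^sub>m (?B ** (r \<cdot>\<^sub>m mat 1 - s \<cdot>\<^sub>m ?T)))"
  proof -
    have "bform (matrix_space ?B) x (?V *v y) =
        bform (matrix_space (inverse ?n \<cdot>\<^sub>m (?B ** (r \<cdot>\<^sub>m mat 1 - s \<cdot>\<^sub>m ?T)))) x y" for x y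
      unfolding bform_matrix_space matrix_vector_mul_assoc smult_mat_mult ..
    then have "(\<lambda>x y. bform (matrix_space ?B) x (?V *v y)) =
        bform (matrix_space (inverse ?n \<cdot>\<^sub>m (?B ** (r \<cdot>\<^sub>m mat 1 - s \<cdot>\<^sub>m ?T))))" by (intro ext)
    then show ?thesis by (simp only:) (simp only: matrix_space_def bilin.simps)
  qed
  finally show ?thesis .
qed

end

section \<open>Units of K_E and their norms\<close>

lemma qunit_imp_qnorm_nonzero:
  assumes "qunit d u"
  shows "qnorm d u \<noteq> 0"
proof -
  obtain v where v: "qmult d u v = (1, 0)" using assms by (auto simp: qunit_def)
  obtain r s r' s' where uv: "u = (r, s)" "v = (r', s')" by (cases u, cases v)
  have "r * r' + d * s * s' = 1" "r * s' + s * r' = 0" using v by (simp_all add: uv)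
  then have "(r * r' + d * s * s')\<^sup>2 - d * (r * s' + s * r')\<^sup>2 = 1" by simp
  then have "(r\<^sup>2 - d * s\<^sup>2) * (r'\<^sup>2 - d * s'\<^sup>2) = 1" by (simp add: power2_eq_square algebra_simps)
  then show ?thesis unfolding uv qnorm_eq by auto
qed

lemma qunitI:
  assumes "qnorm d (r, s) \<noteq> 0"
  shows "qunit d (r, s)"
proof -
  let ?n = "r\<^sup>2 - d * s\<^sup>2"
  have "?n \<noteq> 0" using assms unfolding qnorm_eq .
  then have "qmult d (r, s) (r / ?n, - s / ?n) = (1, 0)"
    by (simp add: power2_eq_square diff_divide_distrib[symmetric] mult_ac)
  then show ?thesis unfolding qunit_def by blast
qed

section \<open>Decomposability and Kronecker products\<close>

lemma linear_on_mem: "linear_on s V s' V' f \<Longrightarrow> x \<in> V \<Longrightarrow> f x \<in> V'"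
  and linear_on_add: "linear_on s V s' V' f \<Longrightarrow> x \<in> V \<Longrightarrow> y \<in> V \<Longrightarrow> f (x + y) = f x + f y"
  and linear_on_scale: "linear_on s V s' V' f \<Longrightarrow> x \<in> V \<Longrightarrow> f (s c x) = s' c (f x)"
  by (auto simp: linear_on_def)

lemma linear_onI:
  "(\<And>x. x \<in> V \<Longrightarrow> f x \<in> V') \<Longrightarrow> (\<And>x y. x \<in> V \<Longrightarrow> y \<in> V \<Longrightarrow> f (x + y) = f x + f y) \<Longrightarrow>
    (\<And>c x. x \<in> V \<Longrightarrow> f (s c x) = s' c (f x)) \<Longrightarrow> linear_on s V s' V' f"
  by (simp add: linear_on_def)

lemma linear_on_comp:
  assumes "linear_on s V s' V' f" "linear_on s' V' s'' V'' g"
  shows "linear_on s V s'' V'' (\<lambda>x. g (f x))"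
  by (intro linear_onI) (simp_all add: linear_on_mem[OF assms(1)] linear_on_mem[OF assms(2)]
      linear_on_add[OF assms(1)] linear_on_add[OF assms(2)] linear_on_scale[OF assms(1)] linear_on_scale[OF assms(2)])

lemma linear_on_restrict:
  assumes "linear_on s V s' V' f" "\<And>x y. x \<in> V \<Longrightarrow> y \<in> V \<Longrightarrow> x + y \<in> V" "\<And>c x. x \<in> V \<Longrightarrow> s c x \<in> V"
  shows "linear_on s V s' V' (restrict f V)"
  using assms by (simp add: linear_on_def)

lemma bilinear_space_add: "bilinear_space W \<Longrightarrow> x \<in> carr W \<Longrightarrow> y \<in> carr W \<Longrightarrow> x + y \<in> carr W"
  and bilinear_space_scale: "bilinear_space W \<Longrightarrow> x \<in> carr W \<Longrightarrow> scal W c x \<in> carr W"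
  and bilinear_space_zero: "bilinear_space W \<Longrightarrow> 0 \<in> carr W"
  unfolding bilinear_space_def using module.subspace_add module.subspace_scale module.subspace_0
    module_iff_vector_space by metis+

lemma linear_iso_inv:
  assumes W: "bilinear_space W" and f: "linear_iso W W' f"
  shows "linear_iso W' W (inv_into (carr W) f)"
    "x \<in> carr W \<Longrightarrow> inv_into (carr W) f (f x) = x" "y \<in> carr W' \<Longrightarrow> f (inv_into (carr W) f y) = y"
proof -
  let ?g = "inv_into (carr W) f"
  have lin: "linear_map W W' f" and bij: "bij_betw f (carr W) (carr W')"
    using f by (auto simp: linear_iso_def)
  have gf: "?g (f x) = x" if "x \<in> carr W" for x using bij that by (rule bij_betw_inv_into_left)
  have fg: "f (?g y) = y" if "y \<in> carr W'" for y using bij that by (rule bij_betw_inv_into_right)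
  have bij': "bij_betw ?g (carr W') (carr W)" using bij by (rule bij_betw_inv_into)
  have mem: "?g y \<in> carr W" if "y \<in> carr W'" for y using bij' that by (auto simp: bij_betw_def)
  have "linear_map W' W ?g"
  proof (rule linear_onI)
    fix x y assume xy: "x \<in> carr W'" "y \<in> carr W'"
    have "f (?g x + ?g y) = x + y" using linear_on_add[OF lin mem mem] xy fg by simp
    then show "?g (x + y) = ?g x + ?g y" using gf bilinear_space_add[OF W mem mem] xy by metis
  next
    fix c x assume x: "x \<in> carr W'"
    have "f (scal W c (?g x)) = scal W' c x" using linear_on_scale[OF lin mem] x fg by simp
    then show "?g (scal W' c x) = scal W c (?g x)" using gf bilinear_space_scale[OF W mem] x by metis
  qed (rule mem)
  then show "linear_iso W' W ?g" using bij' by (simp add: linear_iso_def)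
  show "x \<in> carr W \<Longrightarrow> ?g (f x) = x" "y \<in> carr W' \<Longrightarrow> f (?g y) = y" using gf fg by auto
qed

text \<open>A bilinear map on the new factors is pulled back along the inverse isomorphisms,
  factored through W, and the functional is carried over to W'. This moves a Kronecker product from
  column vectors to the ambient spaces used in \<open>decomposable\<close>.\<close>

lemma is_tensor_product_transport:
  assumes tp: "is_tensor_product W1 W2 W t"
    and bs: "bilinear_space W1'" "bilinear_space W2'" "bilinear_space W" "bilinear_space W'"
    and f1: "linear_iso W1' W1 f1" "\<And>x y. x \<in> carr W1' \<Longrightarrow> y \<in> carr W1' \<Longrightarrow> bform W1 (f1 x) (f1 y) = bform W1' x y"
    and f2: "linear_iso W2' W2 f2" "\<And>x y. x \<in> carr W2' \<Longrightarrow> y \<in> carr W2' \<Longrightarrow> bform W2 (f2 x) (f2 y) = bform W2' x y"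
    and f: "linear_iso W W' f" "\<And>x y. x \<in> carr W \<Longrightarrow> y \<in> carr W \<Longrightarrow> bform W' (f x) (f y) = bform W x y"
  shows "is_tensor_product W1' W2' W' (\<lambda>x y. f (t (f1 x) (f2 y)))"
proof -
  have lin1: "linear_map W1' W1 f1"
    and lin2: "linear_map W2' W2 f2"
    and lin: "linear_map W W' f"
    using f1(1) f2(1) f(1) by (auto simp: linear_iso_def)
  define g1 g2 g where "g1 = inv_into (carr W1') f1" and "g2 = inv_into (carr W2') f2" and "g = inv_into (carr W) f"
  have g1: "linear_map W1 W1' g1" "\<And>x. x \<in> carr W1' \<Longrightarrow> g1 (f1 x) = x"
    "\<And>x. x \<in> carr W1 \<Longrightarrow> f1 (g1 x) = x"
    using linear_iso_inv[OF bs(1) f1(1)] by (simp_all add: linear_iso_def g1_def)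
  have g2: "linear_map W2 W2' g2" "\<And>x. x \<in> carr W2' \<Longrightarrow> g2 (f2 x) = x"
    "\<And>x. x \<in> carr W2 \<Longrightarrow> f2 (g2 x) = x"
    using linear_iso_inv[OF bs(2) f2(1)] by (simp_all add: linear_iso_def g2_def)
  have g: "linear_map W' W g" "\<And>x. x \<in> carr W \<Longrightarrow> g (f x) = x"
    "\<And>x. x \<in> carr W' \<Longrightarrow> f (g x) = x"
    using linear_iso_inv[OF bs(3) f(1)] by (simp_all add: linear_iso_def g_def)
  have t1: "linear_map W2 W (t x)" if "x \<in> carr W1" for x
    using tp that by (simp add: is_tensor_product_def bilinear_on_def)
  have t2: "linear_map W1 W (\<lambda>x. t x y)" if "y \<in> carr W2" for y
    using tp that by (simp add: is_tensor_product_def bilinear_on_def)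
  have tm: "t x y \<in> carr W" if "x \<in> carr W1" "y \<in> carr W2" for x y
    using linear_on_mem[OF t1] that .
  have form: "bform W (t x y) (t x' y') = bform W1 x x' * bform W2 y y'"
    if "x \<in> carr W1" "x' \<in> carr W1" "y \<in> carr W2" "y' \<in> carr W2" for x x' y y'
    using tp that by (simp add: is_tensor_product_def)
  have "bilinear_on (scal W1') (carr W1') (scal W2') (carr W2') (scal W') (carr W') (\<lambda>x y. f (t (f1 x) (f2 y)))"
    unfolding bilinear_on_def
  proof (intro conjI ballI)
    fix x assume "x \<in> carr W1'"
    then show "linear_map W2' W' (\<lambda>y. f (t (f1 x) (f2 y)))"
      by (intro linear_on_comp[OF lin2 linear_on_comp[OF t1 lin]] linear_on_mem[OF lin1])
  next
    fix y assume "y \<in> carr W2'"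
    then show "linear_map W1' W' (\<lambda>x. f (t (f1 x) (f2 y)))"
      by (intro linear_on_comp[OF lin1 linear_on_comp[OF t2 lin]] linear_on_mem[OF lin2])
  qed
  moreover have "\<exists>!k. k \<in> extensional (carr W') \<and> linear_functional W' k \<and>
      (\<forall>x\<in>carr W1'. \<forall>y\<in>carr W2'. k (f (t (f1 x) (f2 y))) = \<beta> x y)"
    if \<beta>: "bilinear_on (scal W1') (carr W1') (scal W2') (carr W2') (*) UNIV \<beta>" for \<beta>
  proof -
    have b1: "linear_functional W2' (\<beta> x)" if "x \<in> carr W1'" for x
      using \<beta> that by (simp add: bilinear_on_def)
    have b2: "linear_functional W1' (\<lambda>x. \<beta> x y)" if "y \<in> carr W2'" for y
      using \<beta> that by (simp add: bilinear_on_def)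
    let ?b = "\<lambda>x y. \<beta> (g1 x) (g2 y)"
    have "bilinear_on (scal W1) (carr W1) (scal W2) (carr W2) (*) UNIV ?b"
      unfolding bilinear_on_def
    proof (intro conjI ballI)
      fix x assume "x \<in> carr W1"
      then show "linear_functional W2 (\<lambda>y. \<beta> (g1 x) (g2 y))"
        by (intro linear_on_comp[OF g2(1) b1] linear_on_mem[OF g1(1)])
    next
      fix y assume "y \<in> carr W2"
      then show "linear_functional W1 (\<lambda>x. \<beta> (g1 x) (g2 y))"
        by (intro linear_on_comp[OF g1(1) b2] linear_on_mem[OF g2(1)])
    qed
    then have "\<exists>!h. h \<in> extensional (carr W) \<and> linear_functional W h \<and>
        (\<forall>x\<in>carr W1. \<forall>y\<in>carr W2. h (t x y) = ?b x y)"
      using tp unfolding is_tensor_product_def by blast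
    then obtain h where h: "linear_functional W h"
      "\<And>x y. x \<in> carr W1 \<Longrightarrow> y \<in> carr W2 \<Longrightarrow> h (t x y) = ?b x y"
      and uniq: "\<And>k. k \<in> extensional (carr W) \<Longrightarrow> linear_functional W k \<Longrightarrow>
        (\<And>x y. x \<in> carr W1 \<Longrightarrow> y \<in> carr W2 \<Longrightarrow> k (t x y) = ?b x y) \<Longrightarrow> k = h"
      by (elim ex1E) (metis (no_types, lifting))
    show ?thesis
    proof (rule ex1I)
      \<comment> \<open>Functionals are unique only as extensional maps, hence the restriction to
        the carrier here and for \<open>?k\<close>.\<close>
      let ?h = "restrict (\<lambda>w. h (g w)) (carr W')"
      have "linear_functional W' ?h"
        using linear_on_comp[OF g(1) h(1)] bilinear_space_add[OF bs(4)] bilinear_space_scale[OF bs(4)]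
        by (rule linear_on_restrict)
      moreover have "?h (f (t (f1 x) (f2 y))) = \<beta> x y" if "x \<in> carr W1'" "y \<in> carr W2'" for x y
        using that linear_on_mem[OF lin1] linear_on_mem[OF lin2] linear_on_mem[OF lin tm] tm
        by (simp add: g(2) h(2) g1(2) g2(2))
      ultimately show "?h \<in> extensional (carr W') \<and> linear_functional W' ?h \<and>
          (\<forall>x\<in>carr W1'. \<forall>y\<in>carr W2'. ?h (f (t (f1 x) (f2 y))) = \<beta> x y)" by simp
      fix k assume k: "k \<in> extensional (carr W') \<and> linear_functional W' k \<and>
          (\<forall>x\<in>carr W1'. \<forall>y\<in>carr W2'. k (f (t (f1 x) (f2 y))) = \<beta> x y)"
      let ?k = "restrict (\<lambda>w. k (f w)) (carr W)"
      have "?k = h"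
      proof (rule uniq)
        have "linear_functional W' k" using k by blast
        from linear_on_comp[OF lin this] bilinear_space_add[OF bs(3)] bilinear_space_scale[OF bs(3)]
        show "linear_functional W ?k" by (rule linear_on_restrict)
        fix x y assume xy: "x \<in> carr W1" "y \<in> carr W2"
        have "k (f (t (f1 (g1 x)) (f2 (g2 y)))) = \<beta> (g1 x) (g2 y)"
          using k linear_on_mem[OF g1(1) xy(1)] linear_on_mem[OF g2(1) xy(2)] by blast
        then show "?k (t x y) = \<beta> (g1 x) (g2 y)" using tm[OF xy] xy by (simp add: g1(3) g2(3))
      qed simp
      then have "k (f w) = h w" if "w \<in> carr W" for w using that by (metis restrict_apply')
      then have "k w = h (g w)" if "w \<in> carr W'" for w using g(3)[OF that] linear_on_mem[OF g(1) that] by metis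
      then show "k = ?h" using k by (intro extensionalityI[of k "carr W'"]) auto
    qed
  qed
  moreover have "bform W' (f (t (f1 x) (f2 y))) (f (t (f1 x') (f2 y'))) = bform W1' x x' * bform W2' y y'"
    if "x \<in> carr W1'" "x' \<in> carr W1'" "y \<in> carr W2'" "y' \<in> carr W2'" for x x' y y'
    using that linear_on_mem[OF lin1] linear_on_mem[OF lin2] tm by (simp add: f(2) form f1(2) f2(2))
  ultimately show ?thesis unfolding is_tensor_product_def by blast
qed

text \<open>A copy of (k^2, M) among the sequences supported on {0, 1}, since
  \<open>decomposable\<close> seeks its factors among sequences.\<close>

definition seq_space :: "'k::field ^ 2 ^ 2 \<Rightarrow> ('k, nat \<Rightarrow> 'k) bilin" where
  "seq_space M = \<lparr>scal = (\<lambda>c f i. c * f i), carr = {f. \<forall>i\<ge>2. f i = 0},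
     bform = (\<lambda>f g. bform (matrix_space M) (vector [f 0, f 1]) (vector [g 0, g 1]))\<rparr>"

lemma seq_space:
  fixes M :: "'k::field ^ 2 ^ 2"
  shows "bilinear_space (seq_space M)" "bdim (seq_space M) = 2"
    "linear_iso (seq_space M) (matrix_space M) (\<lambda>f. vector [f 0, f 1])"
    "bform (matrix_space M) (vector [f 0, f 1]) (vector [g 0, g 1]) = bform (seq_space M) f g"
proof -
  let ?s = "\<lambda>c (f :: nat \<Rightarrow> 'k) i. c * f i"
  let ?v = "\<lambda>f :: nat \<Rightarrow> 'k. vector [f 0, f 1] :: 'k ^ 2"
  let ?V = "{f :: nat \<Rightarrow> 'k. \<forall>i\<ge>2. f i = 0}"
  interpret vector_space ?s by standard (auto simp: fun_eq_iff algebra_simps)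
  define e0 e1 :: "nat \<Rightarrow> 'k" where "e0 = (\<lambda>i. if i = 0 then 1 else 0)" and "e1 = (\<lambda>i. if i = 1 then 1 else 0)"
  have V: "?V = span {e0, e1}"
  proof
    show "?V \<subseteq> span {e0, e1}"
    proof
      fix f assume f: "f \<in> ?V"
      have "f = ?s (f 0) e0 + ?s (f 1) e1"
      proof
        fix i :: nat
        consider "i = 0" | "i = 1" | "i \<ge> 2" by linarith
        then show "f i = (?s (f 0) e0 + ?s (f 1) e1) i" using f by cases (auto simp: e0_def e1_def)
      qed
      then show "f \<in> span {e0, e1}" by (metis insertCI span_add span_base span_scale)
    qed
    have "subspace ?V" by (auto simp: subspace_def)
    moreover have "{e0, e1} \<subseteq> ?V" by (auto simp: e0_def e1_def)
    ultimately show "span {e0, e1} \<subseteq> ?V" by (rule span_minimal[rotated])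
  qed
  have "e0 \<notin> span {e1}"
  proof
    assume "e0 \<in> span {e1}"
    then obtain k where "e0 = ?s k e1" by (auto simp: span_singleton)
    then have "e0 0 = ?s k e1 0" by (rule fun_cong)
    then show False by (simp add: e0_def e1_def)
  qed
  moreover have "e1 \<noteq> 0" by (auto simp: fun_eq_iff e1_def intro!: exI[of _ 1])
  moreover have "e0 \<noteq> e1" by (auto simp: fun_eq_iff e0_def e1_def intro!: exI[of _ 0])
  ultimately have ind: "independent {e0, e1}" and c: "card {e0, e1} = 2"
    by (simp_all add: independent_insert)
  have add: "?v (f + g) = ?v f + ?v g" and sc: "?v (?s a f) = a *s ?v f" for f g a
    by (simp_all add: vec_eq_iff forall_2 vector_2)
  have B: "linear_on (*s) UNIV (*) UNIV (bform (matrix_space M) x)"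
    "linear_on (*s) UNIV (*) UNIV (\<lambda>x. bform (matrix_space M) x y)" for x y
    using bilinear_space_matrix_space[of M] by (auto simp: bilinear_space_def bilinear_on_def)
  have lv: "linear_on ?s ?V (*s) UNIV ?v" by (intro linear_onI) (simp_all only: add sc UNIV_I)
  have "bilinear_on ?s ?V ?s ?V (*) UNIV (\<lambda>f g. bform (matrix_space M) (?v f) (?v g))"
    unfolding bilinear_on_def
  proof (intro conjI ballI)
    fix f
    show "linear_on ?s ?V (*) UNIV (\<lambda>g. bform (matrix_space M) (?v f) (?v g))"
      by (rule linear_on_comp[OF lv B(1)])
    show "linear_on ?s ?V (*) UNIV (\<lambda>g. bform (matrix_space M) (?v g) (?v f))"
      by (rule linear_on_comp[OF lv B(2)])
  qed
  then show "bilinear_space (seq_space M)"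
    unfolding bilinear_space_def seq_space_def bilin.simps
    using vector_space_axioms subspace_span[of "{e0, e1}"] V by (intro conjI exI[of _ "{e0, e1}"]) simp_all
  show "bdim (seq_space M) = 2"
    unfolding bdim_def seq_space_def bilin.simps V using dim_span_eq_card_independent[OF ind] c by simp
  have "bij_betw ?v ?V UNIV"
  proof (rule bij_betwI')
    fix f g assume fg: "f \<in> ?V" "g \<in> ?V"
    show "?v f = ?v g \<longleftrightarrow> f = g"
    proof
      assume "?v f = ?v g"
      then have 01: "f 0 = g 0" "f 1 = g 1" by (simp_all add: vec_eq_iff forall_2 vector_2)
      show "f = g"
      proof
        fix i :: nat
        consider "i = 0" | "i = 1" | "i \<ge> 2" by linarith
        then show "f i = g i" using fg 01 by cases auto
      qed
    qed simp
  next
    fix w :: "'k ^ 2"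
    show "\<exists>f\<in>?V. w = ?v f"
      by (rule bexI[of _ "\<lambda>i. if i = 0 then w $ 1 else if i = 1 then w $ 2 else 0"])
         (simp_all add: vec_eq_iff forall_2 vector_2)
  qed simp
  then show "linear_iso (seq_space M) (matrix_space M) ?v"
    using lv by (simp add: linear_iso_def seq_space_def)
  show "bform (matrix_space M) (?v f) (?v g) = bform (seq_space M) f g" by (simp add: seq_space_def)
qed

text \<open>The scalar of the similitude is absorbed into the first factor, which turns the
  similitude into an isometry.\<close>

lemma similar_kron_imp_decomposable:
  fixes M N :: "'k::field ^ 2 ^ 2"
  assumes W: "bilinear_space W" and sim: "similar W (matrix_space (kron M N))"
  shows "decomposable W"
proof -
  obtain \<phi> c where \<phi>: "c \<noteq> 0" "linear_iso W (matrix_space (kron M N)) \<phi>"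
    "\<forall>x\<in>carr W. \<forall>y\<in>carr W. bform (matrix_space (kron M N)) (\<phi> x) (\<phi> y) = c * bform W x y"
    using sim by (auto simp: similar_def)
  let ?M = "inverse c \<cdot>\<^sub>m M" and ?g = "inv_into (carr W) \<phi>"
  have iso: "linear_iso (matrix_space (kron ?M N)) W ?g"
    using linear_iso_inv(1)[OF W \<phi>(2)] by (simp add: linear_iso_def)
  have mem: "?g x \<in> carr W" "\<phi> (?g x) = x" for x
    using linear_iso_inv(1,3)[OF W \<phi>(2)] by (simp_all add: linear_iso_def linear_on_def)
  have form: "bform W (?g x) (?g y) = bform (matrix_space (kron ?M N)) x y" for x y
  proof -
    have "bform (matrix_space (kron M N)) x y = c * bform W (?g x) (?g y)"
      using \<phi>(3) mem by metis
    then show ?thesis unfolding kron_smult bform_smult_mat using \<phi>(1) by simp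
  qed
  have "is_tensor_product (seq_space ?M) (seq_space N) W
      (\<lambda>x y. ?g (elem_tensor (vector [x 0, x 1]) (vector [y 0, y 1])))"
    by (rule is_tensor_product_transport[OF is_tensor_product_kron seq_space(1) seq_space(1)
        bilinear_space_matrix_space W seq_space(3) seq_space(4) seq_space(3) seq_space(4) iso form])
  moreover have "bilinear_space (seq_space ?M)" "bilinear_space (seq_space N)"
    "bdim (seq_space ?M) \<ge> 2" "bdim (seq_space N) \<ge> 2" by (simp_all only: seq_space)
  ultimately show ?thesis unfolding decomposable_def by blast
qed

text \<open>Two vectors of a basis, with their coordinates as functionals. The functionals later
  witness the independence of products of such vectors.\<close>

lemma coordinate_functionals:
  fixes W :: "('k::field, 'v::ab_group_add) bilin"
  assumes W: "bilinear_space W" and dim: "bdim W \<ge> 2"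
  shows "\<exists>(x :: 2 \<Rightarrow> 'v) co. (\<forall>i. x i \<in> carr W) \<and> (\<forall>i. linear_functional W (co i)) \<and>
    (\<forall>i k. co i (x k) = (if i = k then 1 else 0))"
proof -
  interpret vector_space "scal W" using W by (simp add: bilinear_space_def)
  have sub: "subspace (carr W)" using W by (simp add: bilinear_space_def)
  obtain B where B: "B \<subseteq> carr W" "independent B" "carr W \<subseteq> span B" "card B = dim (carr W)"
    by (rule basis_exists)
  have "card B \<ge> 2" using dim B(4) by (simp add: bdim_def)
  then have "finite B" by (metis card.infinite not_numeral_le_zero)
  then obtain x :: "2 \<Rightarrow> 'v" where x: "x ` UNIV \<subseteq> B" "inj x"
    using card_le_inj[of "UNIV :: 2 set" B] \<open>card B \<ge> 2\<close> by auto
  define co where "co i v = representation B v (x i)" for i v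
  have "x i \<in> carr W" for i using x(1) B(1) by blast
  moreover have "linear_functional W (co i)" for i
  proof (rule linear_onI)
    fix v w assume "v \<in> carr W" "w \<in> carr W"
    then show "co i (v + w) = co i v + co i w"
      using B(3) by (simp add: co_def representation_add[OF B(2)] subset_iff)
  next
    fix c v assume "v \<in> carr W"
    then show "co i (scal W c v) = c * co i v"
      using B(3) by (simp add: co_def representation_scale[OF B(2)] subset_iff)
  qed simp
  moreover have "co i (x k) = (if i = k then 1 else 0)" for i k
  proof -
    have "x k \<in> B" using x(1) by blast
    then show ?thesis using x(2) by (simp add: co_def representation_basis[OF B(2)] inj_def)
  qed
  ultimately show ?thesis by blast
qed

lemma linear_on_sum:
  assumes lin: "linear_on s V s' V' f" and V: "0 \<in> V" "\<And>x y. x \<in> V \<Longrightarrow> y \<in> V \<Longrightarrow> x + y \<in> V"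
    and g: "\<And>i. i \<in> A \<Longrightarrow> g i \<in> V"
  shows "f (sum g A) = (\<Sum>i\<in>A. f (g i)) \<and> sum g A \<in> V"
  using g
proof (induction A rule: infinite_finite_induct)
  case (insert i A)
  then show ?case using linear_on_add[OF lin] V(2) by simp
next
  case empty
  have "f (0 + 0) = f 0 + f 0" by (rule linear_on_add[OF lin V(1) V(1)])
  then show ?case using V(1) by simp
next
  case (infinite A)
  have "f (0 + 0) = f 0 + f 0" by (rule linear_on_add[OF lin V(1) V(1)])
  then show ?case using V(1) infinite by simp
qed

text \<open>Two independent vectors from each factor give four independent products in W. As W is
  isomorphic to k^4, the products form a basis, in which the Gram matrix is a Kronecker
  product.\<close>

lemma decomposable_imp_kron:
  fixes W :: "('k::field, 'v::ab_group_add) bilin"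
  assumes W: "bilinear_space W" and dec: "decomposable W"
    and \<phi>: "linear_iso W (matrix_space (B :: 'k ^ (2 \<times> 2) ^ (2 \<times> 2))) \<phi>"
  shows "\<exists>(M :: 'k ^ 2 ^ 2) (N :: 'k ^ 2 ^ 2) \<psi>. linear_iso (matrix_space (kron M N)) W \<psi> \<and>
    (\<forall>v w. bform W (\<psi> v) (\<psi> w) = bform (matrix_space (kron M N)) v w)"
proof -
  obtain W1 W2 :: "('k, nat \<Rightarrow> 'k) bilin" and t where W12: "bilinear_space W1" "bilinear_space W2"
    "bdim W1 \<ge> 2" "bdim W2 \<ge> 2" and tp: "is_tensor_product W1 W2 W t"
    using dec unfolding decomposable_def by blast
  obtain x :: "2 \<Rightarrow> nat \<Rightarrow> 'k" and co1 where x: "\<And>i. x i \<in> carr W1" "\<And>i. linear_functional W1 (co1 i)"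
    "\<And>i k. co1 i (x k) = (if i = k then 1 else (0::'k))"
    using coordinate_functionals[OF W12(1,3)] by blast
  obtain y :: "2 \<Rightarrow> nat \<Rightarrow> 'k" and co2 where y: "\<And>i. y i \<in> carr W2" "\<And>i. linear_functional W2 (co2 i)"
    "\<And>i k. co2 i (y k) = (if i = k then 1 else (0::'k))"
    using coordinate_functionals[OF W12(2,4)] by blast
  have t1: "linear_map W2 W (t z)" if "z \<in> carr W1" for z
    using tp that by (simp add: is_tensor_product_def bilinear_on_def)
  define e where "e p = t (x (fst p)) (y (snd p))" for p
  have em: "e p \<in> carr W" for p using linear_on_mem[OF t1[OF x(1)] y(1)] by (simp add: e_def)
  have form: "bform W (e p) (e q) = bform W1 (x (fst p)) (x (fst q)) * bform W2 (y (snd p)) (y (snd q))" for p q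
    using tp x(1) y(1) by (simp add: is_tensor_product_def e_def)
  \<comment> \<open>The universal property, applied to a product of two coordinate functionals,
    yields functionals dual to the four products.\<close>
  have "\<exists>f. linear_functional W f \<and> (\<forall>q. f (e q) = (if p = q then 1 else 0))" for p
  proof -
    let ?\<beta> = "\<lambda>v w. co1 (fst p) v * co2 (snd p) w"
    have "bilinear_on (scal W1) (carr W1) (scal W2) (carr W2) (*) UNIV ?\<beta>"
      unfolding bilinear_on_def
      by (intro conjI ballI linear_onI)
         (simp_all add: linear_on_add[OF x(2)] linear_on_add[OF y(2)] linear_on_scale[OF x(2)] linear_on_scale[OF y(2)]
           algebra_simps)
    then obtain f where f: "linear_functional W f"
      "\<forall>v\<in>carr W1. \<forall>w\<in>carr W2. f (t v w) = ?\<beta> v w"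
      using tp unfolding is_tensor_product_def by blast
    have "f (e q) = (if p = q then 1 else 0)" for q
      using f(2) x(1,3) y(1,3) by (auto simp: e_def prod_eq_iff)
    then show ?thesis using f(1) by blast
  qed
  then obtain F where F: "\<And>p. linear_functional W (F p)"
    "\<And>p q. F p (e q) = (if p = q then 1 else 0)" by metis
  interpret vector_space "scal W" using W by (simp add: bilinear_space_def)
  define \<psi> where "\<psi> v = (\<Sum>p\<in>UNIV. scal W (v $ p) (e p))" for v :: "'k ^ (2 \<times> 2)"
  note V = bilinear_space_zero[OF W] bilinear_space_add[OF W]
  have sm: "scal W c (e p) \<in> carr W" for c p using bilinear_space_scale[OF W em] .
  have lsum: "f (\<psi> v) = (\<Sum>p\<in>UNIV. v $ p * f (e p))"
    if f: "linear_functional W f" for f v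
    using linear_on_sum[OF f V, of UNIV "\<lambda>p. scal W (v $ p) (e p)"] sm
    by (simp add: \<psi>_def linear_on_scale[OF f em])
  have id: "linear_map W W (\<lambda>z. z)" by (simp add: linear_on_def bilinear_space_scale[OF W])
  have mem: "\<psi> v \<in> carr W" for v
    using linear_on_sum[OF id V, of UNIV "\<lambda>p. scal W (v $ p) (e p)"] sm by (simp add: \<psi>_def)
  have lin: "linear_on (*s) UNIV (scal W) (carr W) \<psi>"
  proof (rule linear_onI)
    show "\<psi> (v + w) = \<psi> v + \<psi> w" for v w by (simp add: \<psi>_def scale_left_distrib sum.distrib)
    show "\<psi> (c *s v) = scal W c (\<psi> v)" for c v by (simp add: \<psi>_def scale_sum_right)
  qed (rule mem)
  have coord: "F p (\<psi> v) = v $ p" for p v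
    unfolding lsum[OF F(1)] F(2) by (simp add: if_distrib[of "\<lambda>z. _ * z"] cong: if_cong)
  have inj: "inj \<psi>" by (rule injI) (metis coord vec_eq_iff)
  have lphi: "linear_on (scal W) (carr W) (*s) UNIV \<phi>" and bphi: "bij_betw \<phi> (carr W) UNIV"
    using \<phi> by (auto simp: linear_iso_def)
  \<comment> \<open>Composing with \<phi> turns \<psi> into an injective endomorphism of k^4, which
    is therefore surjective.\<close>
  have "Vector_Spaces.linear (*s) (*s) (\<lambda>v. \<phi> (\<psi> v))"
    using linear_on_comp[OF lin lphi] by (auto simp: linear_on_def Vector_Spaces.linear_iff vec.vector_space_axioms)
  moreover have "inj (\<lambda>v. \<phi> (\<psi> v))"
    by (rule injI) (use inj_onD[OF bij_betw_imp_inj_on[OF bphi] _ mem mem] injD[OF inj] in blast)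
  ultimately have surj: "surj (\<lambda>v. \<phi> (\<psi> v))" by (rule vec.linear_inj_imp_surj)
  have "carr W \<subseteq> range \<psi>"
  proof
    fix w assume w: "w \<in> carr W"
    obtain v where "\<phi> w = \<phi> (\<psi> v)" using surj by (metis surjD)
    then have "w = \<psi> v" using inj_onD[OF bij_betw_imp_inj_on[OF bphi] _ w mem] by blast
    then show "w \<in> range \<psi>" by blast
  qed
  then have "bij_betw \<psi> UNIV (carr W)" using inj mem by (auto simp: bij_betw_def)
  define M N :: "'k ^ 2 ^ 2" where "M = (\<chi> i k. bform W1 (x i) (x k))" and "N = (\<chi> i k. bform W2 (y i) (y k))"
  have "linear_iso (matrix_space (kron M N)) W \<psi>"
    using \<open>bij_betw \<psi> UNIV (carr W)\<close> lin by (simp add: linear_iso_def)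
  moreover have "bform W (\<psi> v) (\<psi> w) = bform (matrix_space (kron M N)) v w" for v w
  proof -
    have l2: "linear_functional W (bform W z)"
      and l1: "linear_functional W (\<lambda>u. bform W u z)" if "z \<in> carr W" for z
      using W that by (auto simp: bilinear_space_def bilinear_on_def)
    have "bform W (\<psi> v) (\<psi> w) = (\<Sum>p\<in>UNIV. v $ p * (\<Sum>q\<in>UNIV. w $ q * bform W (e p) (e q)))"
      unfolding lsum[OF l1[OF mem]] lsum[OF l2[OF em]] ..
    also have "\<dots> = bform (matrix_space (kron M N)) v w"
      by (simp add: matrix_space_def kron_def M_def N_def form sum_distrib_left mult_ac)
    finally show ?thesis .
  qed
  ultimately show ?thesis by blast
qed

section \<open>Invariants of the asymmetry of a Kronecker product\<close>

text \<open>Q is the matrix of \<open>\<phi> \<circ> \<psi>\<close>: the isometry \<psi> carries A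
  to the asymmetry of W, and \<phi> carries the latter to the asymmetry of B.\<close>

lemma asymmetry_conjugate_matrices:
  fixes K B A A' :: "'k::field ^ 'n ^ 'n"
  assumes W: "bilinear_space W" "nondegenerate W"
    and conj: "asymmetries_conjugate W (matrix_space B)" "invertible B" "B ** A' = transpose B"
    and \<psi>: "linear_iso (matrix_space K) W \<psi>" "\<And>v w. bform W (\<psi> v) (\<psi> w) = bform (matrix_space K) v w"
    and A: "K ** A = transpose K"
  shows "\<exists>Q. invertible Q \<and> Q ** A = A' ** Q"
proof -
  obtain \<phi> where \<phi>: "linear_iso W (matrix_space B) \<phi>"
    "\<forall>x\<in>carr W. \<phi> (asymmetry W x) = asymmetry (matrix_space B) (\<phi> x)"
    using conj(1) by (auto simp: asymmetries_conjugate_def)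
  have lin: "linear_on (*s) UNIV (scal W) (carr W) \<psi>" and bij: "bij_betw \<psi> UNIV (carr W)"
    using \<psi>(1) by (auto simp: linear_iso_def)
  have lphi: "linear_on (scal W) (carr W) (*s) UNIV \<phi>" and bphi: "bij_betw \<phi> (carr W) UNIV"
    using \<phi> by (auto simp: linear_iso_def)
  note mem = linear_on_mem[OF lin UNIV_I]
  let ?g = "inv_into UNIV \<psi>"
  have g: "linear_on (scal W) (carr W) (*s) UNIV ?g" "?g (\<psi> v) = v" "x \<in> carr W \<Longrightarrow> \<psi> (?g x) = x" for v x
    using linear_iso_inv[OF bilinear_space_matrix_space \<psi>(1)] by (simp_all add: linear_iso_def)
  have lA: "linear_on (*s) UNIV (*s) UNIV ((*v) A)"
    by (simp add: linear_on_def matrix_vector_right_distrib vector_scalar_commute)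
  have as: "asymmetry W x = \<psi> (A *v ?g x)" if "x \<in> carr W" for x
    using W linear_on_comp[OF g(1) linear_on_comp[OF lA lin]] _ that
  proof (rule asymmetry_eqI)
    fix x y assume xy: "x \<in> carr W" "y \<in> carr W"
    have "bform W x y = bform (matrix_space K) (?g x) (?g y)" using \<psi>(2)[of "?g x" "?g y"] g(3) xy by simp
    also have "\<dots> = bform (matrix_space K) (?g y) (A *v ?g x)" by (rule bform_matrix_adjoint[OF A])
    also have "\<dots> = bform W y (\<psi> (A *v ?g x))" using \<psi>(2)[of "?g y" "A *v ?g x"] g(3) xy by simp
    finally show "bform W x y = bform W y (\<psi> (A *v ?g x))" .
  qed
  define Q where "Q = matrix (\<lambda>v. \<phi> (\<psi> v))"
  have "Vector_Spaces.linear (*s) (*s) (\<lambda>v. \<phi> (\<psi> v))"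
    using linear_on_comp[OF lin lphi] by (auto simp: linear_on_def Vector_Spaces.linear_iff vec.vector_space_axioms)
  then have Q: "Q *v v = \<phi> (\<psi> v)" for v unfolding Q_def by (rule matrix_works)
  have "inj (\<lambda>v. \<phi> (\<psi> v))"
    by (rule injI) (use inj_onD[OF bij_betw_imp_inj_on[OF bphi] _ mem mem] injD[OF bij_betw_imp_inj_on[OF bij]] in blast)
  then have "inj ((*v) Q)" using Q by (simp add: inj_def)
  then have "invertible Q" using matrix_left_invertible_injective[of Q] invertible_left_inverse[of Q] by blast
  moreover have "Q ** A = A' ** Q"
  proof -
    have "(Q ** A) *v v = (A' ** Q) *v v" for v
    proof -
      have "\<phi> (asymmetry W (\<psi> v)) = A' *v \<phi> (\<psi> v)"
        using \<phi>(2) mem asymmetry_matrix_space[OF conj(2,3)] by metis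
      then show ?thesis unfolding as[OF mem] g(2) matrix_vector_mul_assoc[symmetric] Q .
    qed
    then show ?thesis by (simp add: matrix_eq)
  qed
  ultimately show ?thesis by blast
qed

lemma invertible_isometric_matrix:
  fixes K :: "'k::field ^ 'n ^ 'n"
  assumes W: "nondegenerate W"
    and \<psi>: "linear_iso (matrix_space K) W \<psi>" "\<And>v w. bform W (\<psi> v) (\<psi> w) = bform (matrix_space K) v w"
  shows "invertible K"
proof -
  have lin: "linear_on (*s) UNIV (scal W) (carr W) \<psi>" and bij: "bij_betw \<psi> UNIV (carr W)"
    using \<psi>(1) by (auto simp: linear_iso_def)
  have z: "\<psi> 0 = 0" using linear_on_add[OF lin, of 0 0] by simp
  have "y = 0" if y: "K *v y = 0" for y
  proof -
    have "bform W x (\<psi> y) = 0" if x: "x \<in> carr W" for x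
    proof -
      have "x \<in> range \<psi>" using x unfolding bij_betw_imp_surj_on[OF bij] .
      then obtain v where v: "x = \<psi> v" by (rule rangeE)
      show ?thesis unfolding v \<psi>(2) bform_matrix_space y by simp
    qed
    then have "\<psi> y = 0" using W linear_on_mem[OF lin UNIV_I, of y] unfolding nondegenerate_def by blast
    then show ?thesis using z injD[OF bij_betw_imp_inj_on[OF bij], of y 0] by simp
  qed
  then show ?thesis by (metis matrix_left_invertible_ker invertible_left_inverse)
qed

text \<open>A kernel vector of one factor, tensored with a basis vector, lies in the kernel of the
  product.\<close>

lemma invertible_kron_factors:
  fixes M N :: "'k::field ^ 2 ^ 2"
  assumes "invertible (kron M N)"
  shows "det M \<noteq> 0" "det N \<noteq> 0"
proof -
  have ker: "z = 0" if "kron M N *v z = 0" for z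
    using assms that by (metis matrix_left_invertible_ker invertible_left_inverse)
  have nz: "x = 0 \<or> y = 0" if "elem_tensor x y = 0" for x y :: "'k ^ 2"
    using that by (auto simp: elem_tensor_def vec_eq_iff)
  have ax: "axis 1 1 \<noteq> (0 :: 'k ^ 2)" by (simp add: axis_eq_0_iff)
  have "x = 0" if "M *v x = 0" for x
  proof -
    have "kron M N *v elem_tensor x (axis 1 1) = 0"
      unfolding kron_elem_tensor that by (simp add: elem_tensor_def vec_eq_iff)
    then show ?thesis using nz[OF ker] ax by blast
  qed
  then have "invertible M" by (metis matrix_left_invertible_ker invertible_left_inverse)
  then show "det M \<noteq> 0" by (simp add: invertible_det_nz)
  have "x = 0" if "N *v x = 0" for x
  proof -
    have "kron M N *v elem_tensor (axis 1 1) x = 0"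
      unfolding kron_elem_tensor that by (simp add: elem_tensor_def vec_eq_iff)
    then show ?thesis using nz[OF ker] ax by blast
  qed
  then have "invertible N" by (metis matrix_left_invertible_ker invertible_left_inverse)
  then show "det N \<noteq> 0" by (simp add: invertible_det_nz)
qed

lemma trace_square_2:
  fixes C :: "'k::field ^ 2 ^ 2"
  shows "trace (C ** C) = (trace C)\<^sup>2 - 2 * det C"
  by (simp add: trace_def det_2 sum_2 matrix_matrix_mult_def power2_eq_square algebra_simps)

text \<open>C is the inverse of M times its transpose. Replacing the inverse by the adjugate gives
  det M trace C = 2ps - q^2 - r^2 for the entries p, q, r, s of M, which is 2 det M - (q -
  r)^2.\<close>

lemma asymmetry_2_trace:
  fixes M :: "'k::field ^ 2 ^ 2"
  assumes "det M \<noteq> 0"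
  obtains C where "M ** C = transpose M" "det C = 1" "(M $ 1 $ 2 - M $ 2 $ 1)\<^sup>2 = (2 - trace C) * det M"
proof -
  obtain R where R: "M ** R = mat 1" using assms by (auto simp: invertible_det_nz[symmetric] invertible_def)
  define C where "C = R ** transpose M"
  have C: "M ** C = transpose M" unfolding C_def matrix_mul_assoc R by simp
  have "det M * det C = det M * 1" using arg_cong[OF C, of det] by (simp add: det_mul det_transpose)
  then have "det C = 1" using assms by (metis mult_left_cancel)
  moreover have "(M $ 1 $ 2 - M $ 2 $ 1)\<^sup>2 = (2 - trace C) * det M"
  proof -
    define adj :: "'k ^ 2 ^ 2" where "adj = vector [vector [M $ 2 $ 2, - M $ 1 $ 2], vector [- M $ 2 $ 1, M $ 1 $ 1]]"
    have "adj ** M = det M \<cdot>\<^sub>m mat 1" by (simp add: mat2_simps adj_def det_2 algebra_simps)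
    then have "det M \<cdot>\<^sub>m C = adj ** (M ** C)" by (simp add: matrix_mul_assoc smult_mat_mult)
    also have "\<dots> = adj ** transpose M" unfolding C ..
    finally have "trace (det M \<cdot>\<^sub>m C) = trace (adj ** transpose M)" by simp
    then have "det M * trace C = 2 * (M $ 1 $ 1 * M $ 2 $ 2) - (M $ 1 $ 2)\<^sup>2 - (M $ 2 $ 1)\<^sup>2"
      by (simp add: trace_def sum_2 adj_def matrix_matrix_mult_def transpose_def vector_2 power2_eq_square algebra_simps)
    then show ?thesis by (simp add: det_2 power2_eq_square algebra_simps)
  qed
  ultimately show ?thesis using that C by blast
qed

section \<open>The invariant and decomposability\<close>

text \<open>Expanding \<open>sq\<close> and using \<open>prod\<close> gives c1^2 + c2^2, so the
  squares of c1 + c2 and c1 - c2 are known. The two choices of sign produce the four cases.\<close>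

lemma trace_pair_cases:
  fixes c1 c2 a1 a2 :: "'k::field"
  assumes two: "(2::'k) \<noteq> 0" and prod: "c1 * c2 = a1 * a2"
    and sq: "(c1\<^sup>2 - 2) * (c2\<^sup>2 - 2) = (a1\<^sup>2 - 2) * (a2\<^sup>2 - 2)"
  shows "c1 = a1 \<and> c2 = a2 \<or> c1 = - a1 \<and> c2 = - a2 \<or> c1 = a2 \<and> c2 = a1 \<or> c1 = - a2 \<and> c2 = - a1"
proof -
  have expand: "(x\<^sup>2 - 2) * (y\<^sup>2 - 2) = (x * y)\<^sup>2 - 2 * (x\<^sup>2 + y\<^sup>2) + 4" for x y :: 'k
    by (simp add: power2_eq_square algebra_simps)
  have "2 * (c1\<^sup>2 + c2\<^sup>2) = 2 * (a1\<^sup>2 + a2\<^sup>2)" using sq unfolding expand prod by algebra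
  then have ss: "c1\<^sup>2 + c2\<^sup>2 = a1\<^sup>2 + a2\<^sup>2" using two by (metis mult_left_cancel)
  have "(c1 + c2)\<^sup>2 = (c1\<^sup>2 + c2\<^sup>2) + 2 * (c1 * c2)" by (simp add: power2_eq_square algebra_simps)
  also have "\<dots> = (a1 + a2)\<^sup>2" unfolding ss prod by (simp add: power2_eq_square algebra_simps)
  finally have p: "c1 + c2 = a1 + a2 \<or> c1 + c2 = - (a1 + a2)" by (simp add: power2_eq_iff)
  have "(c1 - c2)\<^sup>2 = (c1\<^sup>2 + c2\<^sup>2) - 2 * (c1 * c2)" by (simp add: power2_eq_square algebra_simps)
  also have "\<dots> = (a1 - a2)\<^sup>2" unfolding ss prod by (simp add: power2_eq_square algebra_simps)
  finally have m: "c1 - c2 = a1 - a2 \<or> c1 - c2 = - (a1 - a2)" by (simp add: power2_eq_iff)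
  have c: "c1 = x \<and> c2 = y" if xy: "c1 + c2 = x + y" "c1 - c2 = x - y" for x y
  proof -
    have "2 * c1 = (c1 + c2) + (c1 - c2)" by simp
    also have "\<dots> = 2 * x" unfolding xy by simp
    finally have "c1 = x" using two by (metis mult_left_cancel)
    then show ?thesis using xy(1) by simp
  qed
  show ?thesis using p m c[of a1 a2] c[of a2 a1] c[of "- a1" "- a2"] c[of "- a2" "- a1"]
    by (auto simp: algebra_simps)
qed

text \<open>Conjugation preserves the trace of the Kronecker product and that of its square;
  determinant 1 makes the trace of C^2 equal to that of C, squared, minus 2.\<close>

lemma kron_conjugate_traces:
  fixes C1 C2 D1 D2 :: "'k::field ^ 2 ^ 2"
  assumes two: "(2::'k) \<noteq> 0" and det: "det C1 = 1" "det C2 = 1" "det D1 = 1" "det D2 = 1"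
    and Q: "invertible Q" "Q ** kron C1 C2 = kron D1 D2 ** Q"
  shows "trace C1 = trace D1 \<and> trace C2 = trace D2 \<or> trace C1 = - trace D1 \<and> trace C2 = - trace D2 \<or>
    trace C1 = trace D2 \<and> trace C2 = trace D1 \<or> trace C1 = - trace D2 \<and> trace C2 = - trace D1"
proof (rule trace_pair_cases[OF two])
  obtain R where R: "Q ** R = mat 1" "R ** Q = mat 1" using Q(1) by (auto simp: invertible_def)
  have conj: "trace X = trace Y" if "Q ** X = Y ** Q" for X Y
  proof -
    have "X = (R ** Q) ** X" using R by simp
    also have "\<dots> = R ** (Y ** Q)" unfolding that[symmetric] by (simp only: matrix_mul_assoc)
    finally have "trace X = trace ((Y ** Q) ** R)" by (metis trace_mul_sym)
    also have "(Y ** Q) ** R = Y" unfolding matrix_mul_assoc[symmetric] R by simp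
    finally show ?thesis .
  qed
  show "trace C1 * trace C2 = trace D1 * trace D2"
    using conj[OF Q(2)] by (simp only: trace_kron)
  have "Q ** (kron C1 C2 ** kron C1 C2) = (kron D1 D2 ** kron D1 D2) ** Q"
    unfolding matrix_mul_assoc Q(2) unfolding matrix_mul_assoc[symmetric] Q(2) ..
  from conj[OF this]
  show "((trace C1)\<^sup>2 - 2) * ((trace C2)\<^sup>2 - 2) = ((trace D1)\<^sup>2 - 2) * ((trace D2)\<^sup>2 - 2)"
    unfolding kron_mult trace_kron trace_square_2 det by simp
qed

lemma asym_matrix_invariants: "det (asym_matrix a) = 1" "trace (asym_matrix a) = a"
  by (simp_all add: asym_matrix_def det_2 trace_def sum_2 vector_2)

context
  fixes a1 a2 :: "'k::field"
  assumes a: "a1 \<noteq> 2" "a1 \<noteq> - 2" "a2 \<noteq> 2" "a2 \<noteq> - 2" and two: "(2::'k) \<noteq> 0"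
begin

lemma invertible_norm_form:
  assumes "r\<^sup>2 - alpha a1 * alpha a2 * s\<^sup>2 \<noteq> 0"
  shows "invertible (r \<cdot>\<^sub>m mat 1 - s \<cdot>\<^sub>m theta_matrix a1 a2)" (is "invertible (?A - ?B)")
proof -
  let ?n = "r\<^sup>2 - alpha a1 * alpha a2 * s\<^sup>2"
  have p: "(?A - ?B) ** (?A + ?B) = ?n \<cdot>\<^sub>m mat 1" "(?A + ?B) ** (?A - ?B) = ?n \<cdot>\<^sub>m mat 1"
    unfolding matrix_ring_distribs smult_mat_mult theta_matrix_square[OF a two] matrix_mul_lid matrix_mul_rid smult_mat_smult_mat
    by (simp_all add: vec_eq_iff algebra_simps power2_eq_square)
  have "(?A - ?B) ** (inverse ?n \<cdot>\<^sub>m (?A + ?B)) = mat 1" "(inverse ?n \<cdot>\<^sub>m (?A + ?B)) ** (?A - ?B) = mat 1"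
    unfolding smult_mat_mult p smult_mat_smult_mat using assms by simp_all
  then show ?thesis unfolding invertible_def by blast
qed

text \<open>If N(u)\<alpha>2 has the form x^2 - \<alpha>1 y^2, then so has N(u\<theta>) =
  -\<alpha>1\<alpha>2 N(u), since -\<alpha>1 has this form as well and such values are closed under
  products. In that case b(x, \<theta>y) takes the place of b.\<close>

lemma norm_form_congruent:
  assumes nz: "r\<^sup>2 - alpha a1 * alpha a2 * s\<^sup>2 \<noteq> 0"
    and norm: "r\<^sup>2 - alpha a1 * alpha a2 * s\<^sup>2 = x\<^sup>2 - alpha a1 * y\<^sup>2 \<or>
      (r\<^sup>2 - alpha a1 * alpha a2 * s\<^sup>2) * alpha a2 = x\<^sup>2 - alpha a1 * y\<^sup>2"
  shows "\<exists>M N :: 'k ^ 2 ^ 2. congruent_similar (form_matrix a1 a2 **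
    (r \<cdot>\<^sub>m mat 1 - s \<cdot>\<^sub>m theta_matrix a1 a2)) (kron M N)"
proof -
  let ?T = "theta_matrix a1 a2" and ?B = "form_matrix a1 a2"
  let ?d = "alpha a1 * alpha a2"
  let ?n = "r\<^sup>2 - ?d * s\<^sup>2" and ?C = "?B ** (r \<cdot>\<^sub>m mat 1 - s \<cdot>\<^sub>m ?T)"
  note al = alpha_nonzero[OF a two]
  have B: "invertible ?B" using a by (intro invertible_kron invertible_b_matrix)
  have C: "invertible ?C" by (intro invertible_mult B invertible_norm_form nz)
  from norm show ?thesis
  proof
    assume "?n = x\<^sup>2 - alpha a1 * y\<^sup>2"
    then have "congruent_similar ?B ?C"
      using relative_norm_congruent[OF a two nz _ _ C] by blast
    then show ?thesis by (blast intro: congruent_similar_sym)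
  next
    assume n: "?n * alpha a2 = x\<^sup>2 - alpha a1 * y\<^sup>2"
    have "(?d * s)\<^sup>2 - ?d * r\<^sup>2 = - alpha a1 * (?n * alpha a2)"
      by (simp add: power2_eq_square algebra_simps)
    also have "\<dots> = (alpha a1 * y)\<^sup>2 - alpha a1 * x\<^sup>2" unfolding n by (simp add: power2_eq_square algebra_simps)
    finally have norm': "(?d * s)\<^sup>2 - ?d * r\<^sup>2 = (alpha a1 * y)\<^sup>2 - alpha a1 * x\<^sup>2" .
    have "(?d * s)\<^sup>2 - ?d * r\<^sup>2 = - ?d * ?n" by (simp add: power2_eq_square algebra_simps)
    then have nz': "(?d * s)\<^sup>2 - ?d * r\<^sup>2 \<noteq> 0" using al nz by simp
    \<comment> \<open>u\<theta> = ds + r\<theta>, and \<theta> times its conjugate is -d times the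
      conjugate r - s\<theta> of u.\<close>
    have "?T ** ((?d * s) \<cdot>\<^sub>m mat 1 - r \<cdot>\<^sub>m ?T) = (- ?d) \<cdot>\<^sub>m (r \<cdot>\<^sub>m mat 1 - s \<cdot>\<^sub>m ?T)"
      unfolding matrix_ring_distribs smult_mat_mult theta_matrix_square[OF a two] matrix_mul_rid smult_mat_smult_mat
      by (simp add: vec_eq_iff algebra_simps)
    then have eq: "?B ** ?T ** ((?d * s) \<cdot>\<^sub>m mat 1 - r \<cdot>\<^sub>m ?T) = (- ?d) \<cdot>\<^sub>m ?C"
      by (simp only: matrix_mul_assoc[symmetric] smult_mat_mult)
    have "?T ** (inverse ?d \<cdot>\<^sub>m ?T) = mat 1" "(inverse ?d \<cdot>\<^sub>m ?T) ** ?T = mat 1"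
      unfolding smult_mat_mult theta_matrix_square[OF a two] smult_mat_smult_mat using al
      by (simp_all del: inverse_mult_distrib)
    then have "invertible ?T" unfolding invertible_def by blast
    then have "invertible (?B ** ?T ** ((?d * s) \<cdot>\<^sub>m mat 1 - r \<cdot>\<^sub>m ?T))"
      by (intro invertible_mult B invertible_norm_form nz')
    then have "congruent_similar (?B ** ?T) ((- ?d) \<cdot>\<^sub>m ?C)"
      using relative_norm_congruent[OF a two nz' norm', of "?B ** ?T"] unfolding eq by blast
    moreover have "congruent_similar ((- ?d) \<cdot>\<^sub>m ?C) ?C"
      using al by (intro congruent_similar_smult) simp
    ultimately show ?thesis unfolding kron_mult by (blast intro: congruent_similar_sym congruent_similar_trans)
  qed
qed

lemma kron_factors_congruent:
  assumes W: "bilinear_space W" "nondegenerate W" and dec: "decomposable W"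
    and conj: "asymmetries_conjugate W (matrix_space (form_matrix a1 a2))"
  shows "\<exists>M :: 'k ^ (2 \<times> 2) ^ (2 \<times> 2). similar W (matrix_space M) \<and>
    (congruent_similar M (form_matrix a1 a2) \<or>
     congruent_similar M (form_matrix a1 a2 ** theta_matrix a1 a2))"
proof -
  let ?B = "form_matrix a1 a2" and ?A = "kron (asym_matrix a1) (asym_matrix a2)"
  obtain \<phi> where \<phi>: "linear_iso W (matrix_space ?B) \<phi>" using conj by (auto simp: asymmetries_conjugate_def)
  obtain M N :: "'k ^ 2 ^ 2" and \<psi> where \<psi>: "linear_iso (matrix_space (kron M N)) W \<psi>"
    "\<And>v w. bform W (\<psi> v) (\<psi> w) = bform (matrix_space (kron M N)) v w"
    using decomposable_imp_kron[OF W(1) dec \<phi>] by blast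
  have "invertible (kron M N)" by (rule invertible_isometric_matrix[OF W(2) \<psi>])
  note MN = invertible_kron_factors[OF this]
  obtain C1 where C1: "M ** C1 = transpose M" "det C1 = 1" "(M $ 1 $ 2 - M $ 2 $ 1)\<^sup>2 = (2 - trace C1) * det M"
    using asymmetry_2_trace[OF MN(1)] .
  obtain C2 where C2: "N ** C2 = transpose N" "det C2 = 1" "(N $ 1 $ 2 - N $ 2 $ 1)\<^sup>2 = (2 - trace C2) * det N"
    using asymmetry_2_trace[OF MN(2)] .
  have B: "invertible ?B" "?B ** ?A = transpose ?B"
    using a by (simp_all add: invertible_kron invertible_b_matrix kron_mult b_matrix_asym_matrix transpose_kron)
  have "kron M N ** kron C1 C2 = transpose (kron M N)" by (simp add: kron_mult C1 C2 transpose_kron)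
  then obtain Q where Q: "invertible Q" "Q ** kron C1 C2 = ?A ** Q"
    using asymmetry_conjugate_matrices[OF W conj B \<psi>] by blast
  have tr: "trace C1 = a1 \<and> trace C2 = a2 \<or> trace C1 = - a1 \<and> trace C2 = - a2 \<or>
      trace C1 = a2 \<and> trace C2 = a1 \<or> trace C1 = - a2 \<and> trace C2 = - a1"
    using kron_conjugate_traces[OF two C1(2) C2(2) asym_matrix_invariants(1) asym_matrix_invariants(1) Q]
    unfolding asym_matrix_invariants(2) .
  have neg: "- a1 \<noteq> 2" "- a1 \<noteq> - 2" "- a2 \<noteq> 2" "- a2 \<noteq> - 2" using a by (metis minus_minus)+
  have M: "congruent_similar M (b_matrix c)" if "trace C1 = c" "c \<noteq> 2" "c \<noteq> - 2" for c
    by (rule congruent_similar_b_matrix[OF MN(1) C1(3)[unfolded that(1)] that(2,3)])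
  have N: "congruent_similar N (b_matrix c)" if "trace C2 = c" "c \<noteq> 2" "c \<noteq> - 2" for c
    by (rule congruent_similar_b_matrix[OF MN(2) C2(3)[unfolded that(1)] that(2,3)])
  \<comment> \<open>Twisting each plane by its \<delta> negates the trace, so planes of traces -a1
    and -a2 have product b(x, \<theta>y) up to similarity.\<close>
  have BD: "congruent_similar (kron (b_matrix (- a1)) (b_matrix (- a2))) (?B ** theta_matrix a1 a2)"
    unfolding kron_mult
    by (rule congruent_similar_sym[OF congruent_similar_kron[OF congruent_similar_b_matrix_neg
          congruent_similar_b_matrix_neg]]) (rule a)+
  have sim: "congruent_similar (kron M N) ?B \<or> congruent_similar (kron M N) (?B ** theta_matrix a1 a2)"
    using tr
  proof (elim disjE conjE)
    assume t: "trace C1 = a1" "trace C2 = a2"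
    show ?thesis using congruent_similar_kron[OF M[OF t(1) a(1,2)] N[OF t(2) a(3,4)]] ..
  next
    assume t: "trace C1 = - a1" "trace C2 = - a2"
    show ?thesis
      using congruent_similar_trans[OF congruent_similar_kron[OF M[OF t(1) neg(1,2)] N[OF t(2) neg(3,4)]] BD] ..
  next
    assume t: "trace C1 = a2" "trace C2 = a1"
    show ?thesis
      using congruent_similar_trans[OF congruent_similar_kron_swap
          congruent_similar_kron[OF N[OF t(2) a(1,2)] M[OF t(1) a(3,4)]]] ..
  next
    assume t: "trace C1 = - a2" "trace C2 = - a1"
    show ?thesis
      using congruent_similar_trans[OF congruent_similar_trans[OF congruent_similar_kron_swap
          congruent_similar_kron[OF N[OF t(2) neg(1,2)] M[OF t(1) neg(3,4)]]] BD] ..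
  qed
  have "similar W (matrix_space (kron M N))"
    unfolding similar_def
  proof (intro exI conjI ballI)
    show "linear_iso W (matrix_space (kron M N)) (inv_into UNIV \<psi>)"
      using linear_iso_inv(1)[OF bilinear_space_matrix_space \<psi>(1)] by simp
    show "bform (matrix_space (kron M N)) (inv_into UNIV \<psi> x) (inv_into UNIV \<psi> y) = 1 * bform W x y"
      if "x \<in> carr W" "y \<in> carr W" for x y
      using linear_iso_inv(3)[OF bilinear_space_matrix_space \<psi>(1)] \<psi>(2)[symmetric] that by simp
  qed simp
  then show ?thesis using sim by blast
qed

end

theorem proposition6p4:
  fixes a1 a2 :: "'f::field"
    and \<iota> :: "'f \<Rightarrow> 'e::field"
    and j :: "'e \<Rightarrow> 's::field"
    and W :: "('e, 'v::ab_group_add) bilin"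
  assumes "(2 :: 'f) \<noteq> 0"
    and "a1 \<notin> {-2, 2}" and "a2 \<notin> {-2, 2}"
    and "\<nexists>y. y\<^sup>2 = alpha a1" and "\<nexists>y. y\<^sup>2 = alpha a2"
    and "field_embedding \<iota>"
    and "separable_closure j"
    and "bilinear_space W" and "nondegenerate W"
    and "asymmetries_conjugate W (VE \<iota> a1 a2)"
  shows "nu_tilde_value \<iota> j a1 a2 W \<one>\<^bsub>nu_tilde_target \<iota> j a1 a2\<^esub> \<longleftrightarrow> decomposable W"
proof -
  note emb = assms(6) and sc = assms(7) and W = assms(8,9)
  note E = field_embedding_simps[OF emb]
  have two: "(2::'e) \<noteq> 0" using E(11)[of 2] assms(1) unfolding emb_2[OF emb] by simp
  have a: "a1 \<noteq> 2" "a2 \<noteq> 2" using assms(2,3) by auto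
  have ia: "\<iota> a1 \<noteq> 2" "\<iota> a1 \<noteq> - 2" "\<iota> a2 \<noteq> 2" "\<iota> a2 \<noteq> - 2"
    using assms(2,3) E(10) E(5) emb_2[OF emb] by (metis insertCI)+
  define \<alpha>1 \<alpha>2 where "\<alpha>1 = alpha (\<iota> a1)" and "\<alpha>2 = alpha (\<iota> a2)"
  let ?B = "form_matrix (\<iota> a1) (\<iota> a2)"
  let ?T = "theta_matrix (\<iota> a1) (\<iota> a2)"
  let ?C = "\<lambda>r s. ?B ** (r \<cdot>\<^sub>m mat 1 - s \<cdot>\<^sub>m ?T)" and ?N = "\<lambda>r s. r\<^sup>2 - \<alpha>1 * \<alpha>2 * s\<^sup>2"
  have nz: "\<alpha>1 \<noteq> 0" "\<alpha>2 \<noteq> 0" using alpha_nonzero[OF ia two] by (simp_all add: \<alpha>1_def \<alpha>2_def)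
  have d: "\<iota> (alpha a1 * alpha a2) = \<alpha>1 * \<alpha>2" "\<iota> (alpha a1) = \<alpha>1" "\<iota> (alpha a2) = \<alpha>2"
    by (simp_all add: E emb_alpha[OF emb] \<alpha>1_def \<alpha>2_def)
  have triv: "nu_tilde_unit \<iota> j a1 a2 (r, s) = \<one>\<^bsub>nu_tilde_target \<iota> j a1 a2\<^esub> \<longleftrightarrow>
      symbol j \<alpha>1 (?N r s) \<in> coboundaries2 j \<or>
      symbol j \<alpha>1 (?N r s * \<alpha>2) \<in> coboundaries2 j"
    if "?N r s \<noteq> 0" for r s
    using nu_tilde_unit_trivial_iff[OF sc two, of \<iota> a1 a2 "(r, s)"] nz that unfolding d qnorm_eq by blast
  have twisted: "congruent_similar (inverse (?N r s) \<cdot>\<^sub>m (?C r s))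
      (?C r s)"
    "twisted_space \<iota> a1 a2 (r, s) =
      matrix_space (inverse (?N r s) \<cdot>\<^sub>m (?C r s))"
    if "?N r s \<noteq> 0" for r s
    using that twisted_space_eq[OF emb a, of r s] unfolding d qnorm_eq
    by (auto intro: congruent_similar_smult)
  show ?thesis
  proof
    assume "nu_tilde_value \<iota> j a1 a2 W \<one>\<^bsub>nu_tilde_target \<iota> j a1 a2\<^esub>"
    then obtain r s where u: "qunit (\<alpha>1 * \<alpha>2) (r, s)" "similar W (twisted_space \<iota> a1 a2 (r, s))"
      "nu_tilde_unit \<iota> j a1 a2 (r, s) = \<one>\<^bsub>nu_tilde_target \<iota> j a1 a2\<^esub>"
      unfolding nu_tilde_value_def d by (metis surj_pair)
    let ?n = "?N r s"
    have n: "?n \<noteq> 0" using qunit_imp_qnorm_nonzero[OF u(1)] unfolding qnorm_eq .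
    have sym: "\<exists>x y. b = x\<^sup>2 - \<alpha>1 * y\<^sup>2" if "symbol j \<alpha>1 b \<in> coboundaries2 j" "b \<noteq> 0" for b
      using symbol_trivial_imp_norm[OF sc two nz(1) that(2,1)] .
    have "\<exists>x y. ?n = x\<^sup>2 - \<alpha>1 * y\<^sup>2 \<or> ?n * \<alpha>2 = x\<^sup>2 - \<alpha>1 * y\<^sup>2"
      using u(3) sym[of ?n] sym[of "?n * \<alpha>2"] n nz unfolding triv[OF n] by auto
    then obtain M N :: "'e ^ 2 ^ 2" where "congruent_similar (?C r s) (kron M N)"
      using norm_form_congruent[OF ia two] n unfolding \<alpha>1_def \<alpha>2_def by blast
    then have "similar (twisted_space \<iota> a1 a2 (r, s)) (matrix_space (kron M N))"
      unfolding twisted(2)[OF n]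
      using congruent_similar_trans[OF twisted(1)[OF n]] congruent_similar_imp_similar by blast
    then have "similar W (matrix_space (kron M N))" using similar_trans u(2) by blast
    then show "decomposable W" by (rule similar_kron_imp_decomposable[OF W(1)])
  next
    assume "decomposable W"
    then obtain M where M: "similar W (matrix_space M)"
      "congruent_similar M ?B \<or> congruent_similar M (?B ** ?T)"
      using kron_factors_congruent[OF ia two W] assms(10) unfolding VE_eq[OF emb] by blast
    have val: "nu_tilde_value \<iota> j a1 a2 W \<one>\<^bsub>nu_tilde_target \<iota> j a1 a2\<^esub>"
      if n: "?N r s \<noteq> 0" and c: "congruent_similar M (?C r s)"
        and t: "symbol j \<alpha>1 (?N r s) \<in> coboundaries2 j \<or>
          symbol j \<alpha>1 (?N r s * \<alpha>2) \<in> coboundaries2 j" for r s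
    proof -
      have "qunit (\<alpha>1 * \<alpha>2) (r, s)" by (rule qunitI) (use n in \<open>unfold qnorm_eq\<close>)
      moreover have "similar W (twisted_space \<iota> a1 a2 (r, s))"
        unfolding twisted(2)[OF n]
        using M(1) c twisted(1)[OF n] congruent_similar_imp_similar congruent_similar_trans congruent_similar_sym
          similar_trans by blast
      ultimately show ?thesis unfolding nu_tilde_value_def d using triv[OF n] t by metis
    qed
    from M(2) show "nu_tilde_value \<iota> j a1 a2 W \<one>\<^bsub>nu_tilde_target \<iota> j a1 a2\<^esub>"
    proof
      \<comment> \<open>The witness is the unit u = 1.\<close>
      assume "congruent_similar M ?B"
      moreover have "1 \<cdot>\<^sub>m mat 1 - 0 \<cdot>\<^sub>m ?T = mat 1" by (simp add: vec_eq_iff)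
      moreover have "symbol j \<alpha>1 1 \<in> coboundaries2 j" by (rule symbol_trivial_1[OF sc two])
      ultimately show ?thesis by (intro val[of 1 0]) simp_all
    next
      assume c: "congruent_similar M (?B ** ?T)"
      \<comment> \<open>The witness is u = \<theta>, whose conjugate is -\<theta>; this accounts for
        the sign.\<close>
      have "?C 0 1 = (- 1) \<cdot>\<^sub>m (?B ** ?T)"
        unfolding matrix_ring_distribs smult_mat_mult by (simp add: vec_eq_iff)
      then have "congruent_similar (?C 0 1) (?B ** ?T)"
        using congruent_similar_smult[of "- 1" "?B ** ?T"] by simp
      then have "congruent_similar M (?C 0 1)"
        using c congruent_similar_trans congruent_similar_sym by blast
      \<comment> \<open>N(\<theta>)\<alpha>2 = -\<alpha>1\<alpha>2^2, and the square does not affect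
        the symbol, so the second alternative of \<open>triv\<close> applies.\<close>
      moreover have "symbol j \<alpha>1 (?N 0 1 * \<alpha>2) = symbol j \<alpha>1 (- \<alpha>1)"
      proof -
        have e: "?N 0 1 * \<alpha>2 = - \<alpha>1 * \<alpha>2\<^sup>2" by (simp add: power2_eq_square)
        show ?thesis
          unfolding e symbol_def extend2_cong_iff
        proof (intro ballI)
          fix \<sigma> \<tau> assume t: "\<tau> \<in> galois j"
          have "kummer j (- \<alpha>1 * \<alpha>2\<^sup>2) \<tau> = kummer j (- \<alpha>1) \<tau> + kummer j (\<alpha>2\<^sup>2) \<tau>"
            using nz by (intro kummer_mult[OF sc two _ _ t]) auto
          then show "kummer j \<alpha>1 \<sigma> * kummer j (- \<alpha>1 * \<alpha>2\<^sup>2) \<tau> = kummer j \<alpha>1 \<sigma> * kummer j (- \<alpha>1) \<tau>"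
            by (simp only: kummer_square[OF sc two t] add_0_right)
        qed
      qed
      moreover have "symbol j \<alpha>1 (- \<alpha>1) \<in> coboundaries2 j" by (rule symbol_trivial_neg[OF sc two nz(1)])
      ultimately show ?thesis using nz by (intro val[of 0 1]) simp_all
    qed
  qed
qed

end
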